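(* Let $P$ be a hereditary planar polyhedral complex (a hereditary $2$-dimensional polyhedral complex embedded in $\mathbb{R}^2$) and let $r\ge 0$ be an integer. Then $$HP(C^r(\hat P),k)=\frac{f_2}{2}k^2+\frac{3f_2-2(r+1)f_1^0}{2}k+f_2+\Big(\binom{r}{2}-1\Big)f_1^0+\sum_{\xi}\ \sum_{\psi\in H_1(G_{\xi}(P))}c_\psi,$$ where $\xi$ runs over the codimension-$2$ linear subspaces of $\mathbb{R}^3$ (only finitely many contribute), and $$c_\psi=1-n(\psi)\binom{r}{2}+s_1(\psi)\binom{r+\alpha(\psi)}{2}+s_2(\psi)\binom{r+\alpha(\psi)+1}{2}$$ $$=\binom{r+2}{2}+\frac{\alpha(\psi)}{2}\Big(2r+3+\alpha(\psi)-n(\psi)\big(1+\alpha(\psi)\big)\Big).$$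
   Context: $P$ is a finite $2$-dimensional polyhedral complex (its faces are convex polytopes) embedded in $\mathbb{R}^2$. The dual graph of such a complex has the $2$-faces as vertices, two being joined by an edge iff they meet in a $1$-face. The star of a face $\sigma$ is the set of faces $\tau$ such that some face of $P$ contains both $\tau$ and $\sigma$. $P$ is hereditary: for every nonempty face $\sigma$ of $P$ the dual graph of the star of $\sigma$ is connected. $P_2$ is the set of $2$-faces, $f_2=|P_2|$; $P_1^0$ is the set of interior edges (each lies in exactly two $2$-faces), $f_1^0=|P_1^0|$. Embed $P$ in the plane $x_3=1$ of $\mathbb{R}^3$ and let $\hat P$ be the cone over $P$ with vertex at the origin. Let $R=\mathbb{R}[x_1,x_2,x_3]$. For an edge $\tau$ of $P$, $l_\tau\in R$ is a nonzero homogeneous linear form vanishing on the cone over $\tau$; the linear span of $\tau$ means the plane $V(l_\tau)\subset\mathbb{R}^3$. $C^r(\hat P)$ is the graded $R$-module of tuples $(f_\sigma)_{\sigma\in P_2}\in R^{f_2}$ such that $l_\tau^{r+1}$ divides $f_{\sigma_1}-f_{\sigma_2}$ whenever $\sigma_1,\sigma_2\in P_2$ share the edge $\tau$; its degree-$k$ piece has the dimension of the space $C^r_k(P)$ of $C^r$ splines on $P$ of degree at most $k$. $HP(C^r(\hat P),k)$ is its Hilbert polynomial: the polynomial in $k$ equal to $\dim_{\mathbb{R}}C^r(\hat P)_k=\dim_{\mathbb{R}} C^r_k(P)$ for $k\gg0$. For a codimension-$2$ linear subspace $\xi\subset\mathbb{R}^3$ (a line through the origin; a point of $\mathbb{R}^2$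 corresponds to the line through it in the plane $x_3=1$), $G_\xi(P)$ is the graph whose vertices are those $\sigma\in P_2$ having an edge whose linear span contains $\xi$, two vertices being joined by an edge iff the corresponding $2$-faces share a common edge of $P$ whose linear span contains $\xi$ (the graph edge corresponds to this edge of $P$). The notation $\psi\in H_1(G_\xi(P))$ means that $\psi$ is a connected component of $G_\xi(P)$ homotopic to a circle $S^1$. For such $\psi$, $I_\psi=\langle l_\tau^{r+1}\mid\tau\in P_1^0\text{ corresponds to an edge of }\psi\rangle\subset R$, $n=n(\psi)$ is the minimal number of generators of $I_\psi$, and $$\alpha(\psi)=\Big\lfloor\frac{r+1}{n-1}\Big\rfloor,\quad s_1(\psi)=(n-1)\alpha(\psi)+n-r-2,\quad s_2(\psi)=r+1-(n-1)\alpha(\psi).$$ Here $\binom{m}{2}=m(m-1)/2$. *)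

theory Defs
  imports
    "HOL-Analysis.Analysis"
    "HOL-Library.Poly_Mapping"
    "HOL-Library.Numeral_Type"
    "HOL-Library.Function_Algebras"
    "Graph_Theory.Graph_Theory"
begin

section \<open>Planar polyhedral complexes\<close>

text \<open>
  Since \<^const>\<open>face_of\<close> admits the empty set as a face, the empty set is a
  member of every complex.
\<close>

definition planar_polyhedral_complex :: "(real^2) set set \<Rightarrow> bool" where
  "planar_polyhedral_complex P \<longleftrightarrow>
     finite P \<and>
     (\<forall>\<sigma>\<in>P. polytope \<sigma>) \<and>
     (\<forall>\<sigma>\<in>P. \<forall>\<tau>. \<tau> face_of \<sigma> \<longrightarrow> \<tau> \<in> P) \<and>
     (\<forall>\<sigma>\<in>P. \<forall>\<tau>\<in>P. (\<sigma> \<inter> \<tau>) face_of \<sigma> \<and> (\<sigma> \<inter> \<tau>) face_of \<tau>) \<and>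
     (\<exists>\<sigma>\<in>P. aff_dim \<sigma> = 2)"

definition faces_of_dim :: "int \<Rightarrow> (real^2) set set \<Rightarrow> (real^2) set set" where
  "faces_of_dim d P = {\<sigma>\<in>P. aff_dim \<sigma> = d}"

definition interior_edges :: "(real^2) set set \<Rightarrow> (real^2) set set" where
  "interior_edges P = {\<tau>\<in>faces_of_dim 1 P. card {\<sigma>\<in>faces_of_dim 2 P. \<tau> edge_of \<sigma>} = 2}"

definition star :: "(real^2) set set \<Rightarrow> (real^2) set \<Rightarrow> (real^2) set set" where
  "star P \<sigma> = {\<tau>\<in>P. \<exists>\<rho>\<in>P. \<tau> \<subseteq> \<rho> \<and> \<sigma> \<subseteq> \<rho>}"

text \<open>
  Undirected graphs are encoded, as in the graph library, by symmetric arc relations.  The library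
  does not count the empty graph as connected, so hereditary complexes are pure.
\<close>

definition dual_graph :: "(real^2) set set \<Rightarrow> (real^2) set pair_pre_digraph" where
  "dual_graph S =
     \<lparr> pverts = faces_of_dim 2 S,
       parcs = {(\<sigma>1, \<sigma>2). \<sigma>1 \<in> faces_of_dim 2 S \<and> \<sigma>2 \<in> faces_of_dim 2 S \<and>
                          \<sigma>1 \<inter> \<sigma>2 \<in> faces_of_dim 1 S} \<rparr>"

definition hereditary :: "(real^2) set set \<Rightarrow> bool" where
  "hereditary P \<longleftrightarrow>
     (\<forall>\<sigma>\<in>P. \<sigma> \<noteq> {} \<longrightarrow> Digraph_Component.connected (with_proj (dual_graph (star P \<sigma>))))"


section \<open>The polynomial ring in three variables\<close>

type_synonym poly3 = "(3 \<Rightarrow>\<^sub>0 nat) \<Rightarrow>\<^sub>0 real"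

definition const3 :: "real \<Rightarrow> poly3" where
  "const3 c = Poly_Mapping.single 0 c"

definition eval3 :: "poly3 \<Rightarrow> real^3 \<Rightarrow> real" where
  "eval3 p x = (\<Sum>m\<in>Poly_Mapping.keys p.
     Poly_Mapping.lookup p m * (\<Prod>i\<in>UNIV. (x $ i) ^ Poly_Mapping.lookup m i))"

definition homogeneous :: "nat \<Rightarrow> poly3 \<Rightarrow> bool" where
  "homogeneous k p \<longleftrightarrow>
     (\<forall>m\<in>Poly_Mapping.keys p. (\<Sum>i\<in>UNIV. Poly_Mapping.lookup m i) = k)"

definition zero_locus :: "poly3 \<Rightarrow> (real^3) set" where
  "zero_locus p = {x. eval3 p x = 0}"

definition ideal_gen :: "poly3 set \<Rightarrow> poly3 set" where
  "ideal_gen S = module.span (*) S"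

definition min_gens :: "poly3 set \<Rightarrow> nat" where
  "min_gens I = (LEAST n. \<exists>S. finite S \<and> card S = n \<and> ideal_gen S = I)"


section \<open>Splines on the cone over a complex\<close>

definition embed :: "real^2 \<Rightarrow> real^3" where
  "embed x = vector [x $ 1, x $ 2, 1]"

definition cone_over :: "(real^2) set \<Rightarrow> (real^3) set" where
  "cone_over \<sigma> = cone hull (embed ` \<sigma>)"

text \<open>The forms are determined up to nonzero scalars; a choice of them is a parameter below.\<close>

definition edge_forms :: "(real^2) set set \<Rightarrow> ((real^2) set \<Rightarrow> poly3) \<Rightarrow> bool" where
  "edge_forms P l \<longleftrightarrow>
     (\<forall>\<tau>\<in>faces_of_dim 1 P. l \<tau> \<noteq> 0 \<and> homogeneous 1 (l \<tau>) \<and> cone_over \<tau> \<subseteq> zero_locus (l \<tau>))"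

text \<open>
  A tuple indexed by the 2-faces is a function on all sets that vanishes off the 2-faces, so that
  distinct functions represent distinct tuples.
\<close>

definition splines ::
  "nat \<Rightarrow> (real^2) set set \<Rightarrow> ((real^2) set \<Rightarrow> poly3) \<Rightarrow> ((real^2) set \<Rightarrow> poly3) set" where
  "splines r P l =
     {f. (\<forall>\<sigma>. \<sigma> \<notin> faces_of_dim 2 P \<longrightarrow> f \<sigma> = 0) \<and>
         (\<forall>\<sigma>1\<in>faces_of_dim 2 P. \<forall>\<sigma>2\<in>faces_of_dim 2 P. \<forall>\<tau>.
            \<tau> edge_of \<sigma>1 \<and> \<tau> edge_of \<sigma>2 \<longrightarrow> l \<tau> ^ (r + 1) dvd f \<sigma>1 - f \<sigma>2)}"

definition splines_deg ::
  "nat \<Rightarrow> (real^2) set set \<Rightarrow> ((real^2) set \<Rightarrow> poly3) \<Rightarrow> nat \<Rightarrow> ((real^2) set \<Rightarrow> poly3) set" where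
  "splines_deg r P l k = {f\<in>splines r P l. \<forall>\<sigma>. homogeneous k (f \<sigma>)}"

definition tuple_scale :: "real \<Rightarrow> ('a \<Rightarrow> poly3) \<Rightarrow> 'a \<Rightarrow> poly3" where
  "tuple_scale c f = (\<lambda>\<sigma>. const3 c * f \<sigma>)"

interpretation tuple: vector_space tuple_scale
  by unfold_locales
    (auto simp: tuple_scale_def const3_def fun_eq_iff algebra_simps single_add mult_single
                simp flip: mult.assoc)

definition spline_dim ::
  "nat \<Rightarrow> (real^2) set set \<Rightarrow> ((real^2) set \<Rightarrow> poly3) \<Rightarrow> nat \<Rightarrow> nat" where
  "spline_dim r P l k = tuple.dim (splines_deg r P l k)"

definition is_hilbert_polynomial :: "(nat \<Rightarrow> nat) \<Rightarrow> real poly \<Rightarrow> bool" where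
  "is_hilbert_polynomial H p \<longleftrightarrow> (\<forall>\<^sub>F k in sequentially. poly p (real k) = real (H k))"

definition hilbert_polynomial :: "(nat \<Rightarrow> nat) \<Rightarrow> real poly" where
  "hilbert_polynomial H = (THE p. is_hilbert_polynomial H p)"


section \<open>The graphs attached to codimension-two subspaces\<close>

definition codim2 :: "(real^3) set \<Rightarrow> bool" where
  "codim2 \<xi> \<longleftrightarrow> subspace \<xi> \<and> dim \<xi> + 2 = DIM(real^3)"

definition xi_graph ::
  "(real^2) set set \<Rightarrow> ((real^2) set \<Rightarrow> poly3) \<Rightarrow> (real^3) set \<Rightarrow> (real^2) set pair_pre_digraph" where
  "xi_graph P l \<xi> =
     \<lparr> pverts = {\<sigma>\<in>faces_of_dim 2 P. \<exists>\<tau>. \<tau> edge_of \<sigma> \<and> \<xi> \<subseteq> zero_locus (l \<tau>)},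
       parcs = {(\<sigma>1, \<sigma>2). \<sigma>1 \<in> faces_of_dim 2 P \<and> \<sigma>2 \<in> faces_of_dim 2 P \<and> \<sigma>1 \<noteq> \<sigma>2 \<and>
                  (\<exists>\<tau>. \<tau> edge_of \<sigma>1 \<and> \<tau> edge_of \<sigma>2 \<and> \<xi> \<subseteq> zero_locus (l \<tau>))} \<rparr>"

text \<open>
  The geometric realization of a finite graph without parallel edges: each vertex \<open>v\<close> is sent to
  the \<open>v\<close>-th unit vector and each edge to the segment joining its ends.  The two orientations of
  an undirected edge yield the same segment.
\<close>

definition realization :: "('a, 'b) pre_digraph \<Rightarrow> ('a \<Rightarrow> real) topology" where
  "realization G = top_of_set
     ({indicator {v} |v. v \<in> verts G} \<union>
      {\<lambda>u. (1 - t) * indicator {tail G a} u + t * indicator {head G a} u |a t.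
         a \<in> arcs G \<and> t \<in> {0..1}})"

text \<open>In a symmetric digraph the strongly connected components are the connected components.\<close>

definition circle_components ::
  "(real^2) set set \<Rightarrow> ((real^2) set \<Rightarrow> poly3) \<Rightarrow> (real^3) set \<Rightarrow>
     ((real^2) set, (real^2) set \<times> (real^2) set) pre_digraph set" where
  "circle_components P l \<xi> =
     {\<psi>\<in>pre_digraph.sccs (with_proj (xi_graph P l \<xi>)).
        realization \<psi> homotopy_equivalent_space top_of_set (sphere (0::real^2) 1)}"

definition psi_ideal ::
  "nat \<Rightarrow> (real^2) set set \<Rightarrow> ((real^2) set \<Rightarrow> poly3) \<Rightarrow> (real^3) set \<Rightarrow>
     ((real^2) set, (real^2) set \<times> (real^2) set) pre_digraph \<Rightarrow> poly3 set" where
  "psi_ideal r P l \<xi> \<psi> = ideal_gen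
     {l \<tau> ^ (r + 1) |\<tau>. \<tau> \<in> interior_edges P \<and>
        (\<exists>(\<sigma>1, \<sigma>2)\<in>arcs \<psi>. \<tau> edge_of \<sigma>1 \<and> \<tau> edge_of \<sigma>2 \<and> \<xi> \<subseteq> zero_locus (l \<tau>))}"


section \<open>The constants\<close>

definition alpha :: "nat \<Rightarrow> nat \<Rightarrow> int" where
  "alpha r n = \<lfloor>(real r + 1) / (real n - 1)\<rfloor>"

definition s1 :: "nat \<Rightarrow> nat \<Rightarrow> int" where
  "s1 r n = (int n - 1) * alpha r n + int n - int r - 2"

definition s2 :: "nat \<Rightarrow> nat \<Rightarrow> int" where
  "s2 r n = int r + 1 - (int n - 1) * alpha r n"

definition c_const :: "nat \<Rightarrow> nat \<Rightarrow> real" where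
  "c_const r n =
     1 - real n * (real r gchoose 2)
       + s1 r n * ((real r + alpha r n) gchoose 2)
       + s2 r n * ((real r + alpha r n + 1) gchoose 2)"

end

theory Submission
  imports Defs
begin

text \<open>
  By rank--nullity, the dimension of the splines of degree \<open>k\<close> is determined by that of the module
  of relations: the tuples indexed by the interior edges that are congruent, modulo the powers
  \<open>l\<^sub>\<tau>\<^sup>r\<^sup>+\<^sup>1\<close>, to the differences of some tuple indexed by the 2-faces. In large degree its cokernel is
  concentrated at the finitely many points \<open>\<xi>\<close> where edge lines meet, since the product of the
  powers whose forms do not vanish at \<open>\<xi>\<close> is invertible near \<open>\<xi>\<close>. A convex polygon has at most two
  edges on lines through \<open>\<xi>\<close>, so each component of the graph at \<open>\<xi>\<close> is a path or a cycle. Along a path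
  every edge variable is a relation, while a cycle \<open>\<psi>\<close> contributes \<open>R / I\<^sub>\<psi>\<close>. The ideal \<open>I\<^sub>\<psi>\<close> is generated by
  powers of linear forms in two variables, which are as independent as the dimensions permit
  (Hermite interpolation); this yields the multiplicity of \<open>R / I\<^sub>\<psi>\<close>.
\<close>

section \<open>Linear algebra\<close>

text \<open>Where the coefficients come from: with B(d) the number of monomials of degree d, the
  splines of degree k have dimension f2 B(k) + f10 B(k - r - 1) minus the rank of the difference
  map, and this rank falls short of f10 B(k) by exactly the sum of the c_\<psi>. Measuring that
  defect is the whole difficulty. Localization at \<xi> is imitated by multiplying with
  \<open>away \<xi>\<close>, at the price of a degree shift: surviving classes are represented by
  \<open>away \<xi>\<close> times a complement of I_\<psi> in degree k - deg
  \<open>away \<xi>\<close>. The shift is harmless because R / I_\<psi> has the same dimension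
  c_\<psi> in all large degrees. Representatives of different cycles do not interfere, since
  \<open>away \<xi>\<close> is a nonzerodivisor modulo the ideals of cycles at \<xi> and lies in
  those of cycles at other points. The floor in \<alpha>: m lines through \<xi> leave r + 1 - (m -
  1) s binary forms of degree r + s uncovered, and this stays nonnegative up to s = (r + 1) div (m -
  1).\<close>

context vector_space begin

text \<open>The classes of the \<open>g j\<close> form a basis of V/U; the quotient itself is never
  formed. An indexed family instead of a set of vectors spares the callers an injectivity proof,
  since injectivity follows from \<open>indep\<close>.\<close>

lemma dim_mod_family:
  assumes U: "subspace U" and V: "subspace V" and fin: "finite T" "V \<subseteq> span T" and UV: "U \<subseteq> V"
    and J: "finite J" "\<And>j. j \<in> J \<Longrightarrow> g j \<in> V"
    and span: "\<And>v. v \<in> V \<Longrightarrow> \<exists>c. v - (\<Sum>j\<in>J. scale (c j) (g j)) \<in> U"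
    and indep: "\<And>c. (\<Sum>j\<in>J. scale (c j) (g j)) \<in> U \<Longrightarrow> \<forall>j\<in>J. c j = 0"
  shows "dim V = dim U + card J"
proof -
  obtain B where B: "B \<subseteq> U" "independent B" "U \<subseteq> span B" "card B = dim U"
    using basis_exists by blast
  have finB: "finite B"
    using independent_span_bound[OF fin(1) B(2)] B(1) UV fin(2) by blast
  have notU: "g j \<notin> U" if "j \<in> J" for j
  proof
    assume "g j \<in> U"
    moreover have "(\<Sum>i\<in>J. scale (if i = j then 1 else 0) (g i)) = g j"
      using that J(1) by (simp add: if_distrib[of "\<lambda>c. scale c _"] cong: if_cong)
    ultimately have "\<forall>i\<in>J. (if i = j then 1 else 0) = (0::'a)"
      by (intro indep) metis
    then show False using that by auto
  qed
  have inj: "inj_on g J"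
  proof (rule inj_onI, rule ccontr)
    fix i j assume ij: "i \<in> J" "j \<in> J" "g i = g j" "i \<noteq> j"
    have "(\<Sum>k\<in>J. scale (if k = i then 1 else if k = j then - 1 else 0) (g k))
        = (\<Sum>k\<in>{i,j}. scale (if k = i then 1 else if k = j then - 1 else 0) (g k))"
      using ij J(1) by (intro sum.mono_neutral_right) auto
    also have "\<dots> = 0" using ij by simp
    finally have "(\<Sum>k\<in>J. scale (if k = i then 1 else if k = j then - 1 else 0) (g k)) \<in> U"
      using subspace_0[OF U] by simp
    from indep[OF this] ij show False by (auto dest: bspec[of _ _ i])
  qed
  have disj: "B \<inter> g ` J = {}" using B(1) notU by auto
  have ind: "independent (B \<union> g ` J)"
  proof (rule independent_if_scalars_zero)
    show "finite (B \<union> g ` J)" using finB J(1) by simp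
    fix f x assume f: "(\<Sum>x\<in>B \<union> g ` J. scale (f x) x) = 0" and x: "x \<in> B \<union> g ` J"
    have eq: "(\<Sum>x\<in>B. scale (f x) x) + (\<Sum>j\<in>J. scale (f (g j)) (g j)) = 0"
      using f by (simp add: sum.union_disjoint[OF finB _ disj] J(1) sum.reindex[OF inj] o_def)
    have inU: "(\<Sum>x\<in>B. scale (f x) x) \<in> U"
      using B(1) by (auto intro!: subspace_sum[OF U] subspace_scale[OF U])
    have "(\<Sum>j\<in>J. scale (f (g j)) (g j)) = - (\<Sum>x\<in>B. scale (f x) x)"
      using eq by (simp add: eq_neg_iff_add_eq_0 add.commute)
    with inU have "(\<Sum>j\<in>J. scale (f (g j)) (g j)) \<in> U" using subspace_neg[OF U] by simp
    then have z: "\<forall>j\<in>J. f (g j) = 0" by (rule indep)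
    then have "(\<Sum>x\<in>B. scale (f x) x) = 0" using eq by simp
    then have "\<forall>x\<in>B. f x = 0" using independentD[OF B(2) finB order_refl, of f] by blast
    with z x show "f x = 0" by auto
  qed
  have sp: "V \<subseteq> span (B \<union> g ` J)"
  proof
    fix v assume "v \<in> V"
    then obtain c where "v - (\<Sum>j\<in>J. scale (c j) (g j)) \<in> U" using span by blast
    then have "v - (\<Sum>j\<in>J. scale (c j) (g j)) \<in> span (B \<union> g ` J)"
      using B(3) span_mono[of B "B \<union> g ` J"] by blast
    moreover have "(\<Sum>j\<in>J. scale (c j) (g j)) \<in> span (B \<union> g ` J)"
      by (intro span_sum span_scale span_base) auto
    ultimately show "v \<in> span (B \<union> g ` J)" using span_add by fastforce
  qed
  have "dim V = card (B \<union> g ` J)"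
    using sp B(1) UV J(2) by (intro basis_card_eq_dim[symmetric] ind) auto
  also have "\<dots> = dim U + card J"
    using card_Un_disjoint[OF finB _ disj] J(1) card_image[OF inj] B(4) by simp
  finally show ?thesis .
qed

lemma dim_family:
  assumes "finite J" "\<And>c. (\<Sum>j\<in>J. scale (c j) (g j)) = 0 \<Longrightarrow> \<forall>j\<in>J. c j = 0"
  shows "dim (span (g ` J)) = card J"
proof -
  have ex: "\<exists>c. v - (\<Sum>j\<in>J. scale (c j) (g j)) \<in> {0}" if "v \<in> span (g ` J)" for v
    using that
  proof (induction rule: span_induct_alt)
    case base
    show ?case by (rule exI[of _ "\<lambda>_. 0"]) simp
  next
    case (step c x y)
    then obtain d j where d: "y = (\<Sum>j\<in>J. scale (d j) (g j))" and j: "j \<in> J" "x = g j" by auto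
    have "scale c x + y = (\<Sum>i\<in>J. scale (d i + (if i = j then c else 0)) (g i))"
      using j assms(1) by (simp add: d scale_left_distrib sum.distrib if_distrib[of "\<lambda>c. scale c _"] add.commute
          cong: if_cong)
    then show ?case by (intro exI[of _ "\<lambda>i. d i + (if i = j then c else 0)"]) simp
  qed
  have "dim (span (g ` J)) = dim {0} + card J"
  proof (rule dim_mod_family[where T="g ` J" and g=g])
    show "\<exists>c. v - (\<Sum>j\<in>J. scale (c j) (g j)) \<in> {0}" if "v \<in> span (g ` J)" for v
      by (rule ex[OF that])
    show "\<forall>j\<in>J. c j = 0" if "(\<Sum>j\<in>J. scale (c j) (g j)) \<in> {0}" for c
      using assms(2)[of c] that by simp
  qed (use assms(1) in \<open>auto intro: span_base span_zero\<close>)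
  moreover have "dim {0} = 0"
    using dim_eq_card[of "{}" "{0}"] independent_empty by (simp add: span_eq_iff)
  ultimately show ?thesis by simp
qed

text \<open>When a basis of U is extended to one of V, the added vectors represent a basis of
  V/U.\<close>

lemma complement_family:
  assumes U: "subspace U" and V: "subspace V" and fin: "finite T" "V \<subseteq> span T" and UV: "U \<subseteq> V"
  obtains S where "finite S" "S \<subseteq> V" "card S + dim U = dim V"
    "\<And>v. v \<in> V \<Longrightarrow> \<exists>c. v - (\<Sum>s\<in>S. scale (c s) s) \<in> U"
    "\<And>c. (\<Sum>s\<in>S. scale (c s) s) \<in> U \<Longrightarrow> \<forall>s\<in>S. c s = 0"
proof -
  obtain B where B: "B \<subseteq> U" "independent B" "U \<subseteq> span B" "card B = dim U"
    using basis_exists by blast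
  obtain C where C: "B \<subseteq> C" "C \<subseteq> V" "independent C" "V \<subseteq> span C"
    using maximal_independent_subset_extend[of B V] B UV by blast
  have finC: "finite C" using independent_span_bound[OF fin(1) C(3)] C(2) fin(2) by blast
  have finB: "finite B" using finC C(1) finite_subset by blast
  have UB: "U = span B" using B(1,3) U span_minimal by blast
  show ?thesis
  proof
    show "finite (C - B)" "C - B \<subseteq> V" using finC C by auto
    have "dim V = card C" using C by (intro basis_card_eq_dim[symmetric]) auto
    then show "card (C - B) + dim U = dim V"
      using B(4) C(1) finB finC card_mono[OF finC C(1)] by (simp add: card_Diff_subset)
    fix v assume "v \<in> V"
    then have "v \<in> span C" using C(4) by blast
    then obtain c where c: "v = (\<Sum>x\<in>C. scale (c x) x)" by (auto simp: span_finite[OF finC])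
    have "v - (\<Sum>s\<in>C - B. scale (c s) s) = (\<Sum>x\<in>B. scale (c x) x)"
      using sum.subset_diff[OF C(1) finC, of "\<lambda>x. scale (c x) x"] c by simp
    then show "\<exists>c. v - (\<Sum>s\<in>C - B. scale (c s) s) \<in> U"
      using UB by (metis (no_types, lifting) span_base span_scale span_sum)
  next
    fix c assume "(\<Sum>s\<in>C - B. scale (c s) s) \<in> U"
    then obtain d where d: "(\<Sum>s\<in>C - B. scale (c s) s) = (\<Sum>x\<in>B. scale (d x) x)"
      by (auto simp: UB span_finite[OF finB])
    have "(\<Sum>x\<in>C. scale (if x \<in> B then - d x else c x) x)
        = (\<Sum>x\<in>C - B. scale (c x) x) + (\<Sum>x\<in>B. scale (- d x) x)"
      by (subst sum.subset_diff[OF C(1) finC]) simp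
    also have "\<dots> = 0" by (simp add: d sum_negf)
    finally have "\<forall>x\<in>C. (if x \<in> B then - d x else c x) = 0"
      using independentD[OF C(3) finC order_refl, of "\<lambda>x. if x \<in> B then - d x else c x"] by blast
    then show "\<forall>s\<in>C - B. c s = 0" by (metis DiffE)
  qed
qed

lemma subspace_le_of_dim_le:
  assumes "subspace U" "subspace V" "finite T" "V \<subseteq> span T" "U \<subseteq> V" "dim V \<le> dim U"
  shows "V \<subseteq> U"
proof
  fix v assume v: "v \<in> V"
  obtain S where S: "finite S" "card S + dim U = dim V"
    "\<And>v. v \<in> V \<Longrightarrow> \<exists>c. v - (\<Sum>s\<in>S. scale (c s) s) \<in> U"
    using complement_family[OF assms(1-5)] by metis
  have "card S = 0" using S(2) assms(6) by linarith
  then have "S = {}" using S(1) by simp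
  with S(3)[OF v] show "v \<in> U" by simp
qed

end

text \<open>Lifts of a basis of the image form a basis of V modulo the kernel. Spaces of polynomial
  tuples are infinite-dimensional, so finiteness is asked of V alone.\<close>

lemma (in vector_space_pair) rank_nullity:
  assumes lin: "Vector_Spaces.linear s1 s2 f" and V: "vs1.subspace V" and fin: "finite T" "V \<subseteq> vs1.span T"
  shows "vs1.dim V = vs1.dim {x\<in>V. f x = 0} + vs2.dim (f ` V)"
proof -
  interpret Vector_Spaces.linear s1 s2 f by (rule lin)
  have subI: "vs2.subspace (f ` V)" by (rule subspace_image[OF V])
  obtain B where B: "B \<subseteq> f ` V" "vs2.independent B" "f ` V \<subseteq> vs2.span B" "card B = vs2.dim (f ` V)"
    using vs2.basis_exists by blast
  have "f ` V \<subseteq> vs2.span (f ` T)" using fin(2) by (metis image_mono span_image)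
  then have finB: "finite B" using B fin(1) vs2.independent_span_bound[of "f ` T" B] by blast
  obtain g where g: "\<And>b. b \<in> B \<Longrightarrow> g b \<in> V \<and> f (g b) = b"
    using B(1) by (metis (no_types, lifting) image_iff subsetD)
  have fs: "f (\<Sum>j\<in>B. s1 (c j) (g j)) = (\<Sum>j\<in>B. s2 (c j) j)" for c
    using g by (simp add: sum scale)
  show ?thesis unfolding B(4)[symmetric]
  proof (rule vs1.dim_mod_family[where g=g])
    show "vs1.subspace {x \<in> V. f x = 0}"
      using V by (auto simp: vs1.subspace_def add scale zero)
    fix v assume v: "v \<in> V"
    then have "f v \<in> vs2.span B" using B(3) by blast
    then obtain c where c: "f v = (\<Sum>b\<in>B. s2 (c b) b)" by (auto simp: vs2.span_finite[OF finB])
    have "(\<Sum>j\<in>B. s1 (c j) (g j)) \<in> V"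
      using V g by (auto intro!: vs1.subspace_sum vs1.subspace_scale)
    then show "\<exists>c. v - (\<Sum>j\<in>B. s1 (c j) (g j)) \<in> {x \<in> V. f x = 0}"
      using v V c fs[of c] by (intro exI[of _ c]) (auto simp: diff vs1.subspace_diff)
  next
    fix c assume "(\<Sum>j\<in>B. s1 (c j) (g j)) \<in> {x \<in> V. f x = 0}"
    then have "(\<Sum>j\<in>B. s2 (c j) j) = 0" using fs by simp
    then show "\<forall>j\<in>B. c j = 0" using vs2.independentD[OF B(2) finB order_refl, of c] by blast
  qed (use V fin finB g in auto)
qed

section \<open>Homogeneous polynomials\<close>

definition mdeg :: "(3 \<Rightarrow>\<^sub>0 nat) \<Rightarrow> nat" where
  "mdeg m = (\<Sum>i\<in>UNIV. Poly_Mapping.lookup m i)"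

lemma mdeg_simps [simp]: "mdeg 0 = 0" "mdeg (a + b) = mdeg a + mdeg b"
  "mdeg (Poly_Mapping.single i n) = n"
proof -
  have "mdeg (Poly_Mapping.single i n) = (\<Sum>j\<in>UNIV. if j = i then n else 0)"
    unfolding mdeg_def by (intro sum.cong) (auto simp: lookup_single when_def)
  then show "mdeg (Poly_Mapping.single i n) = n" by simp
qed (auto simp: mdeg_def lookup_add sum.distrib)

lemma homogeneous_altdef: "homogeneous k p \<longleftrightarrow> (\<forall>m. Poly_Mapping.lookup p m \<noteq> 0 \<longrightarrow> mdeg m = k)"
  by (auto simp: homogeneous_def mdeg_def in_keys_iff)

lemma homogeneous_0 [simp]: "homogeneous k 0"
  by (simp add: homogeneous_altdef)

lemma homogeneous_single: "mdeg m = k \<Longrightarrow> homogeneous k (Poly_Mapping.single m c)"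
  by (auto simp: homogeneous_altdef lookup_single when_def)

lemma homogeneous_const3: "homogeneous 0 (const3 c)"
  by (simp add: const3_def homogeneous_single)

lemma homogeneous_1: "homogeneous 0 1"
  using homogeneous_const3[of 1] by (simp add: const3_def)

lemma homogeneous_add: "homogeneous k p \<Longrightarrow> homogeneous k q \<Longrightarrow> homogeneous k (p + q)"
  unfolding homogeneous_altdef lookup_add by (metis add_0)

lemma homogeneous_uminus: "homogeneous k p \<Longrightarrow> homogeneous k (- p)"
  by (auto simp: homogeneous_altdef)

lemma homogeneous_diff: "homogeneous k p \<Longrightarrow> homogeneous k q \<Longrightarrow> homogeneous k (p - q)"
  using homogeneous_add[of k p "- q"] homogeneous_uminus[of k q] by simp

lemma homogeneous_sum: "(\<And>i. i \<in> I \<Longrightarrow> homogeneous k (f i)) \<Longrightarrow> homogeneous k (sum f I)"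
  by (induction I rule: infinite_finite_induct) (auto intro: homogeneous_add)

lemma homogeneous_mult: "homogeneous j p \<Longrightarrow> homogeneous k q \<Longrightarrow> homogeneous (j + k) (p * q)"
proof -
  assume *: "homogeneous j p" "homogeneous k q"
  show ?thesis unfolding homogeneous_altdef
  proof (intro allI impI)
    fix m assume "Poly_Mapping.lookup (p * q) m \<noteq> 0"
    then have "m \<in> Poly_Mapping.keys (p * q)" by (simp add: in_keys_iff)
    with keys_mult[of p q] obtain a b where "m = a + b" "Poly_Mapping.lookup p a \<noteq> 0" "Poly_Mapping.lookup q b \<noteq> 0"
      by (auto simp: in_keys_iff)
    then show "mdeg m = j + k" using * by (auto simp: homogeneous_altdef)
  qed
qed

lemma homogeneous_power: "homogeneous j p \<Longrightarrow> homogeneous (j * n) (p ^ n)"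
  by (induction n) (auto simp: homogeneous_1 intro: homogeneous_mult)

lemma homogeneous_prod:
  "(\<And>i. i \<in> I \<Longrightarrow> homogeneous (d i) (f i)) \<Longrightarrow> homogeneous (sum d I) (prod f I)"
  by (induction I rule: infinite_finite_induct) (auto simp: homogeneous_1 intro: homogeneous_mult)

lemma homogeneous_const3_mult: "homogeneous k p \<Longrightarrow> homogeneous k (const3 c * p)"
  using homogeneous_mult[OF homogeneous_const3, of k p c] by simp

text \<open>The projection onto the forms of degree k. Applied to an identity with arbitrary
  polynomial coefficients it yields one whose coefficients are forms.\<close>

definition hpart :: "nat \<Rightarrow> poly3 \<Rightarrow> poly3" where
  "hpart k p = Poly_Mapping.mapp (\<lambda>m c. c when mdeg m = k) p"

lemma lookup_hpart: "Poly_Mapping.lookup (hpart k p) m = (Poly_Mapping.lookup p m when mdeg m = k)"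
  by (auto simp: hpart_def lookup_mapp when_def in_keys_iff)

lemma homogeneous_hpart [simp]: "homogeneous k (hpart k p)"
  by (auto simp: homogeneous_altdef lookup_hpart when_def)

lemma hpart_add: "hpart k (p + q) = hpart k p + hpart k q"
  by (rule poly_mapping_eqI) (auto simp: lookup_hpart lookup_add when_def)

lemma hpart_diff: "hpart k (p - q) = hpart k p - hpart k q"
  by (rule poly_mapping_eqI) (auto simp: lookup_hpart lookup_minus when_def)

lemma hpart_0 [simp]: "hpart k 0 = 0"
  by (rule poly_mapping_eqI) (auto simp: lookup_hpart when_def)

lemma hpart_sum: "hpart k (sum f I) = (\<Sum>i\<in>I. hpart k (f i))"
  by (induction I rule: infinite_finite_induct) (auto simp: hpart_add)

lemma hpart_homogeneous: "homogeneous j p \<Longrightarrow> hpart k p = (if j = k then p else 0)"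
  by (auto intro!: poly_mapping_eqI simp: lookup_hpart when_def homogeneous_altdef)

lemma poly3_expand: "(p::'a \<Rightarrow>\<^sub>0 'b::comm_monoid_add) = (\<Sum>m\<in>Poly_Mapping.keys p. Poly_Mapping.single m (Poly_Mapping.lookup p m))"
proof (rule poly_mapping_eqI)
  fix k
  have "Poly_Mapping.lookup (\<Sum>m\<in>Poly_Mapping.keys p. Poly_Mapping.single m (Poly_Mapping.lookup p m)) k
     = (\<Sum>m\<in>Poly_Mapping.keys p. if m = k then Poly_Mapping.lookup p m else 0)"
    by (simp add: lookup_sum lookup_single when_def)
  also have "\<dots> = Poly_Mapping.lookup p k" by (simp add: in_keys_iff)
  finally show "Poly_Mapping.lookup p k = Poly_Mapping.lookup (\<Sum>m\<in>Poly_Mapping.keys p. Poly_Mapping.single m (Poly_Mapping.lookup p m)) k" ..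
qed

lemma poly3_induct [case_names zero add]:
  assumes "P 0" "\<And>p m c. P p \<Longrightarrow> P (p + Poly_Mapping.single m c)"
  shows "P (p :: 'a \<Rightarrow>\<^sub>0 'b::comm_monoid_add)"
proof -
  have "P (\<Sum>m\<in>A. Poly_Mapping.single m (Poly_Mapping.lookup p m))" if "finite A" for A
    using that
  proof (induction A)
    case (insert x A)
    show ?case using assms(2)[OF insert.IH, of x "Poly_Mapping.lookup p x"] insert.hyps by (simp add: add.commute)
  qed (simp add: assms(1))
  then show ?thesis using poly3_expand[of p] by (metis finite_keys)
qed

text \<open>Additivity in p reduces this to monomials. Writing the degree as \<open>k + d\<close>
  avoids truncated subtraction; \<open>hpart_mult_lower\<close> covers the degrees below that of
  g.\<close>

lemma hpart_mult:
  assumes "homogeneous d g"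
  shows "hpart (k + d) (g * p) = g * hpart k p"
proof (induction p rule: poly3_induct)
  case (add p m c)
  have "homogeneous (mdeg m) (Poly_Mapping.single m c)" by (rule homogeneous_single) simp
  then have "hpart (k + d) (g * Poly_Mapping.single m c) = g * hpart k (Poly_Mapping.single m c)"
    using homogeneous_mult[OF assms, of "mdeg m" "Poly_Mapping.single m c"]
    by (simp add: hpart_homogeneous add.commute)
  then show ?case using add by (simp add: hpart_add distrib_left)
qed simp

lemma hpart_mult_lower:
  assumes "homogeneous d g" "k < d"
  shows "hpart k (g * p) = 0"
proof (induction p rule: poly3_induct)
  case (add p m c)
  have "homogeneous (mdeg m) (Poly_Mapping.single m c)" by (rule homogeneous_single) simp
  then have "hpart k (g * Poly_Mapping.single m c) = 0"
    using homogeneous_mult[OF assms(1), of "mdeg m" "Poly_Mapping.single m c"] assms(2)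
    by (simp add: hpart_homogeneous)
  then show ?case using add by (simp add: hpart_add distrib_left)
qed simp

lemma const3_simps: "const3 0 = 0" "const3 1 = 1" "const3 (a + b) = const3 a + const3 b"
  "const3 (a * b) = const3 a * const3 b" "const3 (- a) = - const3 a" "const3 (a - b) = const3 a - const3 b"
  "const3 (a ^ n) = const3 a ^ n"
proof -
  show *: "const3 1 = 1" "const3 (a * b) = const3 a * const3 b" for a b
    by (auto simp: const3_def mult_single)
  show "const3 (a ^ n) = const3 a ^ n" by (induction n) (auto simp: *)
qed (auto simp: const3_def single_add single_uminus single_diff)

lemma const3_sum: "const3 (sum f I) = (\<Sum>i\<in>I. const3 (f i))"
  by (induction I rule: infinite_finite_induct) (auto simp: const3_simps)

lemma const3_eq_0_iff [simp]: "const3 c = 0 \<longleftrightarrow> c = 0"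
  by (metis const3_def lookup_single_eq lookup_zero const3_simps(1))

section \<open>Substitution homomorphisms\<close>

text \<open>Evaluation at points (\<open>ev\<close>) and endomorphisms of the polynomial ring
  (\<open>sb\<close>) are substitutions that differ only in where the constants go, so they share
  one development.\<close>

locale const_hom =
  fixes \<phi> :: "real \<Rightarrow> 'b::comm_ring_1"
  assumes \<phi>_0: "\<phi> 0 = 0" and \<phi>_1: "\<phi> 1 = 1"
    and \<phi>_add: "\<phi> (a + b) = \<phi> a + \<phi> b" and \<phi>_mult: "\<phi> (a * b) = \<phi> a * \<phi> b"
begin

definition ins :: "(3 \<Rightarrow> 'b) \<Rightarrow> poly3 \<Rightarrow> 'b" where
  "ins x p = (\<Sum>m\<in>Poly_Mapping.keys p. \<phi> (Poly_Mapping.lookup p m) * (\<Prod>i\<in>UNIV. x i ^ Poly_Mapping.lookup m i))"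

lemma ins_superset:
  assumes "finite A" "Poly_Mapping.keys p \<subseteq> A"
  shows "ins x p = (\<Sum>m\<in>A. \<phi> (Poly_Mapping.lookup p m) * (\<Prod>i\<in>UNIV. x i ^ Poly_Mapping.lookup m i))"
  unfolding ins_def using assms by (intro sum.mono_neutral_left) (auto simp: in_keys_iff \<phi>_0)

lemma ins_0 [simp]: "ins x 0 = 0"
  by (simp add: ins_def)

lemma ins_add: "ins x (p + q) = ins x p + ins x q"
proof -
  let ?A = "Poly_Mapping.keys p \<union> Poly_Mapping.keys q"
  have k: "Poly_Mapping.keys (p + q) \<subseteq> ?A" by (rule keys_add)
  show ?thesis
    by (simp add: ins_superset[OF _ k] ins_superset[of ?A p] ins_superset[of ?A q] lookup_add \<phi>_add
        distrib_right sum.distrib)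
qed

lemma ins_single: "ins x (Poly_Mapping.single m c) = \<phi> c * (\<Prod>i\<in>UNIV. x i ^ Poly_Mapping.lookup m i)"
  by (cases "c = 0") (auto simp: ins_def \<phi>_0)

lemma ins_mult_single:
  "ins x (Poly_Mapping.single m c * Poly_Mapping.single m' c')
     = ins x (Poly_Mapping.single m c) * ins x (Poly_Mapping.single m' c')"
  by (simp add: mult_single ins_single \<phi>_mult lookup_add power_add prod.distrib algebra_simps)

lemma ins_mult: "ins x (p * q) = ins x p * ins x q"
proof (induction p rule: poly3_induct)
  case (add p m c)
  have "ins x (Poly_Mapping.single m c * q) = ins x (Poly_Mapping.single m c) * ins x q"
    by (induction q rule: poly3_induct) (auto simp: distrib_left ins_add ins_mult_single)
  with add show ?case by (simp add: distrib_right ins_add)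
qed simp

lemma ins_1 [simp]: "ins x 1 = 1"
  using ins_single[of x 0 1] by (simp add: \<phi>_1)

lemma ins_const3: "ins x (const3 c) = \<phi> c"
  by (simp add: const3_def ins_single)

lemma ins_power: "ins x (p ^ n) = ins x p ^ n"
  by (induction n) (auto simp: ins_mult)

lemma ins_sum: "ins x (sum f I) = (\<Sum>i\<in>I. ins x (f i))"
  by (induction I rule: infinite_finite_induct) (auto simp: ins_add)

end

interpretation ev: const_hom "\<lambda>c::real. c"
  by unfold_locales auto

interpretation sb: const_hom const3
  by unfold_locales (auto simp: const3_simps)

lemma eval3_eq_ins: "eval3 p x = ev.ins (\<lambda>i. x $ i) p"
  by (simp add: eval3_def ev.ins_def)

definition pvar :: "3 \<Rightarrow> poly3" where
  "pvar i = Poly_Mapping.single (Poly_Mapping.single i 1) 1"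

definition lin :: "real^3 \<Rightarrow> poly3" where
  "lin n = (\<Sum>i\<in>UNIV. const3 (n $ i) * pvar i)"

lemma (in const_hom) ins_pvar: "ins x (pvar i) = x i"
proof -
  have "(\<Prod>j\<in>UNIV. x j ^ Poly_Mapping.lookup (Poly_Mapping.single i 1) j) = (\<Prod>j\<in>UNIV. if j = i then x j else 1)"
    by (intro prod.cong) (auto simp: lookup_single when_def)
  also have "\<dots> = x i" by simp
  finally show ?thesis by (simp add: pvar_def ins_single \<phi>_1)
qed

lemma homogeneous_pvar: "homogeneous 1 (pvar i)"
  unfolding pvar_def by (rule homogeneous_single) simp

lemma homogeneous_lin: "homogeneous 1 (lin n)"
  unfolding lin_def by (intro homogeneous_sum homogeneous_const3_mult homogeneous_pvar)

lemma homogeneous_lin_power: "homogeneous e (lin n ^ e)"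
  using homogeneous_power[OF homogeneous_lin, of e n] by simp

lemma lin_linear: "lin (a + b) = lin a + lin b" "lin (c *\<^sub>R a) = const3 c * lin a" "lin (a - b) = lin a - lin b"
  by (auto simp: lin_def const3_simps algebra_simps sum.distrib sum_distrib_left sum_subtractf)

lemma lin_axis: "lin (axis i 1) = pvar i"
proof -
  have "lin (axis i 1) = (\<Sum>j\<in>UNIV. if j = i then pvar j else 0)"
    unfolding lin_def by (intro sum.cong) (auto simp: axis_def const3_simps)
  then show ?thesis by simp
qed

lemma eval3_lin: "eval3 (lin n) x = n \<bullet> x"
  by (simp add: eval3_eq_ins lin_def ev.ins_sum ev.ins_mult ev.ins_const3 ev.ins_pvar inner_vec_def)

lemma lin_eq_0_iff: "lin n = 0 \<longleftrightarrow> n = 0"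
proof
  assume "lin n = 0"
  then have "n \<bullet> n = 0" using eval3_lin[of n n] by (simp add: eval3_eq_ins)
  then show "n = 0" by simp
qed (simp add: lin_def const3_simps)

lemma mdeg_1: "mdeg m = 1 \<Longrightarrow> \<exists>i. m = Poly_Mapping.single i 1"
proof -
  assume m: "mdeg m = 1"
  then obtain i where i: "Poly_Mapping.lookup m i \<noteq> 0" unfolding mdeg_def by (metis sum.neutral zero_neq_one)
  have "mdeg m = Poly_Mapping.lookup m i + (\<Sum>j\<in>UNIV - {i}. Poly_Mapping.lookup m j)"
    unfolding mdeg_def by (rule sum.remove) auto
  with m i have *: "Poly_Mapping.lookup m i = 1" "(\<Sum>j\<in>UNIV - {i}. Poly_Mapping.lookup m j) = 0" by linarith+
  have "m = Poly_Mapping.single i 1"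
    by (rule poly_mapping_eqI) (use * in \<open>auto simp: lookup_single when_def\<close>)
  then show ?thesis ..
qed

lemma single_1_eq_iff: "Poly_Mapping.single i (Suc 0) = Poly_Mapping.single j (Suc 0) \<longleftrightarrow> i = j"
  by (metis lookup_single_eq lookup_single_not_eq nat.distinct(1))

text \<open>Lets every edge form be replaced by its coefficient vector, so that incidence becomes a
  matter of inner and cross products in \<open>real^3\<close>.\<close>

lemma homogeneous_1_lin:
  assumes "homogeneous 1 p"
  obtains n where "p = lin n"
proof
  define n :: "real^3" where "n = (\<chi> i. Poly_Mapping.lookup p (Poly_Mapping.single i 1))"
  have L: "Poly_Mapping.lookup (lin n) (Poly_Mapping.single i 1) = Poly_Mapping.lookup p (Poly_Mapping.single i 1)" for i
  proof -
    have "Poly_Mapping.lookup (lin n) (Poly_Mapping.single i 1) = (\<Sum>j\<in>UNIV. if j = i then n $ j else 0)"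
      unfolding lin_def pvar_def const3_def
      by (auto simp: lookup_sum mult_single lookup_single single_1_eq_iff when_def intro!: sum.cong)
    then show ?thesis by (simp add: n_def)
  qed
  show "p = lin n"
  proof (rule poly_mapping_eqI)
    fix m
    show "Poly_Mapping.lookup p m = Poly_Mapping.lookup (lin n) m"
    proof (cases "mdeg m = 1")
      case True
      then show ?thesis using mdeg_1[OF True] L by auto
    next
      case False
      then show ?thesis using assms homogeneous_lin[of n] by (metis homogeneous_altdef)
    qed
  qed
qed

lemma sb_ins_lin: "sb.ins f (lin n) = (\<Sum>i\<in>UNIV. const3 (n $ i) * f i)"
  by (simp add: lin_def sb.ins_sum sb.ins_mult sb.ins_const3 sb.ins_pvar)

lemma sb_ins_pvar_id: "sb.ins pvar p = p"
proof (induction p rule: poly3_induct)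
  case (add p m c)
  have P: "pvar i ^ k = Poly_Mapping.single (Poly_Mapping.single i k) 1" for i k
    by (induction k) (auto simp: pvar_def mult_single simp flip: single_add)
  have "(\<Prod>i\<in>A. pvar i ^ Poly_Mapping.lookup m i) = Poly_Mapping.single (\<Sum>i\<in>A. Poly_Mapping.single i (Poly_Mapping.lookup m i)) 1"
    if "finite A" for A
    using that by (induction A) (auto simp: P mult_single)
  moreover have "m = (\<Sum>i\<in>UNIV. Poly_Mapping.single i (Poly_Mapping.lookup m i))"
    by (rule poly_mapping_eqI) (simp add: lookup_sum lookup_single when_def)
  ultimately have "(\<Prod>i\<in>UNIV. pvar i ^ Poly_Mapping.lookup m i) = Poly_Mapping.single m 1" by simp
  then have "sb.ins pvar (Poly_Mapping.single m c) = Poly_Mapping.single m c"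
    by (simp add: sb.ins_single const3_def mult_single)
  with add show ?case by (simp add: sb.ins_add)
qed simp

lemma homogeneous_sb_ins:
  assumes "\<And>i. homogeneous 1 (f i)" "homogeneous k p"
  shows "homogeneous k (sb.ins f p)"
  unfolding sb.ins_def
proof (intro homogeneous_sum homogeneous_const3_mult)
  fix m assume "m \<in> Poly_Mapping.keys p"
  then have k: "mdeg m = k" using assms(2) by (auto simp: homogeneous_altdef in_keys_iff)
  have "homogeneous (\<Sum>i\<in>UNIV. Poly_Mapping.lookup m i) (\<Prod>i\<in>UNIV. f i ^ Poly_Mapping.lookup m i)"
    using homogeneous_power[OF assms(1)] by (intro homogeneous_prod) simp
  then show "homogeneous k (\<Prod>i\<in>UNIV. f i ^ Poly_Mapping.lookup m i)" using k by (simp add: mdeg_def)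
qed

section \<open>Ideals of the polynomial ring and their graded pieces\<close>

interpretation p3: vector_space "\<lambda>c p. const3 c * p"
  by unfold_locales (simp_all add: distrib_left distrib_right const3_simps mult.assoc)

declare p3.scale_scale [simp del]

interpretation pm: module "(*) :: poly3 \<Rightarrow> poly3 \<Rightarrow> poly3"
  by unfold_locales (simp_all add: distrib_left distrib_right mult.assoc)

declare pm.scale_scale [simp del]

lemma ideal_gen_eq_span: "ideal_gen S = pm.span S"
  by (simp add: ideal_gen_def)

lemma ideal_add: "p \<in> ideal_gen S \<Longrightarrow> q \<in> ideal_gen S \<Longrightarrow> p + q \<in> ideal_gen S"
  and ideal_diff: "p \<in> ideal_gen S \<Longrightarrow> q \<in> ideal_gen S \<Longrightarrow> p - q \<in> ideal_gen S"
  and ideal_mult: "p \<in> ideal_gen S \<Longrightarrow> a * p \<in> ideal_gen S"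
  and ideal_0: "0 \<in> ideal_gen S"
  and ideal_base: "p \<in> S \<Longrightarrow> p \<in> ideal_gen S"
  and ideal_sum: "(\<And>i. i \<in> I \<Longrightarrow> f i \<in> ideal_gen S) \<Longrightarrow> sum f I \<in> ideal_gen S"
  and ideal_mono: "S \<subseteq> T \<Longrightarrow> ideal_gen S \<subseteq> ideal_gen T"
  unfolding ideal_gen_eq_span
  by (auto intro: pm.span_add pm.span_diff pm.span_scale pm.span_zero pm.span_base pm.span_sum
      dest: pm.span_mono)

lemma ideal_minimal: "S \<subseteq> ideal_gen T \<Longrightarrow> ideal_gen S \<subseteq> ideal_gen T"
  unfolding ideal_gen_eq_span using pm.span_minimal pm.subspace_span by blast

lemma ideal_insert: "p \<in> ideal_gen (insert u S) \<longleftrightarrow> (\<exists>c. p - c * u \<in> ideal_gen S)"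
  unfolding ideal_gen_eq_span by (auto simp: pm.span_insert)

lemma ideal_image:
  assumes "finite N"
  shows "p \<in> ideal_gen (g ` N) \<longleftrightarrow> (\<exists>q. p = (\<Sum>n\<in>N. q n * g n))"
proof
  assume "p \<in> ideal_gen (g ` N)"
  then show "\<exists>q. p = (\<Sum>n\<in>N. q n * g n)"
    unfolding ideal_gen_eq_span
  proof (induction rule: pm.span_induct_alt)
    case base
    show ?case by (rule exI[of _ "\<lambda>_. 0"]) simp
  next
    case (step c x y)
    then obtain q n where q: "y = (\<Sum>n\<in>N. q n * g n)" and n: "n \<in> N" "x = g n" by auto
    have "c * x + y = (\<Sum>i\<in>N. (q i + (if i = n then c else 0)) * g i)"
      using n assms by (simp add: q distrib_right sum.distrib if_distrib[of "\<lambda>c. c * _"] add.commute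
          cong: if_cong)
    then show ?case by (intro exI[of _ "\<lambda>i. q i + (if i = n then c else 0)"])
  qed
next
  assume "\<exists>q. p = (\<Sum>n\<in>N. q n * g n)"
  then show "p \<in> ideal_gen (g ` N)"
    by clarify (intro ideal_sum ideal_mult ideal_base imageI)
qed

lemma subspace_homogeneous: "p3.subspace {p. homogeneous k p}"
  by (auto simp: p3.subspace_def homogeneous_add homogeneous_const3_mult)

lemma subspace_ideal_part: "p3.subspace {p \<in> ideal_gen S. homogeneous k p}"
  by (auto simp: p3.subspace_def homogeneous_add homogeneous_const3_mult ideal_add ideal_mult ideal_0)

text \<open>Substituting the variables for themselves writes p by constants, variables, sums and
  products.\<close>

lemma poly3_ring_induct [case_names const var add mult]:
  assumes "\<And>c. P (const3 c)" "\<And>i. P (pvar i)" "\<And>p q. P p \<Longrightarrow> P q \<Longrightarrow> P (p + q)"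
    "\<And>p q. P p \<Longrightarrow> P q \<Longrightarrow> P (p * q)"
  shows "P p"
proof -
  have pow: "P (pvar i ^ k)" for i k
    using assms(1)[of 1] by (induction k) (auto simp: assms(2,4) const3_simps)
  have prod: "P (\<Prod>i\<in>A. f i)" if "finite A" "\<And>i. P (f i)" for A and f :: "3 \<Rightarrow> poly3"
    using that assms(1)[of 1] by (induction A) (auto simp: assms(4) const3_simps)
  have "P (sb.ins pvar p)"
    unfolding sb.ins_def
  proof -
    have "P (\<Sum>m\<in>A. const3 (Poly_Mapping.lookup p m) * (\<Prod>i\<in>UNIV. pvar i ^ Poly_Mapping.lookup m i))"
      if "finite A" for A
      using that
    proof (induction A)
      case empty
      then show ?case using assms(1)[of 0] by (simp add: const3_simps)
    next
      case (insert m A)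
      then show ?case by (simp add: assms(1,3,4) prod pow)
    qed
    then show "P (\<Sum>m\<in>Poly_Mapping.keys p. const3 (Poly_Mapping.lookup p m) * (\<Prod>i\<in>UNIV. pvar i ^ Poly_Mapping.lookup m i))"
      by simp
  qed
  then show ?thesis by (simp add: sb_ins_pvar_id)
qed

text \<open>The substitution killing \<open>lin l\<close> along \<open>w\<close> fixes the generators.\<close>

lemma ideal_powers_cancel_lin:
  assumes N: "finite N" "\<And>n. n \<in> N \<Longrightarrow> n \<bullet> w = 0" and l: "l \<bullet> w \<noteq> 0"
    and f: "lin l * f \<in> ideal_gen ((\<lambda>n. lin n ^ e) ` N)"
  shows "f \<in> ideal_gen ((\<lambda>n. lin n ^ e) ` N)"
proof -
  \<comment> \<open>\<open>c\<close> is \<open>lin l\<close> scaled to take the value 1 at w, so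
    \<open>s\<close> substitutes x - c(x) w for x: the projection along w onto the plane of l. Forms
    whose normal is orthogonal to w do not change.\<close>
  define c where "c = const3 (inverse (l \<bullet> w)) * lin l"
  define s where "s = sb.ins (\<lambda>i. pvar i - const3 (w $ i) * c)"
  have s_lin: "s (lin n) = lin n - const3 (n \<bullet> w) * c" for n
  proof -
    have "s (lin n) = (\<Sum>i\<in>UNIV. const3 (n $ i) * (pvar i - const3 (w $ i) * c))"
      by (simp add: s_def sb_ins_lin)
    also have "\<dots> = lin n - const3 (n \<bullet> w) * c"
      by (simp add: lin_def inner_vec_def const3_sum const3_simps right_diff_distrib sum_subtractf
          sum_distrib_right mult.assoc)
    finally show ?thesis .
  qed
  have sl: "s (lin l) = 0"
  proof -
    have "const3 (l \<bullet> w) * c = const3 ((l \<bullet> w) * inverse (l \<bullet> w)) * lin l"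
      by (simp only: c_def const3_simps(4) mult.assoc)
    then show ?thesis using l by (simp add: s_lin const3_simps)
  qed
  have sn: "s (lin n) = lin n" if "n \<in> N" for n
    using N(2)[OF that] by (simp add: s_lin const3_simps)
  \<comment> \<open>The substitution moves each variable by a multiple of \<open>lin l\<close>, and
    such congruences respect sums and products.\<close>
  have dvd: "lin l dvd p - s p" for p
  proof (induction p rule: poly3_ring_induct)
    case (var i)
    have "pvar i - s (pvar i) = lin l * (const3 (w $ i) * const3 (inverse (l \<bullet> w)))"
      by (simp add: s_def sb.ins_pvar c_def)
    then show ?case by simp
  next
    case (add p q)
    have "p + q - s (p + q) = (p - s p) + (q - s q)" by (simp add: s_def sb.ins_add)
    then show ?case using dvd_add[OF add] by metis
  next
    case (mult p q)
    have "p * q - s (p * q) = (p - s p) * q + s p * (q - s q)" 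
      by (simp add: s_def sb.ins_mult left_diff_distrib right_diff_distrib)
    also have "lin l dvd \<dots>" by (intro dvd_add dvd_mult dvd_mult2 mult)
    finally show ?case .
  qed (simp add: s_def sb.ins_const3)
  obtain q where q: "lin l * f = (\<Sum>n\<in>N. q n * lin n ^ e)" 
    using ideal_image[OF N(1), THEN iffD1, OF f] by blast
  have "\<exists>g. q n - s (q n) = lin l * g" for n using dvd[of "q n"] by (auto simp: dvd_def)
  then obtain g where g: "\<And>n. q n - s (q n) = lin l * g n" by metis
  \<comment> \<open>\<open>s\<close> kills the left side and fixes the generators, so each
    coefficient \<open>q n\<close> may be replaced by \<open>q n - s (q n)\<close>, which
    \<open>lin l\<close> divides; then \<open>lin l\<close> cancels.\<close>
  have "0 = s (lin l * f)" by (simp add: s_def sb.ins_mult sl[unfolded s_def])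
  also have "\<dots> = (\<Sum>n\<in>N. s (q n) * s (lin n) ^ e)"
    by (simp add: q s_def sb.ins_sum sb.ins_mult sb.ins_power)
  also have "\<dots> = (\<Sum>n\<in>N. s (q n) * lin n ^ e)" by (simp add: sn)
  finally have "lin l * f = (\<Sum>n\<in>N. q n * lin n ^ e) - (\<Sum>n\<in>N. s (q n) * lin n ^ e)"
    using q by simp
  also have "\<dots> = lin l * (\<Sum>n\<in>N. g n * lin n ^ e)"
    by (simp add: sum_subtractf[symmetric] left_diff_distrib[symmetric] g sum_distrib_left mult.assoc)
  finally have "f = (\<Sum>n\<in>N. g n * lin n ^ e)"
    using l by (auto simp: lin_eq_0_iff)
  then show ?thesis using ideal_image[OF N(1), of f "\<lambda>n. lin n ^ e"] by blast
qed

text \<open>The factors are cancelled one at a time by \<open>ideal_powers_cancel_lin\<close>. This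
  is what makes multiplication by \<open>away \<xi>\<close> injective on R / I_\<psi>.\<close>

lemma ideal_powers_cancel_prod:
  assumes N: "finite N" "\<And>n. n \<in> N \<Longrightarrow> n \<bullet> w = 0" and T: "finite T" "\<And>t. t \<in> T \<Longrightarrow> v t \<bullet> w \<noteq> 0"
    and "(\<Prod>t\<in>T. lin (v t) ^ d) * f \<in> ideal_gen ((\<lambda>n. lin n ^ e) ` N)"
  shows "f \<in> ideal_gen ((\<lambda>n. lin n ^ e) ` N)"
  using T assms(5)
proof (induction T arbitrary: f)
  case (insert t T)
  have pow: "lin (v t) ^ k * g \<in> ideal_gen ((\<lambda>n. lin n ^ e) ` N) \<Longrightarrow> g \<in> ideal_gen ((\<lambda>n. lin n ^ e) ` N)" for k g
  proof (induction k arbitrary: g)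
    case (Suc k)
    then have "lin (v t) ^ k * (lin (v t) * g) \<in> ideal_gen ((\<lambda>n. lin n ^ e) ` N)"
      by (simp add: mult_ac)
    from Suc.IH[OF this] show ?case
      using ideal_powers_cancel_lin[OF N insert.prems(1)[OF insertI1]] by blast
  qed simp
  show ?case
  proof (rule insert.IH)
    show "v s \<bullet> w \<noteq> 0" if "s \<in> T" for s using insert.prems(1) that by blast
    show "(\<Prod>t\<in>T. lin (v t) ^ d) * f \<in> ideal_gen ((\<lambda>n. lin n ^ e) ` N)"
    proof (rule pow)
      show "lin (v t) ^ d * ((\<Prod>t\<in>T. lin (v t) ^ d) * f) \<in> ideal_gen ((\<lambda>n. lin n ^ e) ` N)"
        using insert.prems(2) insert.hyps by (simp add: mult.assoc)
    qed
  qed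
qed simp

section \<open>Ideals containing all forms of high degree\<close>

text \<open>Such ideals contain a power of the maximal ideal of the origin. The condition is kept
  algebraic because over the reals an empty projective zero set would not imply it.\<close>

definition cofinite_ideal :: "poly3 set \<Rightarrow> bool" where
  "cofinite_ideal S \<longleftrightarrow> (\<exists>K. \<forall>m. K \<le> mdeg m \<longrightarrow> Poly_Mapping.single m 1 \<in> ideal_gen S)"

lemma cofinite_idealD:
  assumes "cofinite_ideal S"
  obtains K where "\<And>k p. K \<le> k \<Longrightarrow> homogeneous k p \<Longrightarrow> p \<in> ideal_gen S"
proof -
  obtain K where K: "\<And>m. K \<le> mdeg m \<Longrightarrow> Poly_Mapping.single m 1 \<in> ideal_gen S"
    using assms by (auto simp: cofinite_ideal_def)
  have "p \<in> ideal_gen S" if "K \<le> k" "homogeneous k p" for k p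
  proof -
    have "(\<Sum>m\<in>Poly_Mapping.keys p. const3 (Poly_Mapping.lookup p m) * Poly_Mapping.single m 1) \<in> ideal_gen S"
      using that by (intro ideal_sum ideal_mult K) (auto simp: homogeneous_altdef in_keys_iff)
    also have "(\<Sum>m\<in>Poly_Mapping.keys p. const3 (Poly_Mapping.lookup p m) * Poly_Mapping.single m 1) = p"
      by (subst (3) poly3_expand) (simp add: const3_def mult_single)
    finally show ?thesis .
  qed
  then show thesis by (rule that)
qed

lemma mdeg_split: "j \<le> mdeg m \<Longrightarrow> \<exists>a b. m = a + b \<and> mdeg a = j"
proof (induction j)
  case 0
  show ?case by (intro exI[of _ 0] exI[of _ m]) simp
next
  case (Suc j)
  then obtain a b where ab: "m = a + b" "mdeg a = j" by auto
  with Suc.prems have "mdeg b \<noteq> 0" by auto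
  then obtain i where i: "Poly_Mapping.lookup b i \<noteq> 0" unfolding mdeg_def by (metis sum.neutral)
  have "b = Poly_Mapping.single i 1 + (b - Poly_Mapping.single i 1)"
    using i by (intro poly_mapping_eqI) (auto simp: lookup_add lookup_minus lookup_single when_def)
  then have "m = (a + Poly_Mapping.single i 1) + (b - Poly_Mapping.single i 1)"
    using ab by (simp add: add.assoc)
  moreover have "mdeg (a + Poly_Mapping.single i 1) = Suc j" using ab by simp
  ultimately show ?case by blast
qed

text \<open>A monomial of degree at least K + L splits into factors of degrees at least K and L.
  Harder cases are settled by exhibiting a product of two easier ideals inside the given
  one.\<close>

lemma cofinite_ideal_product:
  assumes "cofinite_ideal S" "cofinite_ideal T"
    and ST: "\<And>p q. p \<in> ideal_gen S \<Longrightarrow> q \<in> ideal_gen T \<Longrightarrow> p * q \<in> ideal_gen U"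
  shows "cofinite_ideal U"
proof -
  obtain K where K: "\<And>m. K \<le> mdeg m \<Longrightarrow> Poly_Mapping.single m 1 \<in> ideal_gen S"
    using assms(1) by (auto simp: cofinite_ideal_def)
  obtain L where L: "\<And>m. L \<le> mdeg m \<Longrightarrow> Poly_Mapping.single m 1 \<in> ideal_gen T"
    using assms(2) by (auto simp: cofinite_ideal_def)
  have "Poly_Mapping.single m 1 \<in> ideal_gen U" if "K + L \<le> mdeg m" for m
  proof -
    have "K \<le> mdeg m" using that by simp
    then obtain a b where ab: "m = a + b" "mdeg a = K" using mdeg_split by blast
    then have "L \<le> mdeg b" using that by simp
    then have "Poly_Mapping.single a 1 * Poly_Mapping.single b 1 \<in> ideal_gen U"
      using ab by (intro ST K L) auto
    then show ?thesis by (simp add: ab mult_single)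
  qed
  then show ?thesis unfolding cofinite_ideal_def by blast
qed

lemma cofinite_ideal_mono:
  "cofinite_ideal S \<Longrightarrow> S \<subseteq> ideal_gen T \<Longrightarrow> cofinite_ideal T"
  unfolding cofinite_ideal_def using ideal_minimal[of S T] by blast

lemma cofinite_ideal_1: "1 \<in> S \<Longrightarrow> cofinite_ideal S"
  unfolding cofinite_ideal_def using ideal_mult[OF ideal_base, of 1 S] by force

text \<open>Modulo S the members of the two ideals are multiples of u and of v, so their products
  are multiples of u v.\<close>

lemma cofinite_ideal_insert_mult:
  assumes "cofinite_ideal (insert u S)" "cofinite_ideal (insert v S)"
  shows "cofinite_ideal (insert (u * v) S)"
proof (rule cofinite_ideal_product[OF assms])
  fix p q assume "p \<in> ideal_gen (insert u S)" "q \<in> ideal_gen (insert v S)"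
  then obtain c d where c: "p - c * u \<in> ideal_gen S" and d: "q - d * v \<in> ideal_gen S"
    by (auto simp: ideal_insert)
  have "p * q - (c * d) * (u * v) = (c * u) * (q - d * v) + q * (p - c * u)"
    by (simp add: algebra_simps)
  also have "\<dots> \<in> ideal_gen S" using c d by (intro ideal_add ideal_mult)
  finally show "p * q \<in> ideal_gen (insert (u * v) S)" by (auto simp: ideal_insert)
qed

lemma cofinite_ideal_insert_power:
  "cofinite_ideal (insert u S) \<Longrightarrow> cofinite_ideal (insert (u ^ e) S)"
  by (induction e) (auto intro: cofinite_ideal_1 cofinite_ideal_insert_mult)

lemma cofinite_ideal_insert_prod:
  "finite A \<Longrightarrow> (\<And>i. i \<in> A \<Longrightarrow> cofinite_ideal (insert (f i) S)) \<Longrightarrow> cofinite_ideal (insert (prod f A) S)"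
  by (induction A rule: finite_induct) (auto intro: cofinite_ideal_1 cofinite_ideal_insert_mult)

section \<open>Independence of linear forms and products over the lines missing a point\<close>

unbundle cross3_syntax

text \<open>Cramer's rule with denominators cleared: up to the determinant, the three cross products
  are the dual basis of u, v, w.\<close>

lemma cross3_dual_expansion:
  fixes u v w x :: "real^3"
  shows "(u \<bullet> (v \<times> w)) *\<^sub>R x = (x \<bullet> (v \<times> w)) *\<^sub>R u + (x \<bullet> (w \<times> u)) *\<^sub>R v + (x \<bullet> (u \<times> v)) *\<^sub>R w"
  by (simp add: vec_eq_iff forall_3 cross3_def inner_vec_def sum_3) algebra

text \<open>n and m lie in the plane with normal w, so their cross product is along w; scaling both
  sides clears the denominator \<open>w \<bullet> w\<close>.\<close>

lemma cross3_orthogonal_parallel: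
  fixes n m w :: "real^3"
  assumes "n \<bullet> w = 0" "m \<bullet> w = 0"
  shows "(w \<bullet> w) *\<^sub>R (n \<times> m) = (w \<bullet> (n \<times> m)) *\<^sub>R w"
proof -
  have "n $ 1 * w $ 1 + n $ 2 * w $ 2 + n $ 3 * w $ 3 = 0" "m $ 1 * w $ 1 + m $ 2 * w $ 2 + m $ 3 * w $ 3 = 0"
    using assms by (simp_all add: inner_vec_def sum_3)
  then show ?thesis by (simp add: vec_eq_iff forall_3 cross3_def inner_vec_def sum_3) algebra
qed

lemma triple_product_nonzero:
  fixes n m w x :: "real^3"
  assumes "n \<bullet> w = 0" "m \<bullet> w = 0" "n \<times> m \<noteq> 0" "x \<bullet> w \<noteq> 0"
  shows "x \<bullet> (n \<times> m) \<noteq> 0"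
proof -
  have "w \<noteq> 0" using assms(4) by auto
  have 1: "(w \<bullet> w) *\<^sub>R (n \<times> m) = (w \<bullet> (n \<times> m)) *\<^sub>R w" by (rule cross3_orthogonal_parallel[OF assms(1,2)])
  have "w \<bullet> (n \<times> m) \<noteq> 0" using 1 assms(3) \<open>w \<noteq> 0\<close> by auto
  moreover have "(w \<bullet> w) * (x \<bullet> (n \<times> m)) = (w \<bullet> (n \<times> m)) * (x \<bullet> w)"
    using arg_cong[OF 1, of "\<lambda>y. x \<bullet> y"] by simp
  ultimately show ?thesis using assms(4) by (metis mult_eq_0_iff)
qed

text \<open>Cramer's rule expresses each variable by the three forms, so everything from degree 1 on
  lies in the ideal.\<close>

lemma cofinite_ideal_lins:
  fixes u v w :: "real^3"
  assumes "u \<bullet> (v \<times> w) \<noteq> 0"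
  shows "cofinite_ideal {lin u, lin v, lin w}"
proof -
  let ?S = "{lin u, lin v, lin w}" and ?d = "u \<bullet> (v \<times> w)"
  have var: "pvar i \<in> ideal_gen ?S" for i
  proof -
    have "axis i 1 = inverse ?d *\<^sub>R (?d *\<^sub>R axis i (1::real))" using assms by simp
    also have "lin \<dots> \<in> ideal_gen ?S"
      unfolding cross3_dual_expansion[of u v w] lin_linear
      by (intro ideal_mult ideal_add ideal_base) auto
    finally show ?thesis by (simp add: lin_axis)
  qed
  have "Poly_Mapping.single m 1 \<in> ideal_gen ?S" if m: "1 \<le> mdeg m" for m
  proof -
    obtain a b where ab: "m = a + b" "mdeg a = 1" using mdeg_split[OF m] by blast
    then obtain i where "a = Poly_Mapping.single i 1" using mdeg_1 by blast
    then have "Poly_Mapping.single m 1 = Poly_Mapping.single b 1 * pvar i"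
      by (simp add: ab(1) pvar_def mult_single add.commute)
    then show ?thesis using ideal_mult[OF var] by simp
  qed
  then show ?thesis unfolding cofinite_ideal_def by blast
qed

lemma cofinite_ideal_lin_powers:
  fixes u v w :: "real^3"
  assumes "u \<bullet> (v \<times> w) \<noteq> 0"
  shows "cofinite_ideal {lin u ^ a, lin v ^ b, lin w ^ c}"
proof -
  have "cofinite_ideal {lin u ^ a, lin v, lin w}"
    by (rule cofinite_ideal_insert_power) (rule cofinite_ideal_lins[OF assms])
  then have "cofinite_ideal {lin v, lin u ^ a, lin w}" by (simp add: insert_commute)
  then have "cofinite_ideal {lin v ^ b, lin u ^ a, lin w}" by (rule cofinite_ideal_insert_power)
  then have "cofinite_ideal {lin w, lin v ^ b, lin u ^ a}" by (simp add: insert_commute)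
  then have "cofinite_ideal {lin w ^ c, lin v ^ b, lin u ^ a}" by (rule cofinite_ideal_insert_power)
  then show ?thesis by (simp add: insert_commute)
qed

text \<open>
  Geometrically: on the line of \<open>n0\<close>, the products over the lines missing one of the points \<open>w \<xi>\<close>
  have no common zero.
\<close>

lemma cofinite_ideal_points:
  fixes n :: "'e \<Rightarrow> real^3" and w :: "'x \<Rightarrow> real^3"
  assumes "finite A" "X \<noteq> {}"
    and X0: "\<And>\<xi>. \<xi> \<in> X \<Longrightarrow> n0 \<bullet> w \<xi> = 0"
    and Xdist: "\<And>\<xi> \<xi>'. \<xi> \<in> X \<Longrightarrow> \<xi>' \<in> X \<Longrightarrow> \<xi> \<noteq> \<xi>' \<Longrightarrow> w \<xi> \<times> w \<xi>' \<noteq> 0"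
    and par: "\<And>\<tau> \<xi>. \<tau> \<in> A \<Longrightarrow> n \<tau> \<times> n0 = 0 \<Longrightarrow> \<xi> \<in> X \<Longrightarrow> n \<tau> \<bullet> w \<xi> = 0"
    and meet: "\<And>\<tau>. \<tau> \<in> A \<Longrightarrow> n \<tau> \<times> n0 \<noteq> 0 \<Longrightarrow> \<exists>\<xi>\<in>X. n \<tau> \<bullet> w \<xi> = 0"
  shows "cofinite_ideal (insert (lin n0 ^ e) ((\<lambda>\<xi>. \<Prod>\<tau>\<in>{\<tau>\<in>A. n \<tau> \<bullet> w \<xi> \<noteq> 0}. lin (n \<tau>) ^ e) ` X))"
  using assms(1) par meet
proof (induction A)
  case empty
  then show ?case using assms(2) by (intro cofinite_ideal_1) auto
next
  case (insert t A)
  define g where "g A \<xi> = (\<Prod>\<tau>\<in>{\<tau>\<in>A. n \<tau> \<bullet> w \<xi> \<noteq> 0}. lin (n \<tau>) ^ e)" for A \<xi>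
  have IH: "cofinite_ideal (insert (lin n0 ^ e) (g A ` X))"
    unfolding g_def using insert.IH insert.prems by auto
  \<comment> \<open>Adding the line of t changes only the products at points off that line.\<close>
  have g_ins: "g (insert t A) \<xi> = (if n t \<bullet> w \<xi> = 0 then g A \<xi> else lin (n t) ^ e * g A \<xi>)" for \<xi>
  proof (cases "n t \<bullet> w \<xi> = 0")
    case True
    then have "{\<tau> \<in> insert t A. n \<tau> \<bullet> w \<xi> \<noteq> 0} = {\<tau> \<in> A. n \<tau> \<bullet> w \<xi> \<noteq> 0}" by auto
    then show ?thesis using True by (simp add: g_def)
  next
    case False
    then have "{\<tau> \<in> insert t A. n \<tau> \<bullet> w \<xi> \<noteq> 0} = insert t {\<tau> \<in> A. n \<tau> \<bullet> w \<xi> \<noteq> 0}" by auto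
    then show ?thesis using False insert.hyps by (simp add: g_def)
  qed
  have "cofinite_ideal (insert (lin n0 ^ e) (g (insert t A) ` X))"
  proof (cases "n t \<times> n0 = 0")
    case True
    then have "g (insert t A) ` X = g A ` X" using insert.prems(1)[of t] by (auto simp: g_ins)
    then show ?thesis using IH by simp
  next
    case False
    then obtain \<eta> where \<eta>: "\<eta> \<in> X" "n t \<bullet> w \<eta> = 0" using insert.prems(2)[of t] by auto
    let ?G = "insert (lin n0 ^ e) (g A ` X)" and ?H = "insert (lin n0 ^ e) (g (insert t A) ` X)"
    let ?u = "lin (n t) ^ e"
    \<comment> \<open>With \<open>?u\<close> adjoined, the product at \<eta> alone suffices: each of
      its factors misses \<eta> and is therefore independent of the forms of n0 and t, which both
      vanish at \<eta>.\<close>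
    have uH: "cofinite_ideal (insert ?u ?H)"
    proof -
      have "cofinite_ideal (insert (g A \<eta>) {lin n0 ^ e, ?u})"
        unfolding g_def
      proof (rule cofinite_ideal_insert_prod)
        fix s assume s: "s \<in> {\<tau> \<in> A. n \<tau> \<bullet> w \<eta> \<noteq> 0}"
        have "n s \<bullet> (n0 \<times> n t) \<noteq> 0"
          using False \<eta> X0 s by (intro triple_product_nonzero[of n0 "w \<eta>"]) (auto simp: cross_skew[of n0])
        then show "cofinite_ideal {lin (n s) ^ e, lin n0 ^ e, ?u}"
          by (rule cofinite_ideal_lin_powers)
      qed (use insert.hyps in simp)
      moreover have "g A \<eta> = g (insert t A) \<eta>" using \<eta> by (simp add: g_ins)
      ultimately show ?thesis
        using \<eta> by (elim cofinite_ideal_mono) (auto intro: ideal_base)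
    qed
    show ?thesis
    \<comment> \<open>Multiplication by \<open>?u\<close> carries the old ideal into the new one, so
      the product of the old ideal with the new ideal enlarged by \<open>?u\<close> lies in the new
      ideal.\<close>
    proof (rule cofinite_ideal_product[OF IH uH])
      have "?u * p \<in> ideal_gen ?H" if "p \<in> ideal_gen ?G" for p
      proof -
        have sub: "?u * x \<in> ideal_gen ?H" if "x \<in> ?G" for x
        proof -
          have "?u * g A \<xi> \<in> ideal_gen ?H" if "\<xi> \<in> X" for \<xi>
          proof (cases "n t \<bullet> w \<xi> = 0")
            case True
            then have "g A \<xi> \<in> ?H" using that by (auto simp: g_ins image_iff)
            then show ?thesis by (intro ideal_mult ideal_base)
          next
            case False
            then have "?u * g A \<xi> \<in> ?H" using that by (auto simp: g_ins image_iff)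
            then show ?thesis by (rule ideal_base)
          qed
          then show ?thesis using that by (auto intro: ideal_mult ideal_base)
        qed
        from that show ?thesis
          unfolding ideal_gen_eq_span
        proof (induction rule: pm.span_induct_alt)
          case (step c x y)
          have "?u * (c * x + y) = c * (?u * x) + ?u * y" by (simp add: algebra_simps)
          also have "\<dots> \<in> pm.span ?H"
            using sub[OF step(1)] step(2) unfolding ideal_gen_eq_span
            by (rule pm.span_add[OF pm.span_scale])
          finally show ?case .
        qed (simp add: pm.span_zero)
      qed note uG = this
      fix p q assume p: "p \<in> ideal_gen ?G" and q: "q \<in> ideal_gen (insert ?u ?H)"
      then obtain c where c: "q - c * ?u \<in> ideal_gen ?H" by (auto simp: ideal_insert)
      have "p * q = p * (q - c * ?u) + c * (?u * p)" by (simp add: algebra_simps)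
      also have "\<dots> \<in> ideal_gen ?H" by (rule ideal_add[OF ideal_mult[OF c] ideal_mult[OF uG[OF p]]])
      finally show "p * q \<in> ideal_gen ?H" .
    qed
  qed
  then show ?case by (simp add: g_def)
qed

unbundle no cross3_syntax

section \<open>Ideals generated by powers of linear forms in two variables\<close>

text \<open>Each derivative costs at most one factor of the root.\<close>

lemma higher_pderiv_dvd:
  fixes F :: "real poly"
  assumes "[:a, 1:] ^ s dvd F" "p \<le> s"
  shows "[:a, 1:] ^ (s - p) dvd (pderiv ^^ p) F"
  using assms(2)
proof (induction p)
  case (Suc p)
  then have "[:a, 1:] ^ Suc (s - Suc p) dvd (pderiv ^^ p) F" by (simp add: Suc_diff_Suc del: power_Suc)
  then obtain H where H: "(pderiv ^^ p) F = [:a, 1:] ^ Suc (s - Suc p) * H" by (auto simp: dvd_def)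
  have "[:a, 1:] ^ (s - Suc p) dvd pderiv ([:a, 1:] ^ Suc (s - Suc p) * H)"
    unfolding pderiv_mult pderiv_power_Suc
    by (rule dvd_add, rule dvd_mult2, rule le_imp_power_dvd, simp, rule dvd_mult, rule dvd_mult2,
        rule dvd_smult, rule dvd_refl)
  then show ?case by (simp add: H)
qed (use assms(1) in simp)

lemma poly_higher_pderiv_root:
  fixes F :: "real poly"
  assumes "[:a, 1:] ^ s dvd F" "p < s"
  shows "poly ((pderiv ^^ p) F) (- a) = 0"
proof -
  have "[:a, 1:] ^ Suc 0 dvd [:a, 1:] ^ (s - p)" using assms(2) by (intro le_imp_power_dvd) simp
  also have "\<dots> dvd (pderiv ^^ p) F" using assms by (intro higher_pderiv_dvd) auto
  finally show ?thesis by (auto simp: dvd_def)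
qed

text \<open>At the root only the term survives in which every derivative hits the power. One
  derivative is peeled off and its remainder absorbed into G, hence the induction over arbitrary
  G.\<close>

lemma poly_higher_pderiv_top:
  fixes G :: "real poly"
  shows "poly ((pderiv ^^ p) ([:a, 1:] ^ p * G)) (- a) = fact p * poly G (- a)"
proof (induction p arbitrary: G)
  case (Suc p)
  have "pderiv ([:a, 1:] ^ Suc p * G) = [:a, 1:] ^ p * (smult (of_nat (Suc p)) G + [:a, 1:] * pderiv G)"
    unfolding pderiv_mult pderiv_power_Suc by (simp add: pderiv_pCons algebra_simps)
  then have "(pderiv ^^ Suc p) ([:a, 1:] ^ Suc p * G)
      = (pderiv ^^ p) ([:a, 1:] ^ p * (smult (of_nat (Suc p)) G + [:a, 1:] * pderiv G))"
    by (simp only: funpow_Suc_right o_apply)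
  then show ?case by (simp only: Suc.IH) simp
qed simp

lemma higher_pderiv_monom':
  "(pderiv ^^ p) (monom (c::real) q) = (if p \<le> q then monom (c * fact q / fact (q - p)) (q - p) else 0)"
proof (induction p)
  case (Suc p)
  show ?case
  proof (cases "Suc p \<le> q")
    case True
    then have q: "q - p = Suc (q - Suc p)" by simp
    then have "fact (q - p) = (real (q - p)) * fact (q - Suc p)" by (metis fact_Suc of_nat_mult of_nat_fact)
    with True q Suc show ?thesis by (simp add: pderiv_monom)
  next
    case False
    with Suc show ?thesis by (cases "p \<le> q") (auto simp: pderiv_monom monom_0)
  qed
qed simp

lemma poly_higher_pderiv_sum:
  fixes F :: "real poly"
  assumes "degree F \<le> j"
  shows "poly ((pderiv ^^ p) F) x
     = (\<Sum>q\<le>j. coeff F q * (if p \<le> q then fact q / fact (q - p) * x ^ (q - p) else 0))"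
proof -
  have "poly ((pderiv ^^ p) F) x = poly ((pderiv ^^ p) (\<Sum>q\<le>j. monom (coeff F q) q)) x"
    using assms by (simp add: poly_as_sum_of_monoms')
  also have "\<dots> = (\<Sum>q\<le>j. coeff F q * (if p \<le> q then fact q / fact (q - p) * x ^ (q - p) else 0))"
    unfolding higher_pderiv_sum poly_sum
    by (intro sum.cong) (auto simp: higher_pderiv_monom' poly_monom)
  finally show ?thesis .
qed

text \<open>
  The coefficient relations say that the functional \<open>F \<mapsto> \<Sum> c a p (j - p)! F\<^sup>(\<^sup>p\<^sup>)(-a)\<close> vanishes on all
  polynomials of degree at most \<open>j\<close>; it is tested on a Hermite interpolation polynomial.
\<close>

lemma binary_powers_independent:
  fixes A :: "real set" and s :: "real \<Rightarrow> nat"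
  assumes A: "finite A" "(\<Sum>a\<in>A. s a) \<le> Suc j"
    and c: "\<And>q. q \<le> j \<Longrightarrow> (\<Sum>a\<in>A. \<Sum>p<s a. c a p * (if p \<le> q then real ((j - p) choose (q - p)) * (- a) ^ (q - p) else 0)) = 0"
    and a0: "a0 \<in> A" "p0 < s a0"
  shows "c a0 p0 = 0"
proof (rule ccontr)
  assume nz: "c a0 p0 \<noteq> 0"
  \<comment> \<open>M is the highest order at a0 with a nonzero coefficient. The test polynomial F
    vanishes at -a0 to order exactly M and at every other -a to the full order \<open>s a\<close>,
    so the functional picks out the single term (a0, M).\<close>
  define M where "M = Max {p. p < s a0 \<and> c a0 p \<noteq> 0}"
  have fin: "finite {p. p < s a0 \<and> c a0 p \<noteq> 0}" by simp
  have "M \<in> {p. p < s a0 \<and> c a0 p \<noteq> 0}"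
    unfolding M_def by (rule Max_in[OF fin]) (use nz a0 in auto)
  then have M: "M < s a0" "c a0 M \<noteq> 0" by auto
  have Mmax: "c a0 p = 0" if "p < s a0" "M < p" for p
    using Max_ge[OF fin, of p] that by (fastforce simp: M_def)
  define G :: "real poly" where "G = (\<Prod>a\<in>A - {a0}. [:a, 1:] ^ s a)"
  define F where "F = [:a0, 1:] ^ M * G"
  have sle: "s a \<le> Suc j" if "a \<in> A" for a
    using member_le_sum[OF that, of s] A by simp
  have degG: "degree G \<le> (\<Sum>a\<in>A - {a0}. s a)"
    unfolding G_def using degree_prod_sum_le[of "A - {a0}" "\<lambda>a. [:a, 1:] ^ s a"] A(1)
    by (simp add: o_def degree_power_eq)
  have "degree F \<le> M + degree G" unfolding F_def
    by (rule order.trans[OF degree_mult_le]) (simp add: degree_power_eq)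
  also have "\<dots> \<le> M + (\<Sum>a\<in>A - {a0}. s a)" using degG by simp
  \<comment> \<open>M is strictly less than \<open>s a0\<close>; this unit is what brings the bound
    down from \<open>Suc j\<close> to j.\<close>
  also have "\<dots> \<le> j" using sum.remove[OF A(1) a0(1), of s] A(2) M(1) by simp
  finally have degF: "degree F \<le> j" .
  define L where "L = (\<Sum>a\<in>A. \<Sum>p<s a. c a p * fact (j - p) * poly ((pderiv ^^ p) F) (- a))"
  have "L = (\<Sum>a\<in>A. \<Sum>p<s a. \<Sum>q\<le>j. coeff F q * fact q * fact (j - q) *
       (c a p * (if p \<le> q then real ((j - p) choose (q - p)) * (- a) ^ (q - p) else 0)))"
    unfolding L_def poly_higher_pderiv_sum[OF degF] sum_distrib_left
  proof (intro sum.cong refl)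
    fix a p q assume "a \<in> A" "p \<in> {..<s a}" "q \<in> {..j}"
    show "c a p * fact (j - p) * (coeff F q * (if p \<le> q then fact q / fact (q - p) * (- a) ^ (q - p) else 0))
      = coeff F q * fact q * fact (j - q) *
       (c a p * (if p \<le> q then real ((j - p) choose (q - p)) * (- a) ^ (q - p) else 0))"
    proof (cases "p \<le> q")
      case True
      \<comment> \<open>The identity (j - p)! q! / (q - p)! = q! (j - q)! binom(j - p, q - p) is the
        reason for the weights (j - p)! in the functional.\<close>
      have "real ((j - p) choose (q - p)) = fact (j - p) / (fact (q - p) * fact (j - q))"
        using True \<open>q \<in> {..j}\<close> by (subst binomial_fact) auto
      then show ?thesis using True by simp
    qed simp
  qed
  also have "\<dots> = (\<Sum>q\<le>j. coeff F q * fact q * fact (j - q) * (\<Sum>a\<in>A. \<Sum>p<s a.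
       c a p * (if p \<le> q then real ((j - p) choose (q - p)) * (- a) ^ (q - p) else 0)))"
    unfolding sum_distrib_left by (subst (2) sum.swap) (intro sum.cong refl sum.swap)
  also have "\<dots> = 0" using c by simp
  finally have L0: "L = 0" .
  have in0: "(\<Sum>p<s a. c a p * fact (j - p) * poly ((pderiv ^^ p) F) (- a)) = 0" if "a \<in> A - {a0}" for a
  proof (intro sum.neutral ballI)
    fix p assume "p \<in> {..<s a}"
    moreover have "[:a, 1:] ^ s a dvd F"
      unfolding F_def G_def using that A(1) by (intro dvd_mult dvd_prodI) auto
    ultimately show "c a p * fact (j - p) * poly ((pderiv ^^ p) F) (- a) = 0"
      by (simp add: poly_higher_pderiv_root)
  qed
  have "L = (\<Sum>p<s a0. c a0 p * fact (j - p) * poly ((pderiv ^^ p) F) (- a0))"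
    unfolding L_def using in0 by (subst sum.remove[OF A(1) a0(1)]) simp
  also have "\<dots> = (\<Sum>p\<in>{M}. c a0 p * fact (j - p) * poly ((pderiv ^^ p) F) (- a0))"
  proof (rule sum.mono_neutral_right)
    show "\<forall>p\<in>{..<s a0} - {M}. c a0 p * fact (j - p) * poly ((pderiv ^^ p) F) (- a0) = 0"
    proof
      fix p assume p: "p \<in> {..<s a0} - {M}"
      show "c a0 p * fact (j - p) * poly ((pderiv ^^ p) F) (- a0) = 0"
      proof (cases "M < p")
        case True
        then show ?thesis using p Mmax by simp
      next
        case False
        then have "p < M" using p by auto
        moreover have "[:a0, 1:] ^ M dvd F" by (simp add: F_def)
        ultimately show ?thesis by (simp add: poly_higher_pderiv_root)
      qed
    qed
  qed (use M in auto)
  also have "\<dots> = c a0 M * fact (j - M) * (fact M * poly G (- a0))"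
    by (simp add: F_def poly_higher_pderiv_top)
  finally have "poly G (- a0) = 0" using L0 M(2) by simp
  then show False using A(1) by (simp add: G_def poly_prod)
qed

section \<open>Forms in the coordinates given by three independent linear forms\<close>

definition expo :: "nat \<Rightarrow> nat \<Rightarrow> nat \<Rightarrow> 3 \<Rightarrow>\<^sub>0 nat" where
  "expo x y z = Poly_Mapping.single 1 x + Poly_Mapping.single 2 y + Poly_Mapping.single 3 z"

lemma lookup_expo [simp]:
  "Poly_Mapping.lookup (expo x y z) 1 = x" "Poly_Mapping.lookup (expo x y z) 2 = y" "Poly_Mapping.lookup (expo x y z) 3 = z"
  by (auto simp: expo_def lookup_add lookup_single when_def)

lemma expo_eq_iff: "expo x y z = expo x' y' z' \<longleftrightarrow> x = x' \<and> y = y' \<and> z = z'"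
  by (metis lookup_expo)

lemma expo_lookup: "expo (Poly_Mapping.lookup m 1) (Poly_Mapping.lookup m 2) (Poly_Mapping.lookup m 3) = m"
proof (rule poly_mapping_eqI)
  fix k :: 3
  have "k = 1 \<or> k = 2 \<or> k = 3" by (rule exhaust_3)
  then show "Poly_Mapping.lookup (expo (Poly_Mapping.lookup m 1) (Poly_Mapping.lookup m 2) (Poly_Mapping.lookup m 3)) k
    = Poly_Mapping.lookup m k" by auto
qed

lemma mdeg_3: "mdeg m = Poly_Mapping.lookup m 1 + Poly_Mapping.lookup m 2 + Poly_Mapping.lookup m 3"
  by (simp add: mdeg_def sum_3)

lemma prod_3: "prod f (UNIV :: 3 set) = f 1 * f 2 * (f 3 :: 'a::comm_monoid_mult)"
  unfolding UNIV_3 by (simp add: ac_simps)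

lemma forms_finite_span:
  "\<exists>T. finite T \<and> {p. homogeneous k p} \<subseteq> p3.span T"
proof -
  let ?T = "(\<lambda>(x, y, z). Poly_Mapping.single (expo x y z) 1) ` ({..k} \<times> {..k} \<times> {..k})"
  have "p \<in> p3.span ?T" if "homogeneous k p" for p
  proof -
    have "(\<Sum>m\<in>Poly_Mapping.keys p. const3 (Poly_Mapping.lookup p m) * Poly_Mapping.single m 1) \<in> p3.span ?T"
    proof (intro p3.span_sum p3.span_scale p3.span_base)
      fix m assume "m \<in> Poly_Mapping.keys p"
      then have "mdeg m = k" using that by (auto simp: homogeneous_altdef in_keys_iff)
      then show "Poly_Mapping.single m 1 \<in> ?T"
        by (intro image_eqI[where x="(Poly_Mapping.lookup m 1, Poly_Mapping.lookup m 2, Poly_Mapping.lookup m 3)"])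
          (auto simp: expo_lookup mdeg_3)
    qed
    also have "(\<Sum>m\<in>Poly_Mapping.keys p. const3 (Poly_Mapping.lookup p m) * Poly_Mapping.single m 1) = p"
      by (subst (3) poly3_expand) (simp add: const3_def mult_single)
    finally show ?thesis .
  qed
  then show ?thesis by (intro exI[of _ ?T]) auto
qed

text \<open>In the application u and v span the plane of the normals at a point and w is the
  direction of that point, so the powers involve \<open>lin u\<close> and \<open>lin v\<close>
  only.\<close>

locale linear_coordinates =
  fixes u v w :: "real^3"
  assumes det: "u \<bullet> (cross3 v w) \<noteq> 0"
begin

definition "tm x y z = lin u ^ x * lin v ^ y * lin w ^ z"

text \<open>The coefficients are those of Cramer's rule: a polynomial is rewritten with
  \<open>lin u\<close>, \<open>lin v\<close>, \<open>lin w\<close> as the variables.\<close>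

definition "to_coords = sb.ins (\<lambda>i.
    const3 ((cross3 v w) $ i / (u \<bullet> (cross3 v w))) * pvar 1
    + const3 ((cross3 w u) $ i / (u \<bullet> (cross3 v w))) * pvar 2
    + const3 ((cross3 u v) $ i / (u \<bullet> (cross3 v w))) * pvar 3)"

definition "of_coords = sb.ins (\<lambda>i::3. if i = 1 then lin u else if i = 2 then lin v else lin w)"

lemma to_coords_lin: "to_coords (lin n) = const3 ((n \<bullet> cross3 v w) / (u \<bullet> (cross3 v w))) * pvar 1
    + const3 ((n \<bullet> cross3 w u) / (u \<bullet> (cross3 v w))) * pvar 2
    + const3 ((n \<bullet> cross3 u v) / (u \<bullet> (cross3 v w))) * pvar 3"
proof -
  have "const3 ((n \<bullet> c) / d) = (\<Sum>i\<in>UNIV. const3 (n $ i) * const3 (c $ i / d))" for c and d :: real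
    by (simp add: inner_vec_def sum_divide_distrib const3_sum flip: const3_simps(4))
  then show ?thesis
    by (simp add: to_coords_def sb_ins_lin distrib_left sum.distrib sum_distrib_right mult.assoc)
qed

lemma to_coords_uvw: "to_coords (lin u) = pvar 1" "to_coords (lin v) = pvar 2" "to_coords (lin w) = pvar 3"
proof -
  have d: "v \<bullet> cross3 w u = u \<bullet> cross3 v w" "w \<bullet> cross3 u v = u \<bullet> cross3 v w"
    by (simp_all add: cross3_def inner_vec_def sum_3) algebra+
  show "to_coords (lin u) = pvar 1" "to_coords (lin v) = pvar 2" "to_coords (lin w) = pvar 3"
    using det by (auto simp: to_coords_lin d dot_cross_self const3_simps)
qed

lemma to_coords_tm: "to_coords (tm x y z) = Poly_Mapping.single (expo x y z) 1"
proof -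
  have P: "pvar i ^ k = Poly_Mapping.single (Poly_Mapping.single i k) 1" for i k
    by (induction k) (auto simp: pvar_def mult_single simp flip: single_add)
  have "to_coords (tm x y z) = pvar 1 ^ x * pvar 2 ^ y * pvar 3 ^ z"
    unfolding tm_def to_coords_uvw[symmetric] by (simp add: to_coords_def sb.ins_mult sb.ins_power)
  then show ?thesis by (simp add: P mult_single expo_def)
qed

lemma of_to_coords: "of_coords (to_coords p) = p"
proof -
  let ?d = "u \<bullet> cross3 v w"
  have "of_coords (to_coords (pvar i)) = pvar i" for i
  proof -
    have "?d *\<^sub>R axis i 1 = (axis i 1 \<bullet> cross3 v w) *\<^sub>R u + (axis i 1 \<bullet> cross3 w u) *\<^sub>R v + (axis i 1 \<bullet> cross3 u v) *\<^sub>R w"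
      by (rule cross3_dual_expansion)
    then have "inverse ?d *\<^sub>R (?d *\<^sub>R axis i 1) = inverse ?d *\<^sub>R
       ((axis i 1 \<bullet> cross3 v w) *\<^sub>R u + (axis i 1 \<bullet> cross3 w u) *\<^sub>R v + (axis i 1 \<bullet> cross3 u v) *\<^sub>R w)"
      by (rule arg_cong)
    then have "axis i 1 = ((axis i 1 \<bullet> cross3 v w) / ?d) *\<^sub>R u + ((axis i 1 \<bullet> cross3 w u) / ?d) *\<^sub>R v
       + ((axis i 1 \<bullet> cross3 u v) / ?d) *\<^sub>R w"
      using det by (simp add: scaleR_right_distrib divide_inverse mult.commute)
    from arg_cong[OF this, of lin]
    have "pvar i = const3 ((axis i 1 \<bullet> cross3 v w) / ?d) * lin u + const3 ((axis i 1 \<bullet> cross3 w u) / ?d) * lin v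
       + const3 ((axis i 1 \<bullet> cross3 u v) / ?d) * lin w"
      by (simp only: lin_linear lin_axis)
    moreover have "of_coords (to_coords (pvar i)) = of_coords (to_coords (lin (axis i 1)))" by (simp add: lin_axis)
    ultimately show ?thesis unfolding to_coords_lin
      by (simp add: of_coords_def sb.ins_add sb.ins_mult sb.ins_const3 sb.ins_pvar)
  qed
  then show ?thesis
    by (induction p rule: poly3_ring_induct)
      (simp_all add: of_coords_def to_coords_def sb.ins_add sb.ins_mult sb.ins_const3)
qed

lemma homogeneous_to_coords: "homogeneous k p \<Longrightarrow> homogeneous k (to_coords p)"
  unfolding to_coords_def
  by (rule homogeneous_sb_ins) (use homogeneous_pvar in \<open>auto intro!: homogeneous_add homogeneous_const3_mult\<close>)

lemma form_expand:
  assumes "homogeneous k p"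
  shows "p \<in> p3.span {tm x y z |x y z. x + y + z = k}"
proof -
  let ?q = "to_coords p"
  have "p = of_coords ?q" by (simp add: of_to_coords)
  also have "\<dots> = (\<Sum>m\<in>Poly_Mapping.keys ?q. const3 (Poly_Mapping.lookup ?q m) *
      tm (Poly_Mapping.lookup m 1) (Poly_Mapping.lookup m 2) (Poly_Mapping.lookup m 3))"
    by (simp add: of_coords_def sb.ins_def prod_3 tm_def)
  also have "\<dots> \<in> p3.span {tm x y z |x y z. x + y + z = k}"
  proof (intro p3.span_sum p3.span_scale p3.span_base)
    fix m assume "m \<in> Poly_Mapping.keys ?q"
    then have "mdeg m = k" using homogeneous_to_coords[OF assms] by (auto simp: homogeneous_altdef in_keys_iff)
    then show "tm (Poly_Mapping.lookup m 1) (Poly_Mapping.lookup m 2) (Poly_Mapping.lookup m 3)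
       \<in> {tm x y z |x y z. x + y + z = k}"
      by (auto simp: mdeg_3)
  qed
  finally show ?thesis .
qed

text \<open>The coefficient of \<open>tm x y z\<close> when p is expanded in the new
  coordinates.\<close>

definition "cf p x y z = Poly_Mapping.lookup (to_coords p) (expo x y z)"

lemma cf_0 [simp]: "cf 0 x y z = 0"
  by (simp add: cf_def to_coords_def)

lemma cf_sum: "cf (sum f I) x y z = (\<Sum>i\<in>I. cf (f i) x y z)"
  by (simp add: cf_def to_coords_def sb.ins_sum lookup_sum)

lemma cf_const3_mult: "cf (const3 c * p) x y z = c * cf p x y z"
proof -
  have "Poly_Mapping.lookup (const3 c * q) m = c * Poly_Mapping.lookup q m" for q m
  proof (induction q rule: poly3_induct)
    case (add p m' c')
    then show ?case by (simp add: distrib_left lookup_add const3_def mult_single lookup_single when_def)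
  qed simp
  then show ?thesis by (simp add: cf_def to_coords_def sb.ins_mult sb.ins_const3)
qed

lemma cf_tm: "cf (tm x' y' z') x y z = (if x = x' \<and> y = y' \<and> z = z' then 1 else 0)"
  by (auto simp: cf_def to_coords_tm lookup_single expo_eq_iff when_def)

text \<open>Sorting by j, the joint degree in \<open>lin u\<close> and \<open>lin v\<close>, splits
  the forms of degree k into levels, each a copy of the binary forms of degree j. Within level j
  those with p + e \<le> j are multiples of the e-th power of
  \<open>lin u - const3 a * lin v\<close>.\<close>

definition "pw k j a p = (lin u - const3 a * lin v) ^ (j - p) * lin v ^ p * lin w ^ (k - j)"

lemma pw_expand:
  assumes "p \<le> j"
  shows "pw k j a p = (\<Sum>i\<le>j - p. const3 (real ((j - p) choose i) * (- a) ^ i) * tm (j - p - i) (p + i) (k - j))"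
proof -
  have "lin u - const3 a * lin v = const3 (- a) * lin v + lin u" by (simp add: const3_simps)
  then have "(lin u - const3 a * lin v) ^ (j - p)
      = (\<Sum>i\<le>j - p. of_nat ((j - p) choose i) * (const3 (- a) * lin v) ^ i * lin u ^ (j - p - i))"
    by (simp only: binomial_ring)
  moreover have "of_nat n = const3 (real n)" for n
    by (induction n) (auto simp: const3_simps)
  ultimately have "pw k j a p = (\<Sum>i\<le>j - p. (const3 (real ((j - p) choose i)) * (const3 (- a) * lin v) ^ i * lin u ^ (j - p - i))
       * lin v ^ p * lin w ^ (k - j))"
    by (simp add: pw_def sum_distrib_right)
  also have "\<dots> = (\<Sum>i\<le>j - p. const3 (real ((j - p) choose i) * (- a) ^ i) * tm (j - p - i) (p + i) (k - j))"
    by (intro sum.cong refl) (simp only: tm_def const3_simps power_mult_distrib power_add mult_ac)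
  finally show ?thesis .
qed

text \<open>The exponents are truncated differences; the bounds on p, q, j and j' ensure that equal
  exponents determine the level and the summation index q - p.\<close>

lemma cf_pw:
  assumes "p \<le> j" "q \<le> j'" "j \<le> k" "j' \<le> k"
  shows "cf (pw k j a p) (j' - q) q (k - j')
     = (if j = j' then if p \<le> q then real ((j' - p) choose (q - p)) * (- a) ^ (q - p) else 0 else 0)"
proof -
  have *: "j' - q = j - p - i \<and> q = p + i \<and> k - j' = k - j \<longleftrightarrow> j = j' \<and> p \<le> q \<and> i = q - p" if "i \<le> j - p" for i
    using assms that by auto
  have "cf (pw k j a p) (j' - q) q (k - j')
      = (\<Sum>i\<le>j - p. real ((j - p) choose i) * (- a) ^ i *
          (if j' - q = j - p - i \<and> q = p + i \<and> k - j' = k - j then 1 else 0))"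
    using assms by (simp add: pw_expand cf_sum cf_const3_mult cf_tm)
  also have "\<dots> = (\<Sum>i\<le>j - p. if i = q - p then if j = j' \<and> p \<le> q then real ((j - p) choose i) * (- a) ^ i else 0 else 0)"
    by (intro sum.cong refl) (use * in auto)
  also have "\<dots> = (if j = j' then if p \<le> q then real ((j' - p) choose (q - p)) * (- a) ^ (q - p) else 0 else 0)"
    using assms by (auto simp: sum.delta)
  finally show ?thesis .
qed

abbreviation "pwx k \<equiv> (\<lambda>(j, a, p). pw k j a p)"

lemma homogeneous_pw: "p \<le> j \<Longrightarrow> j \<le> k \<Longrightarrow> homogeneous k (pw k j a p)"
proof -
  assume "p \<le> j" "j \<le> k"
  have "homogeneous ((j - p) + p + (k - j)) (pw k j a p)"
    unfolding pw_def
    by (intro homogeneous_mult homogeneous_lin_power)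
      (metis homogeneous_lin_power lin_linear(2,3))
  then show ?thesis using \<open>p \<le> j\<close> \<open>j \<le> k\<close> by simp
qed

text \<open>Different levels share no monomials, so comparing coefficients separates them; within
  one level \<open>binary_powers_independent\<close> applies.\<close>

lemma pw_independent:
  assumes A: "finite A" and s: "\<And>j. j \<le> k \<Longrightarrow> (\<Sum>a\<in>A. s j a) \<le> Suc j"
    and K: "K \<subseteq> {..k}"
    and 0: "(\<Sum>x\<in>Sigma K (\<lambda>j. Sigma A (\<lambda>a. {..<s j a})). const3 (\<kappa> x) * pwx k x) = 0"
  shows "\<forall>x\<in>Sigma K (\<lambda>j. Sigma A (\<lambda>a. {..<s j a})). \<kappa> x = 0"
proof -
  have finK: "finite K" using K finite_subset by blast
  have sle: "s j a \<le> Suc j" if "j \<le> k" "a \<in> A" for j a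
    using member_le_sum[OF that(2), of "s j"] s[OF that(1)] A by simp
  have rel: "(\<Sum>a\<in>A. \<Sum>p<s j' a. \<kappa> (j', a, p) * (if p \<le> q then real ((j' - p) choose (q - p)) * (- a) ^ (q - p) else 0)) = 0"
    if j': "j' \<in> K" and q: "q \<le> j'" for j' q
  proof -
    have jk: "j' \<le> k" using j' K by auto
    have "0 = (\<Sum>x\<in>Sigma K (\<lambda>j. Sigma A (\<lambda>a. {..<s j a})). \<kappa> x * cf (pwx k x) (j' - q) q (k - j'))"
      using arg_cong[OF 0, of "\<lambda>p. cf p (j' - q) q (k - j')"] by (simp add: cf_sum cf_const3_mult)
    also have "\<dots> = (\<Sum>j\<in>K. \<Sum>a\<in>A. \<Sum>p<s j a. \<kappa> (j, a, p) * cf (pw k j a p) (j' - q) q (k - j'))"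
      using A finK by (simp add: sum.Sigma split_def)
    also have "\<dots> = (\<Sum>j\<in>K. if j = j' then (\<Sum>a\<in>A. \<Sum>p<s j' a. \<kappa> (j', a, p) *
        (if p \<le> q then real ((j' - p) choose (q - p)) * (- a) ^ (q - p) else 0)) else 0)"
    proof (rule sum.cong[OF refl])
      fix j assume j: "j \<in> K"
      then have jk2: "j \<le> k" using K by auto
      have cfeq: "cf (pw k j a p) (j' - q) q (k - j')
         = (if j = j' then if p \<le> q then real ((j' - p) choose (q - p)) * (- a) ^ (q - p) else 0 else 0)"
        if "a \<in> A" "p \<in> {..<s j a}" for a p
        using sle[OF jk2 that(1)] that(2) q jk jk2 by (intro cf_pw) auto
      have "(\<Sum>a\<in>A. \<Sum>p<s j a. \<kappa> (j, a, p) * cf (pw k j a p) (j' - q) q (k - j'))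
        = (\<Sum>a\<in>A. \<Sum>p<s j a. \<kappa> (j, a, p) * (if j = j' then if p \<le> q then real ((j' - p) choose (q - p)) * (- a) ^ (q - p) else 0 else 0))"
        by (intro sum.cong refl) (simp only: cfeq)
      then show "(\<Sum>a\<in>A. \<Sum>p<s j a. \<kappa> (j, a, p) * cf (pw k j a p) (j' - q) q (k - j'))
        = (if j = j' then (\<Sum>a\<in>A. \<Sum>p<s j' a. \<kappa> (j', a, p) *
        (if p \<le> q then real ((j' - p) choose (q - p)) * (- a) ^ (q - p) else 0)) else 0)"
        by (cases "j = j'") auto
    qed
    also have "\<dots> = (\<Sum>a\<in>A. \<Sum>p<s j' a. \<kappa> (j', a, p) *
        (if p \<le> q then real ((j' - p) choose (q - p)) * (- a) ^ (q - p) else 0))"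
      using j' finK by simp
    finally show ?thesis by simp
  qed
  have "\<kappa> (j, a, p) = 0" if "j \<in> K" "a \<in> A" "p < s j a" for j a p
    using binary_powers_independent[OF A s, of j "\<lambda>a p. \<kappa> (j, a, p)" a p] rel that K by auto
  then show ?thesis by auto
qed

lemma dim_pw_span:
  assumes "finite A" "\<And>j. j \<le> k \<Longrightarrow> (\<Sum>a\<in>A. s j a) \<le> Suc j" "K \<subseteq> {..k}"
  shows "p3.dim (p3.span (pwx k ` Sigma K (\<lambda>j. Sigma A (\<lambda>a. {..<s j a})))) = (\<Sum>j\<in>K. \<Sum>a\<in>A. s j a)"
proof -
  have finK: "finite K" using assms(3) finite_subset by blast
  have "p3.dim (p3.span (pwx k ` Sigma K (\<lambda>j. Sigma A (\<lambda>a. {..<s j a}))))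
      = card (Sigma K (\<lambda>j. Sigma A (\<lambda>a. {..<s j a})))"
    using pw_independent[OF assms] by (intro p3.dim_family) (use assms(1) finK in auto)
  also have "\<dots> = (\<Sum>j\<in>K. \<Sum>a\<in>A. s j a)" using assms(1) finK by simp
  finally show ?thesis .
qed

text \<open>The j + 1 chosen forms are independent inside level j, which is spanned by j + 1
  monomials. So they span the level, including the powers with any other slope b.\<close>

lemma level_span:
  assumes A: "finite A" and s: "(\<Sum>a\<in>A. s a) = Suc j" and j: "j \<le> k" "p \<le> j"
  shows "pw k j b p \<in> p3.span {pw k j a p |a p. a \<in> A \<and> p < s a}"
proof -
  let ?T = "(\<lambda>y. tm (j - y) y (k - j)) ` {..j}"
  let ?S = "{pw k j a p |a p. a \<in> A \<and> p < s a}"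
  have sle: "s a \<le> Suc j" if "a \<in> A" for a using member_le_sum[OF that, of s] s A by simp
  have inT: "pw k j a p \<in> p3.span ?T" if "p \<le> j" for a p
    unfolding pw_expand[OF that]
  proof (intro p3.span_sum p3.span_scale p3.span_base)
    fix i assume "i \<in> {..j - p}"
    then show "tm (j - p - i) (p + i) (k - j) \<in> ?T"
      using that by (intro image_eqI[of _ _ "p + i"]) auto
  qed
  have eq: "pwx k ` Sigma {j} (\<lambda>j. Sigma A (\<lambda>a. {..<s a})) = ?S" by (force simp: image_iff)
  \<comment> \<open>\<open>dim_pw_span\<close> asks for a bound at every level up to k; counts equal
    to 0 off level j provide it.\<close>
  define s' where "s' j' a = (if j' = j then s a else 0)" for j' a
  have "Sigma {j} (\<lambda>j'. Sigma A (\<lambda>a. {..<s' j' a})) = Sigma {j} (\<lambda>j. Sigma A (\<lambda>a. {..<s a}))"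
    by (auto simp: s'_def)
  then have "p3.dim (p3.span ?S) = p3.dim (p3.span (pwx k ` Sigma {j} (\<lambda>j'. Sigma A (\<lambda>a. {..<s' j' a}))))"
    by (simp only: eq)
  also have "\<dots> = (\<Sum>j'\<in>{j}. \<Sum>a\<in>A. s' j' a)"
  proof (rule dim_pw_span[OF A])
    show "(\<Sum>a\<in>A. s' j' a) \<le> Suc j'" for j' using s by (cases "j' = j") (auto simp: s'_def)
  qed (use j in auto)
  also have "\<dots> = Suc j" using s by (simp add: s'_def)
  finally have dimS: "p3.dim (p3.span ?S) = Suc j" .
  have "p3.span ?T \<subseteq> p3.span ?S"
  proof (rule p3.subspace_le_of_dim_le[where T="?T"])
    have "?S \<subseteq> p3.span ?T"
    proof clarify
      fix a p assume "a \<in> A" "p < s a"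
      then show "pw k j a p \<in> p3.span ?T" using sle[of a] by (intro inT) auto
    qed
    then show "p3.span ?S \<subseteq> p3.span ?T" by (intro p3.span_minimal p3.subspace_span)
    have "p3.dim (p3.span ?T) \<le> card ?T" by (rule p3.dim_le_card) auto
    also have "\<dots> \<le> Suc j" using card_image_le[of "{..j}" "\<lambda>y. tm (j - y) y (k - j)"] by simp
    finally show "p3.dim (p3.span ?T) \<le> p3.dim (p3.span ?S)" using dimS by simp
  qed (auto intro: p3.subspace_span)
  then show ?thesis using inT[OF j(2)] by blast
qed

text \<open>Filled greedily. Serves to select exactly j + 1 multiples when the powers offer more
  than the level can hold.\<close>

lemma ex_bounded_sum:
  "finite A \<Longrightarrow> N \<le> card A * b \<Longrightarrow> \<exists>s :: 'x \<Rightarrow> nat. (\<forall>a\<in>A. s a \<le> b) \<and> sum s A = N"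
proof (induction A arbitrary: N rule: finite_induct)
  case (insert x A)
  have "N - min N b \<le> card A * b" using insert.prems insert.hyps by auto
  from insert.IH[OF this] obtain s where s: "\<forall>a\<in>A. s a \<le> b" "sum s A = N - min N b" by auto
  have "sum (s(x := min N b)) A = sum s A" using insert.hyps by (intro sum.cong) auto
  then show ?case using s insert.hyps by (intro exI[of _ "s(x := min N b)"]) auto
qed auto

text \<open>The graded piece is a direct sum over levels. At level j each power offers j + 1 - e
  multiples, none if j < e (the subtraction is meant to truncate), and these stay independent until
  they fill the level of dimension j + 1.\<close>

theorem dim_power_ideal:
  assumes A: "finite A"
  shows "p3.dim {p \<in> ideal_gen ((\<lambda>a. (lin u - const3 a * lin v) ^ e) ` A). homogeneous k p}
       = (\<Sum>j\<le>k. min (Suc j) (card A * (Suc j - e)))"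
proof -
  \<comment> \<open>\<open>f a\<close> counts the multiples kept for slope a: all of them if there
    are at most j + 1 in total, otherwise a selection of size j + 1. The last clause records the
    first alternative.\<close>
  have "\<exists>f :: real \<Rightarrow> nat. (\<forall>a\<in>A. f a \<le> Suc j - e) \<and> sum f A = min (Suc j) (card A * (Suc j - e)) \<and>
      (card A * (Suc j - e) \<le> Suc j \<longrightarrow> (\<forall>a\<in>A. f a = Suc j - e))" for j
  proof (cases "card A * (Suc j - e) \<le> Suc j")
    case True
    then show ?thesis by (intro exI[of _ "\<lambda>_. Suc j - e"]) auto
  next
    case False
    then show ?thesis using ex_bounded_sum[OF A, of "Suc j" "Suc j - e"] by auto
  qed
  then obtain s :: "nat \<Rightarrow> real \<Rightarrow> nat" where
    s1: "\<And>j a. a \<in> A \<Longrightarrow> s j a \<le> Suc j - e" and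
    s2: "\<And>j. sum (s j) A = min (Suc j) (card A * (Suc j - e))" and
    s3: "\<And>j a. card A * (Suc j - e) \<le> Suc j \<Longrightarrow> a \<in> A \<Longrightarrow> s j a = Suc j - e"
    by metis
  let ?J = "Sigma {..k} (\<lambda>j. Sigma A (\<lambda>a. {..<s j a}))"
  let ?g = "\<lambda>a. (lin u - const3 a * lin v) ^ e"
  let ?V = "{p \<in> ideal_gen (?g ` A). homogeneous k p}"
  have hg: "homogeneous e (?g a)" for a by (metis homogeneous_lin_power lin_linear(2,3))
  have in1: "pw k j a p \<in> p3.span (pwx k ` ?J)" if "a \<in> A" "p < Suc j - e" "j \<le> k" for a p j
  proof (cases "card A * (Suc j - e) \<le> Suc j")
    case True
    then have "p < s j a" using s3 that by auto
    then have "(j, a, p) \<in> ?J" using that by auto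
    then have "pwx k (j, a, p) \<in> pwx k ` ?J" by (rule imageI)
    from p3.span_base[OF this] show ?thesis by simp
  next
    case False
    then have "pw k j a p \<in> p3.span {pw k j a p |a p. a \<in> A \<and> p < s j a}"
    proof (intro level_span A)
      show "sum (s j) A = Suc j" using False s2[of j] by (simp only: min_def) simp
    qed (use that in auto)
    moreover have "{pw k j a p |a p. a \<in> A \<and> p < s j a} \<subseteq> pwx k ` ?J"
    proof clarify
      fix b q assume "b \<in> A" "q < s j b"
      then have "(j, b, q) \<in> ?J" using that by auto
      then have "pwx k (j, b, q) \<in> pwx k ` ?J" by (rule imageI)
      then show "pw k j b q \<in> pwx k ` ?J" by (simp only: case_prod_conv)
    qed
    ultimately show ?thesis using p3.span_mono by blast
  qed
  \<comment> \<open>Expanding \<open>lin u\<close> as the sum of \<open>?L\<close> and a times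
    \<open>lin v\<close> turns the multiple into a combination of the forms \<open>pw\<close> at
    level e + x + y.\<close>
  have in2: "?g a * tm x y z \<in> p3.span (pwx k ` ?J)" if "a \<in> A" "x + y + z + e = k" for a x y z
  proof -
    let ?L = "lin u - const3 a * lin v"
    have "lin u ^ x = (const3 a * lin v + ?L) ^ x" by simp
    also have "\<dots> = (\<Sum>i\<le>x. of_nat (x choose i) * (const3 a * lin v) ^ i * ?L ^ (x - i))"
      by (rule binomial_ring)
    finally have "lin u ^ x = (\<Sum>i\<le>x. of_nat (x choose i) * (const3 a * lin v) ^ i * ?L ^ (x - i))" .
    moreover have of_nat: "of_nat n = const3 (real n)" for n
      by (induction n) (auto simp: const3_simps)
    ultimately have "?g a * tm x y z = (\<Sum>i\<le>x. ?g a * (const3 (real (x choose i)) * (const3 a * lin v) ^ i * ?L ^ (x - i)) * lin v ^ y * lin w ^ z)"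
      by (simp add: tm_def sum_distrib_left sum_distrib_right mult.assoc)
    also have "\<dots> = (\<Sum>i\<le>x. const3 (real (x choose i) * a ^ i) * pw k (e + x + y) a (y + i))"
    proof (intro sum.cong refl)
      fix i assume "i \<in> {..x}"
      then have e1: "e + x + y - (y + i) = e + (x - i)" "k - (e + x + y) = z" using that by auto
      show "?g a * (const3 (real (x choose i)) * (const3 a * lin v) ^ i * ?L ^ (x - i)) * lin v ^ y * lin w ^ z
        = const3 (real (x choose i) * a ^ i) * pw k (e + x + y) a (y + i)"
        unfolding pw_def e1 by (simp only: const3_simps power_mult_distrib power_add mult_ac)
    qed
    also have "\<dots> \<in> p3.span (pwx k ` ?J)"
      using that by (intro p3.span_sum p3.span_scale in1) auto
    finally show ?thesis .
  qed
  have "?V = p3.span (pwx k ` ?J)"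
  proof
    show "p3.span (pwx k ` ?J) \<subseteq> ?V"
    proof (rule p3.span_minimal[OF _ subspace_ideal_part], rule subsetI)
      fix h assume "h \<in> pwx k ` ?J"
      then obtain j a p where jap: "j \<in> {..k}" "a \<in> A" "p \<in> {..<s j a}" and h: "h = pw k j a p"
        by auto
      then have p: "p < Suc j - e" using s1[of a j] by auto
      have "pw k j a p = (lin u - const3 a * lin v) ^ (j - p - e) * lin v ^ p * lin w ^ (k - j) * ?g a"
      proof -
        have "j - p = (j - p - e) + e" using p by auto
        then have "(lin u - const3 a * lin v) ^ (j - p) = (lin u - const3 a * lin v) ^ (j - p - e) * ?g a"
          by (metis power_add)
        then show ?thesis by (simp only: pw_def mult_ac)
      qed
      then have "pw k j a p \<in> ideal_gen (?g ` A)" using jap by (auto intro: ideal_mult ideal_base)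
      then show "h \<in> ?V"
        unfolding h using homogeneous_pw[of p j k a] p jap by auto
    qed
  next
    show "?V \<subseteq> p3.span (pwx k ` ?J)"
    proof clarify
      fix p assume p: "p \<in> ideal_gen (?g ` A)" "homogeneous k p"
      obtain q where q: "p = (\<Sum>a\<in>A. q a * ?g a)"
        using ideal_image[OF A, THEN iffD1, OF p(1)] by blast
      have "p = hpart k p" using p(2) by (simp add: hpart_homogeneous)
      also have "\<dots> = (\<Sum>a\<in>A. hpart k (?g a * q a))" unfolding q hpart_sum by (simp add: mult.commute)
      finally have eq: "p = (\<Sum>a\<in>A. hpart k (?g a * q a))" .
      show "p \<in> p3.span (pwx k ` ?J)"
      \<comment> \<open>Below degree e the ideal contains only 0; the cofactor degree k - e would be
        truncated there.\<close>
      proof (cases "e \<le> k")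
        case False
        then have "p = 0" using eq hpart_mult_lower[OF hg] by simp
        then show ?thesis by (simp add: p3.span_zero)
      next
        case True
        have "?g a * h \<in> p3.span (pwx k ` ?J)" if "h \<in> p3.span {tm x y z |x y z. x + y + z = k - e}" "a \<in> A" for h a
          using that(1)
        proof (induction rule: p3.span_induct_alt)
          case base
          then show ?case by (simp add: p3.span_zero)
        next
          case (step c x y)
          have "?g a * (const3 c * x + y) = const3 c * (?g a * x) + ?g a * y" by (simp add: distrib_left mult.left_commute)
          moreover have "?g a * x \<in> p3.span (pwx k ` ?J)" using step(1) in2[OF that(2)] True by auto
          ultimately show ?case using step(2) by (metis p3.span_add p3.span_scale)
        qed
        then have "?g a * hpart (k - e) (q a) \<in> p3.span (pwx k ` ?J)" if "a \<in> A" for a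
          using form_expand[OF homogeneous_hpart, of "k - e" "q a"] that by blast
        moreover have "hpart k (?g a * q a) = ?g a * hpart (k - e) (q a)" for a
          using hpart_mult[OF hg, of "k - e" a "q a"] True by simp
        ultimately show ?thesis unfolding eq by (intro p3.span_sum) simp
      qed
    qed
  qed
  then show ?thesis
    using dim_pw_span[OF A, of k s "{..k}"] s2 by simp
qed

text \<open>The case e = 0 of the ideal count: a zeroth power generates the unit ideal and every
  level is full.\<close>

lemma dim_forms: "p3.dim {p. homogeneous k p} = (\<Sum>j\<le>k. Suc j)"
proof -
  have "ideal_gen {1} = UNIV"
    using ideal_mult[OF ideal_base, of 1 "{1}"] by auto
  then show ?thesis using dim_power_ideal[of "{0}" 0 k] by simp
qed

end

lemma hpart_0_mult: "hpart 0 (p * q) = hpart 0 p * hpart 0 q"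
proof (induction p rule: poly3_induct)
  case (add p m c)
  have s: "homogeneous (mdeg m) (Poly_Mapping.single m c)" by (rule homogeneous_single) simp
  have "hpart 0 (Poly_Mapping.single m c * q) = hpart 0 (Poly_Mapping.single m c) * hpart 0 q"
  proof (cases "mdeg m = 0")
    case True
    then show ?thesis using hpart_mult[OF s, of 0 q] s by (simp add: hpart_homogeneous)
  next
    case False
    then show ?thesis using hpart_mult_lower[OF s, of 0 q] s by (auto simp: hpart_homogeneous)
  qed
  with add show ?case by (simp add: distrib_right hpart_add)
qed simp

lemma hpart_0_eq: "hpart 0 p = const3 (Poly_Mapping.lookup p 0)"
proof -
  have "mdeg m = 0 \<longleftrightarrow> m = 0" for m
    by (auto simp: mdeg_def intro: poly_mapping_eqI)
  then show ?thesis
    by (intro poly_mapping_eqI) (auto simp: lookup_hpart const3_def lookup_single when_def)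
qed

text \<open>A generating set must already span the forms of lowest degree.\<close>

lemma min_gens_eq_dim:
  assumes G: "\<And>g. g \<in> G \<Longrightarrow> homogeneous e g"
  shows "min_gens (ideal_gen G) = p3.dim {p \<in> ideal_gen G. homogeneous e p}" (is "_ = p3.dim ?V")
  unfolding min_gens_def
proof (rule Least_equality)
  obtain T where T: "finite T" "{p. homogeneous e p} \<subseteq> p3.span T" using forms_finite_span by blast
  obtain B where B: "B \<subseteq> ?V" "p3.independent B" "?V \<subseteq> p3.span B" "card B = p3.dim ?V"
    using p3.basis_exists by blast
  have "finite B" using p3.independent_span_bound[OF T(1) B(2)] B(1) T(2) by blast
  moreover have "ideal_gen B = ideal_gen G"
  proof
    show "ideal_gen B \<subseteq> ideal_gen G" using B(1) by (intro ideal_minimal) auto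
    have "p3.span B \<subseteq> ideal_gen B"
      by (rule p3.span_minimal)
        (auto intro: ideal_base simp: p3.subspace_def ideal_0 ideal_add ideal_mult)
    then show "ideal_gen G \<subseteq> ideal_gen B" using B(3) G ideal_base by (intro ideal_minimal) blast
  qed
  ultimately show "\<exists>S. finite S \<and> card S = p3.dim ?V \<and> ideal_gen S = ideal_gen G" using B(4) by blast
next
  fix n assume "\<exists>S. finite S \<and> card S = n \<and> ideal_gen S = ideal_gen G"
  then obtain S where S: "finite S" "card S = n" "ideal_gen S = ideal_gen G" by blast
  \<comment> \<open>The generators have degree e, so in degree e only the constant term of a
    multiplier is visible.\<close>
  have low: "hpart e (q * s) = hpart 0 q * hpart e s" if "s \<in> ideal_gen G" for q s
    using that unfolding ideal_gen_eq_span
  proof (induction rule: pm.span_induct_alt)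
    case (step c g y)
    have "q * (c * g + y) = g * (q * c) + q * y" by (simp add: distrib_left mult_ac)
    then have "hpart e (q * (c * g + y)) = g * hpart 0 (q * c) + hpart 0 q * hpart e y"
      using hpart_mult[OF G[OF step(1)], of 0 "q * c"] step(2) by (simp add: hpart_add)
    moreover have "hpart e (c * g + y) = g * hpart 0 c + hpart e y"
      using hpart_mult[OF G[OF step(1)], of 0 c] by (simp add: hpart_add mult.commute)
    ultimately show ?case by (simp add: hpart_0_mult distrib_left mult_ac)
  qed simp
  have "?V \<subseteq> p3.span (hpart e ` S)"
  proof clarify
    fix p assume p: "p \<in> ideal_gen G" "homogeneous e p"
    then have "p \<in> ideal_gen ((\<lambda>s. s) ` S)" by (simp add: S(3))
    then obtain q where q: "p = (\<Sum>s\<in>S. q s * s)" using ideal_image[OF S(1), THEN iffD1] by blast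
    have "p = hpart e p" using p(2) by (simp add: hpart_homogeneous)
    also have "\<dots> = (\<Sum>s\<in>S. hpart e (q s * s))" by (simp add: q hpart_sum)
    also have "\<dots> = (\<Sum>s\<in>S. const3 (Poly_Mapping.lookup (q s) 0) * hpart e s)"
    proof (rule sum.cong[OF refl])
      fix s assume "s \<in> S"
      then have "s \<in> ideal_gen G" using S(3) ideal_base by blast
      from low[OF this] show "hpart e (q s * s) = const3 (Poly_Mapping.lookup (q s) 0) * hpart e s"
        by (simp add: hpart_0_eq)
    qed
    also have "\<dots> \<in> p3.span (hpart e ` S)" by (intro p3.span_sum p3.span_scale p3.span_base) auto
    finally show "p \<in> p3.span (hpart e ` S)" .
  qed
  then have "p3.dim ?V \<le> card (hpart e ` S)" using S(1) by (intro p3.dim_le_card) auto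
  also have "\<dots> \<le> n" using card_image_le[OF S(1)] S(2) by blast
  finally show "p3.dim ?V \<le> n" .
qed

section \<open>The constants\<close>

lemma gbinomial_2: "(a::real) gchoose 2 = a * (a - 1) / 2"
  by (simp add: gbinomial_prod_rev numeral_2_eq_2)

text \<open>Expanding the binomials leaves a polynomial identity in r, n and
  \<open>alpha r n\<close>.\<close>

lemma c_const_closed_form:
  "c_const r n = (real (r + 2) gchoose 2) + alpha r n / 2 * (2 * real r + 3 + alpha r n - real n * (1 + alpha r n))"
  by (simp add: c_const_def s1_def s2_def gbinomial_2 field_simps)

text \<open>\<open>e div d\<close> is the last index at which the truncated difference agrees with
  the true one; with e = r + 1 and d = m - 1 this is the origin of the floor in \<alpha>. The M
  further terms vanish.\<close>

lemma sum_truncated: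
  assumes "0 < d"
  shows "(\<Sum>s=1..M + e div d. real (e - d * s)) = real (e div d) * real e - real d * real (e div d) * (real (e div d) + 1) / 2"
proof -
  have "(\<Sum>s=1..b. real (e - d * s)) = real b * real e - real d * real b * (real b + 1) / 2" if "b \<le> e div d" for b
    using that
  proof (induction b)
    case (Suc b)
    have "d * Suc b \<le> d * (e div d)" using Suc.prems by (rule mult_le_mono2)
    also have "\<dots> \<le> e" by simp
    finally have "real (e - d * Suc b) = real e - real (d * Suc b)" by (rule of_nat_diff)
    also have "\<dots> = real e - real d * (real b + 1)" by (simp add: algebra_simps)
    finally have "real (e - d * Suc b) = real e - real d * (real b + 1)" .
    then show ?case using Suc by (simp add: field_simps)
  qed simp
  from this[of "e div d"] have 1: "(\<Sum>s=1..e div d. real (e - d * s)) = real (e div d) * real e - real d * real (e div d) * (real (e div d) + 1) / 2"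
    by simp
  have "(\<Sum>s=1..M + e div d. real (e - d * s)) = (\<Sum>s=1..e div d. real (e - d * s))"
  proof (rule sum.mono_neutral_right)
    show "\<forall>s\<in>{1..M + e div d} - {1..e div d}. real (e - d * s) = 0"
    proof
      fix s assume "s \<in> {1..M + e div d} - {1..e div d}"
      then have "e div d < s" by auto
      then have "e < s * d" using assms by (simp add: div_less_iff_less_mult)
      then show "real (e - d * s) = 0" by (simp add: mult.commute)
    qed
  qed auto
  with 1 show ?thesis by simp
qed

lemma alpha_eq_div:
  assumes "2 \<le> n"
  shows "alpha r n = int (Suc r div (n - 1))"
proof -
  have "(real r + 1) / (real n - 1) = real (Suc r) / real (n - 1)" using assms by (simp add: of_nat_diff)
  then show ?thesis unfolding alpha_def by (metis floor_divide_of_nat_eq)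
qed

text \<open>With t = j + 1, level j lacks t - m (t - r - 1) dimensions, cut off at 0. For t \<le> r
  + 1 this is t, which sums to a triangular number; for t = r + 1 + s it is r + 1 - (m - 1) s. The
  bound on k makes all nonzero defects occur. The binary forms of degree r + 1 have dimension r + 2,
  hence the minimum.\<close>

lemma codimension_sum:
  assumes m: "2 \<le> m" and k: "2 * Suc r \<le> k"
  shows "real (\<Sum>j\<le>k. Suc j) - real (\<Sum>j\<le>k. min (Suc j) (m * (Suc j - Suc r))) = c_const r (min m (r + 2))"
proof -
  let ?e = "Suc r" and ?d = "m - 1"
  let ?a = "?e div ?d"
  have "real (\<Sum>j\<le>k. Suc j) - real (\<Sum>j\<le>k. min (Suc j) (m * (Suc j - ?e)))
      = (\<Sum>j\<le>k. real (Suc j - m * (Suc j - ?e)))"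
    unfolding of_nat_sum sum_subtractf[symmetric] by (intro sum.cong) (auto simp: min_def of_nat_diff)
  also have "\<dots> = (\<Sum>t\<in>{1..Suc k}. real (t - m * (t - ?e)))"
    by (rule sum.reindex_bij_witness[of _ "\<lambda>t. t - 1" Suc]) auto
  also have "{1..Suc k} = {1..?e} \<union> {?e + 1..?e + (Suc k - ?e)}" using k by auto
  also have "(\<Sum>t\<in>{1..?e} \<union> {?e + 1..?e + (Suc k - ?e)}. real (t - m * (t - ?e)))
     = (\<Sum>t\<in>{1..?e}. real (t - m * (t - ?e))) + (\<Sum>t\<in>{?e + 1..?e + (Suc k - ?e)}. real (t - m * (t - ?e)))"
    by (rule sum.union_disjoint) auto
  also have "(\<Sum>t\<in>{1..?e}. real (t - m * (t - ?e))) = (\<Sum>t\<in>{1..?e}. real t)"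
    by (rule sum.cong) auto
  also have "(\<Sum>t\<in>{1..?e}. real t) = real ?e * (real ?e + 1) / 2"
    by (induction r) (auto simp: field_simps)
  also have "(\<Sum>t\<in>{?e + 1..?e + (Suc k - ?e)}. real (t - m * (t - ?e))) = (\<Sum>s=1..Suc k - ?e. real (?e - ?d * s))"
  proof (rule sum.reindex_bij_witness[of _ "\<lambda>s. ?e + s" "\<lambda>t. t - ?e"])
    fix t assume t: "t \<in> {?e + 1..?e + (Suc k - ?e)}"
    have "?e - ?d * (t - ?e) = (?e + (t - ?e)) - (Suc ?d) * (t - ?e)" by simp
    also have "\<dots> = t - m * (t - ?e)" using t m by (simp del: mult_Suc)
    finally show "real (?e - ?d * (t - ?e)) = real (t - m * (t - ?e))" by simp
  qed auto
  also have "Suc k - ?e = (Suc k - ?e - ?a) + ?a"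
  proof -
    have "?a \<le> ?e" by (rule div_le_dividend)
    moreover have "x \<le> e \<Longrightarrow> 2 * e \<le> k \<Longrightarrow> Suc k - e = (Suc k - e - x) + x" for x e by arith
    ultimately show ?thesis using k by blast
  qed
  also have "(\<Sum>s=1..(Suc k - ?e - ?a) + ?a. real (?e - ?d * s)) = real ?a * real ?e - real ?d * real ?a * (real ?a + 1) / 2"
    using m by (intro sum_truncated) simp
  also have "real ?e * (real ?e + 1) / 2 + (real ?a * real ?e - real ?d * real ?a * (real ?a + 1) / 2) = c_const r (min m (r + 2))"
  proof (cases "m \<le> r + 2")
    case True
    then have "alpha r (min m (r + 2)) = int ?a" using m by (simp add: alpha_eq_div min_def)
    then show ?thesis using True m unfolding c_const_closed_form
      by (simp add: gbinomial_2 min_def of_nat_diff field_simps)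
  next
    \<comment> \<open>For m > r + 2 the defects vanish from s = 1 on and the quotient is 0, whereas
      n = r + 2 gives \<alpha> = 1. The totals agree because the defect r + 1 - (n - 1) at s = 1 is
      zero.\<close>
    case False
    then have "?a = 0" "alpha r (min m (r + 2)) = 1" using m by (auto simp: alpha_eq_div min_def)
    then show ?thesis using False unfolding c_const_closed_form
      by (simp add: gbinomial_2 min_def field_simps)
  qed
  finally show ?thesis .
qed

section \<open>Codimension of the ideal of lines through a common point\<close>

lemma cross3_eq_0_scale:
  fixes x y :: "real^3"
  assumes "cross3 x y = 0" "y \<noteq> 0"
  shows "x = ((x \<bullet> y) / (y \<bullet> y)) *\<^sub>R y"
proof -
  have "0 = (y \<bullet> y) *\<^sub>R x - (y \<bullet> x) *\<^sub>R y"
    using Lagrange[of y x y] assms(1) by simp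
  then have "(y \<bullet> y) *\<^sub>R x = (x \<bullet> y) *\<^sub>R y" by (simp add: inner_commute)
  then have "inverse (y \<bullet> y) *\<^sub>R (y \<bullet> y) *\<^sub>R x = inverse (y \<bullet> y) *\<^sub>R (x \<bullet> y) *\<^sub>R y" by (rule arg_cong)
  then show ?thesis using assms(2) by (simp add: divide_inverse mult.commute)
qed

lemma cross3_parallel_trans:
  fixes x y z :: "real^3"
  assumes "cross3 x y = 0" "cross3 z y = 0" "y \<noteq> 0"
  shows "cross3 x z = 0"
proof -
  obtain a b where "x = a *\<^sub>R y" "z = b *\<^sub>R y"
    using cross3_eq_0_scale[OF assms(1,3)] cross3_eq_0_scale[OF assms(2,3)] by metis
  then show ?thesis by (simp add: cross_mult_left cross_mult_right)
qed

text \<open>All normals lie in the plane orthogonal to w. With v in that plane parallel to none of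
  them, each is a multiple of u - a v and \<open>dim_power_ideal\<close> applies to the set of
  slopes a. Proportional normals share a slope, so the slopes count lines rather than edges.\<close>

lemma codim_powers_of_normals:
  fixes N :: "(real^3) set" and r :: nat
  assumes N: "finite N" "\<And>n. n \<in> N \<Longrightarrow> n \<bullet> w = 0" "0 \<notin> N" and w: "w \<noteq> 0"
    and n01: "n0 \<in> N" "n1 \<in> N" "cross3 n0 n1 \<noteq> 0"
  defines "I \<equiv> ideal_gen ((\<lambda>n. lin n ^ Suc r) ` N)"
  shows "\<exists>K. \<forall>k\<ge>K. real (p3.dim {p. homogeneous k p})
     = real (p3.dim {p \<in> I. homogeneous k p}) + c_const r (min_gens I)"
proof -
  have n1: "n1 \<noteq> 0" using n01 N(3) by auto
  \<comment> \<open>The parameters to avoid in the choice of v. Each n excludes at most one t, since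
    otherwise n0 and n1 would both be parallel to n.\<close>
  define bad where "bad = (\<Union>n\<in>N. {t. cross3 (n0 + t *\<^sub>R n1) n = 0})"
  have "finite {t. cross3 (n0 + t *\<^sub>R n1) n = 0}" if n: "n \<in> N" for n
  proof (rule finite_subset[of _ "{SOME t. cross3 (n0 + t *\<^sub>R n1) n = 0}"])
    show "{t. cross3 (n0 + t *\<^sub>R n1) n = 0} \<subseteq> {SOME t. cross3 (n0 + t *\<^sub>R n1) n = 0}"
    proof
      fix t assume "t \<in> {t. cross3 (n0 + t *\<^sub>R n1) n = 0}"
      then have t: "cross3 (n0 + t *\<^sub>R n1) n = 0" by simp
      define t' where "t' = (SOME t. cross3 (n0 + t *\<^sub>R n1) n = 0)"
      have t': "cross3 (n0 + t' *\<^sub>R n1) n = 0" unfolding t'_def by (rule someI[of _ t]) (rule t)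
      have "t = t'"
      proof (rule ccontr)
        assume "t \<noteq> t'"
        have "cross3 n0 n + t *\<^sub>R cross3 n1 n = 0" "cross3 n0 n + t' *\<^sub>R cross3 n1 n = 0"
          using t t' by (simp_all add: cross_add_left cross_mult_left)
        moreover have "(t - t') *\<^sub>R cross3 n1 n
            = (cross3 n0 n + t *\<^sub>R cross3 n1 n) - (cross3 n0 n + t' *\<^sub>R cross3 n1 n)"
          by (simp add: scaleR_left_diff_distrib)
        ultimately have "(t - t') *\<^sub>R cross3 n1 n = 0" by simp
        then have 1: "cross3 n1 n = 0" using \<open>t \<noteq> t'\<close> by simp
        have "cross3 n0 n = 0" using t 1 by (simp add: cross_add_left cross_mult_left)
        then show False using cross3_parallel_trans[of n0 n n1] 1 n N(3) n01(3) by auto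
      qed
      then show "t \<in> {SOME t. cross3 (n0 + t *\<^sub>R n1) n = 0}" by (simp add: t'_def)
    qed
  qed simp
  then have "finite bad" unfolding bad_def using N(1) by blast
  then obtain t where t: "t \<notin> bad" using ex_new_if_finite infinite_UNIV_char_0 by metis
  define u where "u = n1"
  define v where "v = n0 + t *\<^sub>R n1"
  have vn: "cross3 v n \<noteq> 0" if "n \<in> N" for n using t that by (auto simp: bad_def v_def)
  have uw: "u \<bullet> w = 0" and vw: "v \<bullet> w = 0"
    using N(2) n01 by (auto simp: u_def v_def inner_add_left)
  have uv: "cross3 u v \<noteq> 0" using vn[OF n01(2)] by (metis cross_skew neg_equal_0_iff_equal u_def)
  have par: "(w \<bullet> w) *\<^sub>R cross3 u v = (w \<bullet> cross3 u v) *\<^sub>R w"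
    by (rule cross3_orthogonal_parallel[OF uw vw])
  define d where "d = u \<bullet> cross3 v w"
  have "w \<bullet> cross3 u v \<noteq> 0" using par uv w by auto
  moreover have "d = w \<bullet> cross3 u v"
    unfolding d_def by (simp add: cross3_def inner_vec_def sum_3) algebra
  ultimately have d: "d \<noteq> 0" by simp
  interpret linear_coordinates u v w by unfold_locales (use d d_def in simp)
  define x where "x n = (n \<bullet> cross3 v w) / d" for n
  define y where "y n = (n \<bullet> cross3 w u) / d" for n
  have dec: "n = x n *\<^sub>R u + y n *\<^sub>R v" if "n \<in> N" for n
  proof -
    have "(w \<bullet> w) * (n \<bullet> cross3 u v) = 0"
      using arg_cong[OF par, of "\<lambda>z. n \<bullet> z"] N(2)[OF that] by simp
    then have "n \<bullet> cross3 u v = 0" using w by simp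
    then have "d *\<^sub>R n = (n \<bullet> cross3 v w) *\<^sub>R u + (n \<bullet> cross3 w u) *\<^sub>R v"
      using cross3_dual_expansion[of u v w n] by (simp add: d_def)
    then have "inverse d *\<^sub>R d *\<^sub>R n = inverse d *\<^sub>R ((n \<bullet> cross3 v w) *\<^sub>R u + (n \<bullet> cross3 w u) *\<^sub>R v)"
      by (rule arg_cong)
    then show ?thesis using d
      by (simp add: x_def y_def divide_inverse scaleR_right_distrib mult.commute)
  qed
  have xn: "x n \<noteq> 0" if "n \<in> N" for n
  proof
    assume "x n = 0"
    then have "n = y n *\<^sub>R v" using dec[OF that] by simp
    then have "cross3 v n = 0" by (metis cross_mult_right cross_refl scaleR_zero_right)
    then show False using vn[OF that] by simp
  qed
  define a where "a n = - y n / x n" for n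
  have lin_n: "lin n = const3 (x n) * (lin u - const3 (a n) * lin v)" if "n \<in> N" for n
  proof -
    have "lin n = const3 (x n) * lin u + const3 (y n) * lin v"
      using arg_cong[OF dec[OF that], of lin] by (simp add: lin_linear)
    moreover have "const3 (y n) = - (const3 (x n) * const3 (a n))"
      using xn[OF that] by (simp add: a_def flip: const3_simps(4,5))
    ultimately show ?thesis by (simp add: right_diff_distrib mult.assoc)
  qed
  have a01: "a n0 \<noteq> a n1"
  proof
    assume eq: "a n0 = a n1"
    have "n = x n *\<^sub>R (u - a n *\<^sub>R v)" if "n \<in> N" for n
    proof -
      have "x n *\<^sub>R (u - a n *\<^sub>R v) = x n *\<^sub>R u + y n *\<^sub>R v"
        using xn[OF that] by (simp add: a_def scaleR_right_diff_distrib scaleR_right_distrib)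
      then show ?thesis using dec[OF that] by (rule sym[OF trans[OF _ sym]])
    qed
    then have "n0 = x n0 *\<^sub>R (u - a n0 *\<^sub>R v)" "n1 = x n1 *\<^sub>R (u - a n0 *\<^sub>R v)" using n01 eq by metis+
    then have "cross3 n0 n1 = 0" by (metis cross_mult_left cross_mult_right cross_refl scaleR_zero_right)
    then show False using n01 by simp
  qed
  let ?g = "\<lambda>a. (lin u - const3 a * lin v) ^ Suc r"
  define A where "A = a ` N"
  have A: "finite A" using N(1) by (simp add: A_def)
  have A2: "2 \<le> card A"
    using card_mono[OF A, of "{a n0, a n1}"] n01 a01 by (auto simp: A_def)
  have I: "I = ideal_gen (?g ` A)"
  proof
    show "I \<subseteq> ideal_gen (?g ` A)"
      unfolding I_def
    proof (intro ideal_minimal, clarify)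
      fix n assume n: "n \<in> N"
      have "lin n ^ Suc r = const3 (x n) ^ Suc r * ?g (a n)"
        unfolding lin_n[OF n] by (rule power_mult_distrib)
      also have "\<dots> \<in> ideal_gen (?g ` A)" using n by (intro ideal_mult ideal_base) (auto simp: A_def)
      finally show "lin n ^ Suc r \<in> ideal_gen (?g ` A)" .
    qed
    show "ideal_gen (?g ` A) \<subseteq> I"
      unfolding I_def A_def
    proof (intro ideal_minimal, clarify)
      fix n assume n: "n \<in> N"
      have "?g (a n) = const3 (inverse (x n)) ^ Suc r * lin n ^ Suc r"
      proof -
        have "lin u - const3 (a n) * lin v = const3 (inverse (x n)) * lin n"
          unfolding lin_n[OF n] using xn[OF n] by (simp add: mult.assoc[symmetric] const3_simps(4)[symmetric] const3_simps(2))
        then show ?thesis by (simp only: power_mult_distrib)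
      qed
      also have "\<dots> \<in> ideal_gen ((\<lambda>n. lin n ^ Suc r) ` N)" using n by (intro ideal_mult ideal_base) auto
      finally show "?g (a n) \<in> ideal_gen ((\<lambda>n. lin n ^ Suc r) ` N)" .
    qed
  qed
  have dimI: "p3.dim {p \<in> I. homogeneous k p} = (\<Sum>j\<le>k. min (Suc j) (card A * (Suc j - Suc r)))" for k
    unfolding I by (rule dim_power_ideal[OF A])
  \<comment> \<open>In degree r + 1 the levels below r + 1 are empty and the top one has dimension
    min m (r + 2), where m is the number of slopes.\<close>
  have "min_gens I = p3.dim {p \<in> I. homogeneous (Suc r) p}"
    unfolding I_def by (rule min_gens_eq_dim) (auto simp del: power_Suc intro: homogeneous_lin_power)
  also have "\<dots> = (\<Sum>j\<le>Suc r. min (Suc j) (card A * (Suc j - Suc r)))" by (rule dimI)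
  also have "\<dots> = min (card A) (r + 2)"
  proof -
    have "(\<Sum>j\<le>r. min (Suc j) (card A * (Suc j - Suc r))) = 0" by (rule sum.neutral) auto
    then show ?thesis by (simp add: min.commute)
  qed
  finally have mg: "min_gens I = min (card A) (r + 2)" .
  show ?thesis
    unfolding mg dimI dim_forms
    using codimension_sum[OF A2, of r] by (intro exI[of _ "2 * Suc r"]) (auto simp: algebra_simps)
qed

section \<open>Realizations of paths and cycles\<close>

definition path_arcs :: "nat \<Rightarrow> (nat \<times> nat) set" where
  "path_arcs N = {(i, j). i < N \<and> j < N \<and> (j = Suc i \<or> i = Suc j)}"

text \<open>For N = 2 the closing arcs are already path arcs, so genuine cycles need N \<ge>
  3.\<close>

definition cycle_arcs :: "nat \<Rightarrow> (nat \<times> nat) set" where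
  "cycle_arcs N = path_arcs N \<union> {(0, N - 1), (N - 1, 0)}"

definition segments :: "nat \<Rightarrow> (nat \<times> nat) set \<Rightarrow> (nat \<Rightarrow> real) set" where
  "segments N E = {indicator {i} |i. i < N} \<union>
     {\<lambda>k. (1 - t) * indicator {i} k + t * indicator {j} k |i j t. (i, j) \<in> E \<and> t \<in> {0..1}}"

text \<open>Only the index set of the coordinates differs between the two realizations; reindexing
  is linear and, in both directions, continuous in each coordinate. \<open>R\<close> is an output
  because \<open>realization G\<close> is a topology, not a set.\<close>

lemma realization_homeomorphic_segments:
  assumes vs: "distinct vs" "verts G = set vs" and N: "N = length vs"
    and E: "E \<subseteq> {..<N} \<times> {..<N}" "arcs G = (\<lambda>(i, j). (vs ! i, vs ! j)) ` E"
    and G: "tail G = fst" "head G = snd"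
  obtains R where "realization G = top_of_set R" "R homeomorphic segments N E"
proof -
  define idx where "idx u = (THE i. i < N \<and> vs ! i = u)" for u
  have idx: "idx (vs ! i) = i" if "i < N" for i
    unfolding idx_def using that vs(1) N by (intro the_equality) (auto simp: nth_eq_iff_index_eq)
  define \<theta> where "\<theta> x = (\<lambda>u. if u \<in> set vs then x (idx u) else 0)" for x :: "nat \<Rightarrow> real"
  define \<theta>' where "\<theta>' y = (\<lambda>i. if i < N then y (vs ! i) else 0)" for y :: "_ \<Rightarrow> real"
  have th_ind: "\<theta> (indicator {i}) = indicator {vs ! i}" if "i < N" for i
  proof
    fix u show "\<theta> (indicator {i}) u = indicator {vs ! i} u"
      using that idx N by (auto simp: \<theta>_def indicator_def in_set_conv_nth)
  qed
  have th_lin: "\<theta> (\<lambda>k. a * x k + b * y k) = (\<lambda>u. a * \<theta> x u + b * \<theta> y u)" for a b x y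
    by (auto simp: \<theta>_def)
  \<comment> \<open>Points of the model vanish at all indices from N on, which is exactly what
    \<theta>' forgets.\<close>
  have th'_th: "\<theta>' (\<theta> x) = x" if "x \<in> segments N E" for x
  proof
    have "x i = 0" if "\<not> i < N" for i
      using \<open>x \<in> segments N E\<close> that E(1) by (auto simp: segments_def indicator_def)
    then show "\<theta>' (\<theta> x) i = x i" for i using idx N by (auto simp: \<theta>_def \<theta>'_def)
  qed
  let ?R = "\<theta> ` segments N E"
  have cont: "continuous_on S \<theta>" "continuous_on S' \<theta>'" for S S'
  proof -
    have c: "continuous_on T (\<lambda>x. x i)" for T :: "('i \<Rightarrow> real) set" and i :: 'i
      by (rule continuous_on_subset[OF continuous_on_product_coordinates]) simp
    show "continuous_on S \<theta>"
    proof (rule continuous_on_coordinatewise_then_product)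
      show "continuous_on S (\<lambda>x. \<theta> x u)" for u by (cases "u \<in> set vs") (simp_all add: \<theta>_def c)
    qed
    show "continuous_on S' \<theta>'"
    proof (rule continuous_on_coordinatewise_then_product)
      show "continuous_on S' (\<lambda>x. \<theta>' x i)" for i by (cases "i < N") (simp_all add: \<theta>'_def c)
    qed
  qed
  have "homeomorphism ?R (segments N E) \<theta>' \<theta>"
    unfolding homeomorphism_def using th'_th cont by (force simp: image_iff)
  then have hom: "?R homeomorphic segments N E" unfolding homeomorphic_def by blast
  have "{indicator {v} |v. v \<in> verts G} = \<theta> ` {indicator {i} |i. i < N}"
    using th_ind N by (force simp: vs(2) in_set_conv_nth image_iff)
  moreover have "{\<lambda>u. (1 - t) * indicator {tail G a} u + t * indicator {head G a} u |a t.
         a \<in> arcs G \<and> t \<in> {0..1}}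
     = \<theta> ` {\<lambda>k. (1 - t) * indicator {i} k + t * indicator {j} k |i j t. (i, j) \<in> E \<and> t \<in> {0..1}}" (is "?X = \<theta> ` ?Y")
  proof -
    have eq: "\<theta> (\<lambda>k. (1 - t) * indicator {i} k + t * indicator {j} k)
        = (\<lambda>u. (1 - t) * indicator {vs ! i} u + t * indicator {vs ! j} u)" if "(i, j) \<in> E" for i j t
      unfolding th_lin using that E(1) th_ind by auto
    show ?thesis
    proof
      show "?X \<subseteq> \<theta> ` ?Y"
      proof clarify
        fix a t assume "a \<in> arcs G" "t \<in> {0..1::real}"
        then obtain i j where ij: "(i, j) \<in> E" "a = (vs ! i, vs ! j)" using E(2) by auto
        have "(\<lambda>u. (1 - t) * indicator {tail G a} u + t * indicator {head G a} u)
            = \<theta> (\<lambda>k. (1 - t) * indicator {i} k + t * indicator {j} k)"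
          using eq[OF ij(1), of t] ij(2) G by simp
        moreover have "(\<lambda>k. (1 - t) * indicator {i} k + t * indicator {j} k) \<in> ?Y"
          using ij(1) \<open>t \<in> {0..1}\<close> by blast
        ultimately show "(\<lambda>u. (1 - t) * indicator {tail G a} u + t * indicator {head G a} u) \<in> \<theta> ` ?Y"
          by (simp only: imageI)
      qed
      show "\<theta> ` ?Y \<subseteq> ?X"
      proof clarify
        fix i j t assume ij: "(i, j) \<in> E" "t \<in> {0..1::real}"
        then have "(vs ! i, vs ! j) \<in> arcs G" using E(2) by force
        then show "\<exists>a t'. \<theta> (\<lambda>k. (1 - t) * indicator {i} k + t * indicator {j} k) =
            (\<lambda>u. (1 - t') * indicator {tail G a} u + t' * indicator {head G a} u) \<and> a \<in> arcs G \<and> t' \<in> {0..1}"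
          using ij eq[OF ij(1), of t] G by (intro exI[of _ "(vs ! i, vs ! j)"] exI[of _ t]) simp
      qed
    qed
  qed
  ultimately have "realization G = top_of_set ?R"
    unfolding realization_def segments_def image_Un by simp
  then show thesis using hom that by blast
qed

text \<open>Barycentric coordinates on a half-line with vertices 0, 1, 2, ...: the integer i goes to
  the i-th unit vector, and the intervals between integers go to segments.\<close>

definition tent :: "real \<Rightarrow> nat \<Rightarrow> real" where
  "tent x i = max 0 (1 - \<bar>x - real i\<bar>)"

lemma continuous_tent: "continuous_on S tent"
  unfolding tent_def by (intro continuous_on_coordinatewise_then_product continuous_intros)

lemma tent_segment:
  "t \<in> {0..1} \<Longrightarrow> tent (real i + t) = (\<lambda>k. (1 - t) * indicator {i} k + t * indicator {Suc i} k)"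
proof
  fix k assume t: "t \<in> {0..1}"
  consider "k = i" | "k = Suc i" | "k < i" | "Suc i < k" by linarith
  then show "tent (real i + t) k = (1 - t) * indicator {i} k + t * indicator {Suc i} k"
  proof cases
    case 3
    then have "real k + 1 \<le> real i" by linarith
    then show ?thesis using t 3 by (simp add: tent_def)
  next
    case 4
    then have "real i + 2 \<le> real k" by linarith
    then show ?thesis using t 4 by (simp add: tent_def)
  qed (use t in \<open>auto simp: tent_def\<close>)
qed

lemma tent_nat: "tent (real i) = indicator {i}"
  using tent_segment[of 0 i] by simp

text \<open>The two coordinates at the integers around x recover x.\<close>

lemma inj_tent: "inj_on tent {0..}"
proof (rule inj_onI)
  fix x y :: real assume x: "x \<in> {0..}" and y: "y \<in> {0..}" and eq: "tent x = tent y"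
  define i where "i = nat \<lfloor>x\<rfloor>"
  have i: "real i \<le> x" "x < real i + 1" unfolding i_def using x by auto
  have "tent x i = 1 - (x - real i)" "tent x (Suc i) = x - real i"
    using i by (auto simp: tent_def)
  then have "tent y i = 1 - (x - real i)" "tent y (Suc i) = x - real i" using eq by simp_all
  then show "x = y" using i by (auto simp: tent_def max_def abs_if split: if_splits)
qed

lemma segments_path:
  assumes "0 < N"
  shows "segments N (path_arcs N) = tent ` {0..real (N - 1)}"
proof
  show "segments N (path_arcs N) \<subseteq> tent ` {0..real (N - 1)}"
  proof
    fix x assume "x \<in> segments N (path_arcs N)"
    then consider i where "i < N" "x = indicator {i}"
      | i j t where "(i, j) \<in> path_arcs N" "t \<in> {0..1}" "x = (\<lambda>k. (1 - t) * indicator {i} k + t * indicator {j} k)"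
      unfolding segments_def by blast
    then show "x \<in> tent ` {0..real (N - 1)}"
    proof cases
      case 1
      then show ?thesis by (intro image_eqI[of _ _ "real i"]) (auto simp: tent_nat)
    next
      case 2
      then consider "j = Suc i" "Suc i < N" | "i = Suc j" "Suc j < N" by (auto simp: path_arcs_def)
      then show ?thesis
      proof cases
        case 1
        then have "x = tent (real i + t)" using 2 tent_segment[of t i] by simp
        moreover have "real i + 1 \<le> real (N - 1)" using 1 by linarith
        ultimately show ?thesis using 2(2) by (intro image_eqI[of _ _ "real i + t"]) auto
      next
        case b: 2
        then have "x = tent (real j + (1 - t))" using 2 tent_segment[of "1 - t" j] by (auto simp: add.commute)
        moreover have "real j + 1 \<le> real (N - 1)" using b by linarith
        ultimately show ?thesis using 2(2) by (intro image_eqI[of _ _ "real j + (1 - t)"]) auto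
      qed
    qed
  qed
next
  show "tent ` {0..real (N - 1)} \<subseteq> segments N (path_arcs N)"
  proof clarify
    fix x assume x: "x \<in> {0..real (N - 1)}"
    define i where "i = nat \<lfloor>x\<rfloor>"
    have i: "real i \<le> x" "x < real i + 1" unfolding i_def using x by auto
    show "tent x \<in> segments N (path_arcs N)"
    proof (cases "x = real i")
      case True
      then have "i < N" using x assms by auto
      then show ?thesis using True tent_nat by (auto simp: segments_def)
    next
      case False
      then have "real i < real (N - 1)" using i x by auto
      then have "Suc i < N" by linarith
      moreover have "tent x = (\<lambda>k. (1 - (x - real i)) * indicator {i} k + (x - real i) * indicator {Suc i} k)"
        using tent_segment[of "x - real i" i] i by simp
      moreover have "(i, Suc i) \<in> path_arcs N" "x - real i \<in> {0..1}"
        using \<open>Suc i < N\<close> i by (auto simp: path_arcs_def)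
      ultimately show ?thesis unfolding segments_def by blast
    qed
  qed
qed

lemma segments_path_homeomorphic:
  "0 < N \<Longrightarrow> segments N (path_arcs N) homeomorphic {0..real (N - 1)}"
  unfolding segments_path
  by (rule homeomorphic_sym[THEN iffD1], rule homeomorphic_compact[of _ tent])
    (auto intro: continuous_tent inj_on_subset[OF inj_tent])

text \<open>The path and the closing edge are arcs with the same ends. As they meet nowhere else,
  their join is a simple closed curve.\<close>

lemma segments_cycle_homeomorphic:
  assumes N: "3 \<le> N"
  shows "segments N (cycle_arcs N) homeomorphic sphere (0::real^2) 1"
proof -
  define g1 where "g1 s = tent (real (N - 1) * s)" for s
  define g2 where "g2 s = (\<lambda>k. (1 - s) * indicator {N - 1} k + s * indicator {0} k)" for s :: real
  have ends: "g1 0 = indicator {0}" "g1 1 = indicator {N - 1}" "g2 0 = indicator {N - 1}" "g2 1 = indicator {0}"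
    using tent_nat[of 0] tent_nat[of "N - 1"] by (simp_all add: g1_def g2_def)
  have pi1: "path_image g1 = segments N (path_arcs N)"
  proof -
    have "(*) (real (N - 1)) ` {0..1} = {0..real (N - 1)}"
      using N image_mult_atLeastAtMost[of "real (N - 1)" 0 1] by simp
    then show ?thesis using N unfolding path_image_def g1_def segments_path[of N, OF order.strict_trans2[OF _ N, of 0, simplified]]
      by (metis image_image)
  qed
  have arc1: "arc g1" unfolding arc_def path_def
  proof
    show "continuous_on {0..1} g1" unfolding g1_def
      by (intro continuous_on_compose2[OF continuous_tent[of UNIV]] continuous_intros) auto
    show "inj_on g1 {0..1}"
    proof (rule inj_onI)
      fix s t :: real assume "s \<in> {0..1}" "t \<in> {0..1}" "g1 s = g1 t"
      then have "real (N - 1) * s = real (N - 1) * t" unfolding g1_def by (intro inj_onD[OF inj_tent]) auto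
      then show "s = t" using N by auto
    qed
  qed
  have g2N: "g2 s 0 = s" "g2 s (N - 1) = 1 - s" for s using N by (auto simp: g2_def)
  have arc2: "arc g2" unfolding arc_def path_def
  proof
    show "continuous_on {0..1} g2" unfolding g2_def
      by (intro continuous_on_coordinatewise_then_product continuous_intros)
    show "inj_on g2 {0..1}" by (rule inj_onI) (metis g2N(1))
  qed
  have "simple_path (g1 +++ g2)"
  proof (rule simple_path_join_loop[OF arc1 arc2])
    \<comment> \<open>At a common point with 0 < t < 1 both end coordinates are positive, which
      forces the path parameter below 1 and above N - 2. Here N \<ge> 3 is essential.\<close>
    show "path_image g1 \<inter> path_image g2 \<subseteq> {pathstart g1, pathstart g2}"
    proof
      fix y assume "y \<in> path_image g1 \<inter> path_image g2"
      then obtain s t where s: "s \<in> {0..1}" "y = g1 s" and t: "t \<in> {0..1}" "y = g2 t"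
        by (auto simp: path_image_def)
      define x where "x = real (N - 1) * s"
      have 1: "tent x 0 = t" "tent x (N - 1) = 1 - t" using s t g2N[of t] by (auto simp: g1_def x_def)
      have N2: "2 \<le> real (N - 1)" using N by simp
      have "0 \<le> x" using s by (simp add: x_def)
      have "t = 0 \<or> t = 1"
      proof (rule ccontr)
        assume n: "\<not> (t = 0 \<or> t = 1)"
        then have "x < 1" using 1(1) t(1) \<open>0 \<le> x\<close> by (auto simp: tent_def max_def split: if_splits)
        moreover have "x > 1" using 1(2) t(1) n N2 by (auto simp: tent_def max_def abs_if split: if_splits)
        ultimately show False by simp
      qed
      then show "y \<in> {pathstart g1, pathstart g2}" using t ends by (auto simp: pathstart_def)
    qed
  qed (simp_all add: pathstart_def pathfinish_def ends)
  then have "path_image (g1 +++ g2) homeomorphic sphere (0::complex) 1"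
    by (intro homeomorphic_simple_path_image_circle) (simp_all add: pathstart_def[of g1] pathfinish_def[of g2] ends)
  also have "sphere (0::complex) 1 homeomorphic sphere (0::real^2) 1"
    by (rule homeomorphic_spheres_gen) auto
  also have "path_image (g1 +++ g2) = segments N (cycle_arcs N)"
  proof -
    have "path_image g2 = {\<lambda>k. (1 - t) * indicator {N - 1} k + t * indicator {0} k |t. t \<in> {0..1}}"
      unfolding path_image_def g2_def by auto
    moreover have "{\<lambda>k. (1 - t) * indicator {0} k + t * indicator {N - 1} k |t::real. t \<in> {0..1}}
       = {\<lambda>k. (1 - t) * indicator {N - 1} k + t * indicator {0} k |t::real. t \<in> {0..1}}" (is "?X = ?Y")
    proof
      show "?X \<subseteq> ?Y" by clarify (rule exI[of _ "1 - _"], auto simp: add.commute)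
      show "?Y \<subseteq> ?X" by clarify (rule exI[of _ "1 - _"], auto simp: add.commute)
    qed
    moreover have "segments N (cycle_arcs N) = segments N (path_arcs N) \<union>
       {\<lambda>k. (1 - t) * indicator {0} k + t * indicator {N - 1} k |t::real. t \<in> {0..1}} \<union>
       {\<lambda>k. (1 - t) * indicator {N - 1} k + t * indicator {0} k |t::real. t \<in> {0..1}}"
      unfolding segments_def cycle_arcs_def by blast
    ultimately show ?thesis
      using pi1 by (simp add: path_image_join pathstart_def pathfinish_def ends)
  qed
  finally show ?thesis .
qed

text \<open>A path is a compact interval, hence contractible, and the circle is not.\<close>

lemma path_realization_not_circle:
  assumes "distinct vs" "verts G = set vs" "vs \<noteq> []"
    "arcs G = (\<lambda>(i, j). (vs ! i, vs ! j)) ` path_arcs (length vs)" "tail G = fst" "head G = snd"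
  shows "\<not> realization G homotopy_equivalent_space top_of_set (sphere (0::real^2) 1)"
proof
  assume *: "realization G homotopy_equivalent_space top_of_set (sphere (0::real^2) 1)"
  obtain R where R: "realization G = top_of_set R" "R homeomorphic segments (length vs) (path_arcs (length vs))"
    using realization_homeomorphic_segments[OF assms(1,2) refl _ assms(4-6)]
    by (auto simp: path_arcs_def)
  have "R homeomorphic {0..real (length vs - 1)}"
    using R(2) segments_path_homeomorphic[of "length vs"] assms(3) homeomorphic_trans by auto
  then have "top_of_set R homotopy_equivalent_space top_of_set {0..real (length vs - 1)}"
    by (rule homeomorphic_imp_homotopy_eqv)
  then have "contractible_space (top_of_set R)"
    using homotopy_equivalent_space_contractibility by (force intro: convex_imp_contractible)
  then have "contractible (sphere (0::real^2) 1)"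
    using homotopy_equivalent_space_contractibility[OF *[unfolded R(1)]] by simp
  then show False by (simp add: contractible_sphere)
qed

lemma cycle_realization_circle:
  assumes "distinct vs" "verts G = set vs" "3 \<le> length vs"
    "arcs G = (\<lambda>(i, j). (vs ! i, vs ! j)) ` cycle_arcs (length vs)" "tail G = fst" "head G = snd"
  shows "realization G homotopy_equivalent_space top_of_set (sphere (0::real^2) 1)"
proof -
  have "cycle_arcs (length vs) \<subseteq> {..<length vs} \<times> {..<length vs}"
    using assms(3) by (auto simp: path_arcs_def cycle_arcs_def)
  then obtain R where R: "realization G = top_of_set R" "R homeomorphic segments (length vs) (cycle_arcs (length vs))"
    using realization_homeomorphic_segments[OF assms(1,2) refl _ assms(4-6)] by blast
  then have "R homeomorphic sphere (0::real^2) 1"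
    using segments_cycle_homeomorphic[OF assms(3)] homeomorphic_trans by blast
  then show ?thesis unfolding R(1) by (rule homeomorphic_imp_homotopy_eqv)
qed

section \<open>Connected graphs of maximal degree two\<close>

text \<open>A longest path exhausts the graph: its inner vertices already have both neighbours on
  it, and a new neighbour of an end would lengthen it. The only edge left to consider joins the two
  ends.\<close>

lemma degree_two_path_or_cycle:
  fixes E :: "('v \<times> 'v) set"
  assumes V: "finite V" "V \<noteq> {}" and E: "E \<subseteq> V \<times> V" "sym E" "irrefl E"
    and deg: "\<And>v. v \<in> V \<Longrightarrow> card (E `` {v}) \<le> 2"
    and conn: "\<And>u v. u \<in> V \<Longrightarrow> v \<in> V \<Longrightarrow> (u, v) \<in> E\<^sup>*"
  obtains vs where "distinct vs" "set vs = V"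
    "E = (\<lambda>(i, j). (vs ! i, vs ! j)) ` path_arcs (length vs) \<or>
     3 \<le> length vs \<and> E = (\<lambda>(i, j). (vs ! i, vs ! j)) ` cycle_arcs (length vs)"
proof -
  define W where "W vs \<longleftrightarrow> vs \<noteq> [] \<and> distinct vs \<and> set vs \<subseteq> V \<and> (\<forall>i. Suc i < length vs \<longrightarrow> (vs ! i, vs ! Suc i) \<in> E)" for vs
  have fin: "finite (E `` {v})" for v using E(1) V(1) by (auto intro: finite_subset[of _ V])
  have symE: "(v, u) \<in> E" if "(u, v) \<in> E" for u v using E(2) that by (auto dest: symD)
  have bound: "length vs \<le> card V" if "W vs" for vs
    using that card_mono[OF V(1), of "set vs"] by (simp add: W_def distinct_card)
  obtain v0 where "v0 \<in> V" using V(2) by blast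
  then have "W [v0]" by (simp add: W_def)
  then have "\<exists>vs. W vs \<and> (\<forall>ws. W ws \<longrightarrow> length ws \<le> length vs)"
    using bound by (intro ex_has_greatest_nat[of W "[v0]" length "Suc (card V)"]) (auto simp: less_Suc_eq_le)
  then obtain vs where vs: "W vs" and mx: "\<And>ws. W ws \<Longrightarrow> length ws \<le> length vs"
    by blast
  let ?N = "length vs"
  have dist: "distinct vs" and ne: "vs \<noteq> []" and sub: "set vs \<subseteq> V"
    and step: "\<And>i. Suc i < ?N \<Longrightarrow> (vs ! i, vs ! Suc i) \<in> E" using vs by (auto simp: W_def)
  have inner: "x = vs ! (i - 1) \<or> x = vs ! Suc i" if "0 < i" "Suc i < ?N" "(vs ! i, x) \<in> E" for i x
  proof (rule ccontr)
    assume n: "\<not> ?thesis"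
    have "(vs ! i, vs ! (i - 1)) \<in> E" using symE[OF step[of "i - 1"]] that by simp
    then have "{x, vs ! (i - 1), vs ! Suc i} \<subseteq> E `` {vs ! i}" using that step by auto
    moreover have "card {x, vs ! (i - 1), vs ! Suc i} = 3"
      using n that dist by (auto simp: nth_eq_iff_index_eq card_insert_if)
    ultimately have "3 \<le> card (E `` {vs ! i})" using card_mono[OF fin] by metis
    moreover have "vs ! i \<in> V" using sub that by auto
    ultimately show False using deg by force
  qed
  have closed: "x \<in> set vs" if "i < ?N" "(vs ! i, x) \<in> E" for i x
  proof (rule ccontr)
    assume x: "x \<notin> set vs"
    have xV: "x \<in> V" using that E(1) by auto
    have "i = 0 \<or> Suc i = ?N \<or> 0 < i \<and> Suc i < ?N" using that(1) by linarith
    then consider "i = 0" | "Suc i = ?N" | "0 < i" "Suc i < ?N" by blast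
    then show False
    proof cases
      case 1
      have "W (x # vs)" unfolding W_def
      proof (intro conjI allI impI)
        fix j assume j: "Suc j < length (x # vs)"
        show "((x # vs) ! j, (x # vs) ! Suc j) \<in> E"
        proof (cases j)
          case 0
          then show ?thesis using symE[OF that(2)] 1 by simp
        next
          case (Suc j')
          then show ?thesis using step[of j'] j by simp
        qed
      qed (use dist sub x xV in auto)
      then show False using mx by fastforce
    next
      case 2
      have "W (vs @ [x])" unfolding W_def
      proof (intro conjI allI impI)
        fix j assume j: "Suc j < length (vs @ [x])"
        show "((vs @ [x]) ! j, (vs @ [x]) ! Suc j) \<in> E"
        proof (cases "Suc j = ?N")
          case True
          then have "j = i" using 2 by simp
          then show ?thesis using that(2) 2 by (simp add: nth_append)
        next
          case False
          then show ?thesis using step[of j] j by (simp add: nth_append)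
        qed
      qed (use dist sub x xV in auto)
      then show False using mx by fastforce
    next
      case 3
      then have "x = vs ! (i - 1) \<or> x = vs ! Suc i" using inner that by blast
      then show False using x that 3 by auto
    qed
  qed
  have setV: "set vs = V"
  proof
    show "V \<subseteq> set vs"
    proof
      fix v assume v: "v \<in> V"
      have "(vs ! 0, v) \<in> E\<^sup>*" using ne sub v by (intro conn) auto
      then show "v \<in> set vs"
      proof (induction rule: rtrancl_induct)
        case (step y z)
        then show ?case using closed by (auto simp: in_set_conv_nth[of y])
      qed (use ne in simp)
    qed
  qed (rule sub)
  have adj: "j = Suc i \<or> i = 0 \<and> j = ?N - 1" if "i < j" "j < ?N" "(vs ! i, vs ! j) \<in> E" for i j
  proof (cases "i = 0")
    case False
    then have "vs ! j = vs ! (i - 1) \<or> vs ! j = vs ! Suc i" using inner that by auto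
    then show ?thesis using that dist by (auto simp: nth_eq_iff_index_eq)
  next
    case True
    show ?thesis
    proof (cases "Suc j = ?N")
      case False
      then have "vs ! i = vs ! (j - 1) \<or> vs ! i = vs ! Suc j" using inner[of j "vs ! i"] symE that by auto
      then show ?thesis using that dist False by (auto simp: nth_eq_iff_index_eq)
    qed (use True in auto)
  qed
  \<comment> \<open>With two vertices the edge between the ends is the path edge itself; it closes a
    cycle only from length 3 on.\<close>
  define closing where "closing \<longleftrightarrow> (vs ! 0, vs ! (?N - 1)) \<in> E \<and> 3 \<le> ?N"
  have arcs: "E = (\<lambda>(i, j). (vs ! i, vs ! j)) ` {(i, j). i < ?N \<and> j < ?N \<and> (vs ! i, vs ! j) \<in> E}"
  proof -
    have "(u, v) \<in> (\<lambda>(i, j). (vs ! i, vs ! j)) ` {(i, j). i < ?N \<and> j < ?N \<and> (vs ! i, vs ! j) \<in> E}" if uv: "(u, v) \<in> E" for u v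
    proof -
      have "u \<in> set vs" "v \<in> set vs" using E(1) uv setV by auto
      then obtain i j where "i < ?N" "j < ?N" "u = vs ! i" "v = vs ! j" by (metis in_set_conv_nth)
      then show ?thesis using uv by (intro image_eqI[of _ _ "(i, j)"]) auto
    qed
    then show ?thesis by auto
  qed
  have noloop: "(vs ! i, vs ! i) \<notin> E" for i using E(3) by (auto simp: irrefl_def)
  have "{(i, j). i < ?N \<and> j < ?N \<and> (vs ! i, vs ! j) \<in> E} = (if closing then cycle_arcs ?N else path_arcs ?N)"
  proof (rule set_eqI, clarify)
    fix i j
    have lt: "(vs ! i, vs ! j) \<in> E \<longleftrightarrow> j = Suc i \<or> closing \<and> i = 0 \<and> j = ?N - 1" if "i < j" "j < ?N" for i j
    proof
      assume e: "(vs ! i, vs ! j) \<in> E"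
      show "j = Suc i \<or> closing \<and> i = 0 \<and> j = ?N - 1"
      proof (cases "j = Suc i")
        case False
        then have "i = 0" "j = ?N - 1" using adj[OF that e] by auto
        then show ?thesis using e False that by (auto simp: closing_def)
      qed simp
    qed (use step that in \<open>auto simp: closing_def\<close>)
    show "(i, j) \<in> {(i, j). i < ?N \<and> j < ?N \<and> (vs ! i, vs ! j) \<in> E} \<longleftrightarrow> (i, j) \<in> (if closing then cycle_arcs ?N else path_arcs ?N)"
    proof (cases i j rule: linorder_cases)
      case less
      then show ?thesis using lt[OF less] by (auto simp: cycle_arcs_def path_arcs_def closing_def)
    next
      case equal
      then show ?thesis using noloop by (auto simp: cycle_arcs_def path_arcs_def closing_def)
    next
      case greater
      then show ?thesis using lt[OF greater] symE by (auto simp: cycle_arcs_def path_arcs_def closing_def)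
    qed
  qed
  then show thesis using that[OF dist setV] arcs by (auto simp: closing_def split: if_splits)
qed

section \<open>Planar geometry of the complex\<close>

locale spline_complex =
  fixes P :: "(real^2) set set" and l :: "(real^2) set \<Rightarrow> poly3"
  assumes complex: "planar_polyhedral_complex P" and forms: "edge_forms P l"
begin

definition "nv \<tau> = (SOME n. l \<tau> = lin n)"

abbreviation "Faces \<equiv> faces_of_dim 2 P"

abbreviation "Edges \<equiv> interior_edges P"

text \<open>The edge form restricted to the plane x3 = 1, read as an affine function on the original
  plane.\<close>

definition "val \<tau> x = nv \<tau> \<bullet> embed x"

definition "line \<tau> = {x. val \<tau> x = 0}"

lemma l_eq:
  assumes "\<tau> \<in> faces_of_dim 1 P"
  shows "l \<tau> = lin (nv \<tau>)" "nv \<tau> \<noteq> 0" "\<tau> \<subseteq> line \<tau>"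
proof -
  have *: "l \<tau> \<noteq> 0" "homogeneous 1 (l \<tau>)" "cone_over \<tau> \<subseteq> zero_locus (l \<tau>)"
    using forms assms by (auto simp: edge_forms_def)
  obtain n where "l \<tau> = lin n" using homogeneous_1_lin[OF *(2)] by blast
  then show l: "l \<tau> = lin (nv \<tau>)" unfolding nv_def by (rule someI)
  show "nv \<tau> \<noteq> 0" using *(1) l by (auto simp: lin_eq_0_iff)
  show "\<tau> \<subseteq> line \<tau>"
  proof
    fix x assume "x \<in> \<tau>"
    then have "embed x \<in> cone_over \<tau>" unfolding cone_over_def by (intro hull_inc imageI)
    then have "eval3 (l \<tau>) (embed x) = 0" using *(3) by (auto simp: zero_locus_def)
    then show "x \<in> line \<tau>" by (simp add: l eval3_lin line_def val_def)
  qed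
qed

lemma val_eq: "val \<tau> x = vector [nv \<tau> $ 1, nv \<tau> $ 2] \<bullet> x + nv \<tau> $ 3"
  by (simp add: val_def embed_def inner_vec_def sum_2 sum_3)

lemma val_affine: "val \<tau> ((1 - t) *\<^sub>R x + t *\<^sub>R y) = (1 - t) * val \<tau> x + t * val \<tau> y"
  by (simp add: val_eq inner_add_right algebra_simps)

lemma finite_P: "finite P"
  using complex by (simp add: planar_polyhedral_complex_def)

lemma finite_Faces: "finite Faces" and finite_Edges: "finite Edges"
  using finite_P by (auto simp: faces_of_dim_def interior_edges_def)

lemma Faces_convex: "\<sigma> \<in> Faces \<Longrightarrow> convex \<sigma>"
  using complex by (auto simp: planar_polyhedral_complex_def faces_of_dim_def polytope_imp_convex)

lemma edge_in_P: "\<tau> edge_of \<sigma> \<Longrightarrow> \<sigma> \<in> Faces \<Longrightarrow> \<tau> \<in> faces_of_dim 1 P"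
  using complex by (auto simp: planar_polyhedral_complex_def faces_of_dim_def edge_of_def)

lemma Edges_dim1: "\<tau> \<in> Edges \<Longrightarrow> \<tau> \<in> faces_of_dim 1 P"
  by (simp add: interior_edges_def)

text \<open>Both sides are lines. If the first two entries of the normal were zero, the form would
  be constant on the plane x3 = 1; vanishing on the edge, it would be zero.\<close>

lemma line_eq_hull:
  assumes "\<tau> \<in> faces_of_dim 1 P"
  shows "line \<tau> = affine hull \<tau>"
proof -
  have d: "aff_dim \<tau> = 1" using assms by (simp add: faces_of_dim_def)
  then have ne: "\<tau> \<noteq> {}" by auto
  let ?a = "vector [nv \<tau> $ 1, nv \<tau> $ 2] :: real^2"
  have H: "line \<tau> = {x. ?a \<bullet> x = - (nv \<tau> $ 3)}"
    by (auto simp: line_def val_eq)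
  have "?a \<noteq> 0"
  proof
    assume a: "?a = 0"
    then have "nv \<tau> $ 3 = 0" using ne l_eq(3)[OF assms] by (auto simp: H)
    moreover have "nv \<tau> $ 1 = 0" "nv \<tau> $ 2 = 0" using a by (auto simp: vec_eq_iff forall_2)
    ultimately have "nv \<tau> = 0" by (simp add: vec_eq_iff forall_3)
    then show False using l_eq(2)[OF assms] by simp
  qed
  then have "aff_dim (line \<tau>) = 1" unfolding H by (subst aff_dim_hyperplane) auto
  moreover have "affine hull \<tau> \<subseteq> line \<tau>"
    using l_eq(3)[OF assms] unfolding H by (intro hull_minimal affine_hyperplane) auto
  ultimately show ?thesis
    using d ne affine_dim_equal[of "affine hull \<tau>" "line \<tau>"] by (auto simp: H affine_hyperplane)
qed

lemma edge_eq:
  assumes "\<tau> edge_of \<sigma>" "\<sigma> \<in> Faces"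
  shows "\<tau> = line \<tau> \<inter> \<sigma>"
  using face_of_imp_eq_affine_Int[OF Faces_convex[OF assms(2)], of \<tau>] assms
    line_eq_hull[OF edge_in_P[OF assms]] by (simp add: edge_of_def)

lemma not_in_line:
  assumes "\<sigma> \<in> Faces" "\<tau> \<in> faces_of_dim 1 P"
  shows "\<exists>x\<in>\<sigma>. val \<tau> x \<noteq> 0"
proof (rule ccontr)
  assume "\<not> ?thesis"
  then have "\<sigma> \<subseteq> line \<tau>" by (auto simp: line_def)
  then have "aff_dim \<sigma> \<le> aff_dim (line \<tau>)" by (rule aff_dim_subset)
  then show False using assms by (simp add: line_eq_hull faces_of_dim_def)
qed

text \<open>A sign change along a segment in \<sigma> would produce a point of the edge inside that
  segment; the face property then puts its ends into the edge, where the form vanishes.\<close>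

lemma edge_one_sided:
  assumes "\<tau> edge_of \<sigma>" "\<sigma> \<in> Faces" "x \<in> \<sigma>" "y \<in> \<sigma>"
  shows "0 \<le> val \<tau> x * val \<tau> y"
proof (rule ccontr)
  assume "\<not> ?thesis"
  then have neg: "val \<tau> x * val \<tau> y < 0" by simp
  define t where "t = val \<tau> x / (val \<tau> x - val \<tau> y)"
  have t: "0 < t" "t < 1" and d: "val \<tau> x \<noteq> val \<tau> y"
    using neg by (auto simp: t_def mult_less_0_iff field_simps)
  define z where "z = (1 - t) *\<^sub>R x + t *\<^sub>R y"
  have "val \<tau> z = (1 - t) * val \<tau> x + t * val \<tau> y" unfolding z_def by (rule val_affine)
  also have "\<dots> = 0" using d by (simp add: t_def field_simps)
  finally have "val \<tau> z = 0" .
  moreover have z: "z \<in> open_segment x y" using t d by (auto simp: z_def in_segment)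
  moreover have "z \<in> \<sigma>"
    using z assms(3,4) Faces_convex[OF assms(2)] by (meson convex_contains_open_segment subsetD)
  ultimately have "z \<in> \<tau>" using edge_eq[OF assms(1,2)] by (auto simp: line_def)
  then have "x \<in> \<tau>" using assms z by (auto simp: edge_of_def face_of_def)
  then have "val \<tau> x = 0" using l_eq(3)[OF edge_in_P[OF assms(1,2)]] by (auto simp: line_def)
  then show False using neg by simp
qed

lemma parallel_edges_eq:
  assumes "\<tau> edge_of \<sigma>" "\<tau>' edge_of \<sigma>" "\<sigma> \<in> Faces" "cross3 (nv \<tau>) (nv \<tau>') = 0"
  shows "\<tau> = \<tau>'"
proof -
  note e = edge_in_P[OF assms(1,3)] edge_in_P[OF assms(2,3)]
  obtain c where c: "nv \<tau> = c *\<^sub>R nv \<tau>'" using cross3_eq_0_scale[OF assms(4) l_eq(2)[OF e(2)]] by blast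
  then have "c \<noteq> 0" using l_eq(2)[OF e(1)] by auto
  then have "line \<tau> = line \<tau>'" by (simp add: line_def val_def c)
  then show ?thesis using edge_eq[OF assms(1,3)] edge_eq[OF assms(2,3)] by simp
qed

text \<open>The edge \<tau> then lies in \<tau>' and is a face of it of the same dimension.\<close>

lemma edge_subset_line_eq:
  assumes "\<tau> edge_of \<sigma>" "\<tau>' edge_of \<sigma>" "\<sigma> \<in> Faces" "\<tau> \<subseteq> line \<tau>'"
  shows "\<tau> = \<tau>'"
proof -
  note e = edge_in_P[OF assms(1,3)] edge_in_P[OF assms(2,3)]
  have "\<tau> \<subseteq> \<tau>'" using assms edge_eq[OF assms(2,3)] edge_of_imp_subset[OF assms(1)] by blast
  moreover have "\<tau> face_of \<sigma>" "\<tau>' face_of \<sigma>" using assms by (auto simp: edge_of_def)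
  ultimately have "\<tau> face_of \<tau>'" using face_of_subset edge_of_imp_subset[OF assms(2)] by blast
  moreover have "aff_dim \<tau> = aff_dim \<tau>'" using e by (simp add: faces_of_dim_def)
  ultimately show ?thesis
    using face_of_aff_dim_lt[of \<tau>' \<tau>] face_of_imp_convex[OF \<open>\<tau>' face_of \<sigma>\<close>] by fastforce
qed

lemma edge_sign:
  assumes "\<tau> edge_of \<sigma>" "\<sigma> \<in> Faces"
  obtains s where "s \<noteq> 0" "\<And>x. x \<in> \<sigma> \<Longrightarrow> 0 \<le> s * val \<tau> x"
proof -
  obtain y where "y \<in> \<sigma>" "val \<tau> y \<noteq> 0" using not_in_line[OF assms(2) edge_in_P[OF assms]] by blast
  then show thesis using edge_one_sided[OF assms] by (intro that[of "val \<tau> y"]) auto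
qed

text \<open>
  Normals of three edges of a convex polygon cannot lie in a plane: one of the three
  supporting half-planes would be redundant, or their intersection degenerate.
\<close>

lemma at_most_two_edges_through:
  assumes e: "\<tau>1 edge_of \<sigma>" "\<tau>2 edge_of \<sigma>" "\<tau>3 edge_of \<sigma>" "\<sigma> \<in> Faces"
    and w: "w \<noteq> 0" "nv \<tau>1 \<bullet> w = 0" "nv \<tau>2 \<bullet> w = 0" "nv \<tau>3 \<bullet> w = 0"
    and ne: "\<tau>1 \<noteq> \<tau>2" "\<tau>1 \<noteq> \<tau>3" "\<tau>2 \<noteq> \<tau>3"
  shows False
proof -
  let ?n1 = "nv \<tau>1" and ?n2 = "nv \<tau>2" and ?n3 = "nv \<tau>3"
  have np: "cross3 ?n1 ?n2 \<noteq> 0" "cross3 ?n1 ?n3 \<noteq> 0" "cross3 ?n3 ?n2 \<noteq> 0"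
    using parallel_edges_eq e ne by metis+
  obtain s1 where s1: "s1 \<noteq> 0" "\<And>x. x \<in> \<sigma> \<Longrightarrow> 0 \<le> s1 * val \<tau>1 x" using edge_sign[OF e(1,4)] by blast
  obtain s2 where s2: "s2 \<noteq> 0" "\<And>x. x \<in> \<sigma> \<Longrightarrow> 0 \<le> s2 * val \<tau>2 x" using edge_sign[OF e(2,4)] by blast
  obtain s3 where s3: "s3 \<noteq> 0" "\<And>x. x \<in> \<sigma> \<Longrightarrow> 0 \<le> s3 * val \<tau>3 x" using edge_sign[OF e(3,4)] by blast
  \<comment> \<open>All three normals are orthogonal to w, so Cramer's rule expresses the third by
    the first two.\<close>
  have dep: "\<exists>p q. ?n3 = p *\<^sub>R ?n1 + q *\<^sub>R ?n2"
  proof -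
    let ?N = "cross3 ?n1 ?n2"
    have par: "(w \<bullet> w) *\<^sub>R ?N = (w \<bullet> ?N) *\<^sub>R w" by (rule cross3_orthogonal_parallel[OF w(2,3)])
    have d: "w \<bullet> ?N \<noteq> 0" using par np(1) w(1) by auto
    have "(w \<bullet> w) * (?n3 \<bullet> ?N) = 0" using arg_cong[OF par, of "\<lambda>z. ?n3 \<bullet> z"] w(4) by simp
    then have n3: "?n3 \<bullet> ?N = 0" using w(1) by simp
    let ?d = "?n1 \<bullet> cross3 ?n2 w"
    have dd: "?d \<noteq> 0" using d by (simp add: cross3_def inner_vec_def sum_3) algebra
    have "?d *\<^sub>R ?n3 = (?n3 \<bullet> cross3 ?n2 w) *\<^sub>R ?n1 + (?n3 \<bullet> cross3 w ?n1) *\<^sub>R ?n2"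
      using cross3_dual_expansion[of ?n1 ?n2 w ?n3] n3 by simp
    then have "inverse ?d *\<^sub>R ?d *\<^sub>R ?n3 = inverse ?d *\<^sub>R ((?n3 \<bullet> cross3 ?n2 w) *\<^sub>R ?n1 + (?n3 \<bullet> cross3 w ?n1) *\<^sub>R ?n2)"
      by (rule arg_cong)
    then have "?n3 = (inverse ?d * (?n3 \<bullet> cross3 ?n2 w)) *\<^sub>R ?n1 + (inverse ?d * (?n3 \<bullet> cross3 w ?n1)) *\<^sub>R ?n2"
      using dd by (simp add: scaleR_right_distrib)
    then show ?thesis by blast
  qed
  then obtain p' q' where pq': "?n3 = p' *\<^sub>R ?n1 + q' *\<^sub>R ?n2" by blast
  have "p' \<noteq> 0" "q' \<noteq> 0" using pq' np(2,3) by (auto simp: cross_mult_left cross_mult_right)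
  \<comment> \<open>Rescaled so that the relation holds between the signed forms that are
    nonnegative on \<sigma>; then only the signs of p and q matter.\<close>
  define p where "p = s3 * p' / s1"
  define q where "q = s3 * q' / s2"
  have pq0: "p \<noteq> 0" "q \<noteq> 0" using \<open>p' \<noteq> 0\<close> \<open>q' \<noteq> 0\<close> s1 s2 s3 by (auto simp: p_def q_def)
  have rel: "s3 *\<^sub>R ?n3 = (p * s1) *\<^sub>R ?n1 + (q * s2) *\<^sub>R ?n2"
    using s1 s2 unfolding pq' by (simp add: p_def q_def scaleR_right_distrib)
  have rel3: "?n3 = (p / s3 * s1) *\<^sub>R ?n1 + (q / s3 * s2) *\<^sub>R ?n2"
    using arg_cong[OF rel, of "\<lambda>x. inverse s3 *\<^sub>R x"] s3(1) by (simp add: scaleR_right_distrib divide_inverse mult_ac)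
  \<comment> \<open>In the first three cases the relation makes the form of one edge vanish along
    another edge, so the two edges coincide. With both signs negative the third signed form would be
    negative at a point of \<sigma>.\<close>
  consider "0 < p" "0 < q" | "0 < p" "q < 0" | "p < 0" "0 < q" | "p < 0" "q < 0" using pq0 by linarith
  then show False
  proof cases
    case 1
    have "\<tau>3 = \<tau>1"
    proof (rule edge_subset_line_eq[OF e(3,1,4)], rule subsetI)
      fix x assume x: "x \<in> \<tau>3"
      have "val \<tau>3 x = 0" using l_eq(3)[OF edge_in_P[OF e(3,4)]] x by (auto simp: line_def)
      moreover have "s3 * val \<tau>3 x = p * (s1 * val \<tau>1 x) + q * (s2 * val \<tau>2 x)"
        using arg_cong[OF rel, of "\<lambda>n. n \<bullet> embed x"] by (simp add: val_def inner_add_left)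
      moreover have "x \<in> \<sigma>" using x edge_of_imp_subset[OF e(3)] by blast
      then have "0 \<le> p * (s1 * val \<tau>1 x)" "0 \<le> q * (s2 * val \<tau>2 x)" using s1 s2 1 by auto
      ultimately have "p * (s1 * val \<tau>1 x) = 0"
        using add_nonneg_eq_0_iff[of "p * (s1 * val \<tau>1 x)" "q * (s2 * val \<tau>2 x)"]
        by (simp del: mult_eq_0_iff)
      then show "x \<in> line \<tau>1" using 1 s1 by (simp add: line_def)
    qed
    then show False using ne by simp
  next
    case 2
    have "\<tau>1 = \<tau>3"
    proof (rule edge_subset_line_eq[OF e(1,3,4)], rule subsetI)
      fix x assume x: "x \<in> \<tau>1"
      have "val \<tau>1 x = 0" using l_eq(3)[OF edge_in_P[OF e(1,4)]] x by (auto simp: line_def)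
      moreover have "s3 * val \<tau>3 x = p * (s1 * val \<tau>1 x) + q * (s2 * val \<tau>2 x)"
        using arg_cong[OF rel, of "\<lambda>n. n \<bullet> embed x"] by (simp add: val_def inner_add_left)
      moreover have x\<sigma>: "x \<in> \<sigma>" using x edge_of_imp_subset[OF e(1)] by blast
      then have "q * (s2 * val \<tau>2 x) \<le> 0" using s2 2 by (intro mult_nonpos_nonneg) auto
      ultimately have "s3 * val \<tau>3 x = 0" using s3(2)[OF x\<sigma>] by simp
      then show "x \<in> line \<tau>3" using s3 by (simp add: line_def)
    qed
    then show False using ne by simp
  next
    case 3
    have "\<tau>2 = \<tau>3"
    proof (rule edge_subset_line_eq[OF e(2,3,4)], rule subsetI)
      fix x assume x: "x \<in> \<tau>2"
      have "val \<tau>2 x = 0" using l_eq(3)[OF edge_in_P[OF e(2,4)]] x by (auto simp: line_def)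
      moreover have "s3 * val \<tau>3 x = p * (s1 * val \<tau>1 x) + q * (s2 * val \<tau>2 x)"
        using arg_cong[OF rel, of "\<lambda>n. n \<bullet> embed x"] by (simp add: val_def inner_add_left)
      moreover have x\<sigma>: "x \<in> \<sigma>" using x edge_of_imp_subset[OF e(2)] by blast
      then have "p * (s1 * val \<tau>1 x) \<le> 0" using s1 3 by (intro mult_nonpos_nonneg) auto
      ultimately have "s3 * val \<tau>3 x = 0" using s3(2)[OF x\<sigma>] by simp
      then show "x \<in> line \<tau>3" using s3 by (simp add: line_def)
    qed
    then show False using ne by simp
  next
    case 4
    obtain x where x: "x \<in> \<sigma>" "val \<tau>1 x \<noteq> 0" using not_in_line[OF e(4) edge_in_P[OF e(1,4)]] by blast
    have "s3 * val \<tau>3 x = p * (s1 * val \<tau>1 x) + q * (s2 * val \<tau>2 x)"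
      using arg_cong[OF rel, of "\<lambda>n. n \<bullet> embed x"] by (simp add: val_def inner_add_left)
    moreover have "q * (s2 * val \<tau>2 x) \<le> 0" using s2(2)[OF x(1)] 4 by (intro mult_nonpos_nonneg) auto
    moreover have "0 < s1 * val \<tau>1 x" using s1(1) s1(2)[OF x(1)] x(2) by (metis less_eq_real_def mult_eq_0_iff)
    then have "p * (s1 * val \<tau>1 x) < 0" using 4 by (intro mult_neg_pos)
    ultimately show False using s3(2)[OF x(1)] by simp
  qed
qed

text \<open>Distinct 2-faces meet in a common face, so their relative interiors are disjoint and a
  line separates them. It contains the shared edge, hence is the line of that edge.\<close>

lemma faces_separated:
  assumes \<sigma>: "\<sigma> \<in> Faces" "\<sigma>' \<in> Faces" "\<sigma> \<noteq> \<sigma>'" and \<tau>: "\<tau> edge_of \<sigma>" "\<tau> edge_of \<sigma>'"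
  shows "\<sigma> \<inter> \<sigma>' \<subseteq> line \<tau>" "x \<in> \<sigma> \<Longrightarrow> y \<in> \<sigma>' \<Longrightarrow> val \<tau> x * val \<tau> y \<le> 0"
proof -
  have P: "\<sigma> \<in> P" "\<sigma>' \<in> P" using \<sigma> by (auto simp: faces_of_dim_def)
  have f: "(\<sigma> \<inter> \<sigma>') face_of \<sigma>" "(\<sigma> \<inter> \<sigma>') face_of \<sigma>'"
    using complex P by (auto simp: planar_polyhedral_complex_def)
  have "rel_interior \<sigma> \<inter> rel_interior \<sigma>' = {}"
  proof (rule ccontr)
    assume "rel_interior \<sigma> \<inter> rel_interior \<sigma>' \<noteq> {}"
    then obtain z where z: "z \<in> rel_interior \<sigma>" "z \<in> rel_interior \<sigma>'" by blast
    then have "z \<in> \<sigma> \<inter> \<sigma>'" using rel_interior_subset by blast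
    then have "\<sigma> \<inter> \<sigma>' = \<sigma>" "\<sigma> \<inter> \<sigma>' = \<sigma>'"
      using z f face_of_disjoint_rel_interior by blast+
    then show False using \<sigma>(3) by simp
  qed
  moreover have ne: "\<sigma> \<noteq> {}" "\<sigma>' \<noteq> {}" using \<sigma> by (auto simp: faces_of_dim_def)
  ultimately obtain a b where ab0: "a \<noteq> 0" "\<forall>x\<in>rel_interior \<sigma>. a \<bullet> x \<le> b" "\<forall>x\<in>rel_interior \<sigma>'. b \<le> a \<bullet> x"
    using separating_hyperplane_sets[of "rel_interior \<sigma>" "rel_interior \<sigma>'"] Faces_convex \<sigma>
    by (auto simp: convex_rel_interior rel_interior_eq_empty)
  have ab: "a \<noteq> 0" "\<And>x. x \<in> \<sigma> \<Longrightarrow> a \<bullet> x \<le> b" "\<And>x. x \<in> \<sigma>' \<Longrightarrow> b \<le> a \<bullet> x"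
  proof -
    have "closure (rel_interior \<sigma>) \<subseteq> {x. a \<bullet> x \<le> b}"
      using ab0 by (intro closure_minimal closed_halfspace_le) auto
    then show "a \<bullet> x \<le> b" if "x \<in> \<sigma>" for x
      using that closure_subset[of \<sigma>] convex_closure_rel_interior[OF Faces_convex[OF \<sigma>(1)]] by auto
    have "closure (rel_interior \<sigma>') \<subseteq> {x. a \<bullet> x \<ge> b}"
      using ab0 by (intro closure_minimal closed_halfspace_ge) auto
    then show "b \<le> a \<bullet> x" if "x \<in> \<sigma>'" for x
      using that closure_subset[of \<sigma>'] convex_closure_rel_interior[OF Faces_convex[OF \<sigma>(2)]] by auto
  qed (rule ab0)
  have inter: "\<sigma> \<inter> \<sigma>' \<subseteq> {x. a \<bullet> x = b}"
  proof
    fix x assume "x \<in> \<sigma> \<inter> \<sigma>'"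
    then have "a \<bullet> x \<le> b" "b \<le> a \<bullet> x" using ab by blast+
    then show "x \<in> {x. a \<bullet> x = b}" by simp
  qed
  note e = edge_in_P[OF \<tau>(1) \<sigma>(1)]
  have "affine hull \<tau> = {x. a \<bullet> x = b}"
  proof (rule affine_dim_equal)
    have "\<tau> \<subseteq> \<sigma> \<inter> \<sigma>'" using edge_of_imp_subset[OF \<tau>(1)] edge_of_imp_subset[OF \<tau>(2)] by blast
    then have "\<tau> \<subseteq> {x. a \<bullet> x = b}" using inter by blast
    then show "affine hull \<tau> \<subseteq> {x. a \<bullet> x = b}" by (intro hull_minimal affine_hyperplane)
    show "aff_dim (affine hull \<tau>) = aff_dim {x. a \<bullet> x = b}"
      using e ab(1) by (simp add: faces_of_dim_def aff_dim_hyperplane)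
    show "affine hull \<tau> \<noteq> {}" using e by (auto simp: faces_of_dim_def)
  qed (auto simp: affine_hyperplane)
  then have L: "line \<tau> = {x. a \<bullet> x = b}" using line_eq_hull[OF e] by simp
  show "\<sigma> \<inter> \<sigma>' \<subseteq> line \<tau>" unfolding L by (rule inter)
  assume x: "x \<in> \<sigma>" and y: "y \<in> \<sigma>'"
  show "val \<tau> x * val \<tau> y \<le> 0"
  proof (rule ccontr)
    assume "\<not> ?thesis"
    then have pos: "0 < val \<tau> x * val \<tau> y" by simp
    then have "x \<notin> line \<tau>" "y \<notin> line \<tau>" by (auto simp: line_def)
    then have lt: "a \<bullet> x < b" "b < a \<bullet> y" using ab(2)[OF x] ab(3)[OF y] by (auto simp: L)
    \<comment> \<open>z is the point where the segment from x to y crosses the separating line; two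
      values of the same sign cannot average to zero there.\<close>
    define t where "t = (b - a \<bullet> x) / (a \<bullet> y - a \<bullet> x)"
    have t: "0 < t" "t < 1" using lt by (auto simp: t_def field_simps)
    define z where "z = (1 - t) *\<^sub>R x + t *\<^sub>R y"
    have "a \<bullet> z = a \<bullet> x + t * (a \<bullet> y - a \<bullet> x)" by (simp add: z_def inner_add_right algebra_simps)
    also have "\<dots> = b" using lt by (simp add: t_def)
    finally have "z \<in> line \<tau>" by (simp add: L)
    then have z: "(1 - t) * val \<tau> x + t * val \<tau> y = 0" by (simp add: line_def z_def val_affine)
    have "0 < (1 - t) * (val \<tau> x * val \<tau> x) + t * (val \<tau> x * val \<tau> y)"
      using t pos by (intro add_nonneg_pos) auto
    also have "\<dots> = val \<tau> x * ((1 - t) * val \<tau> x + t * val \<tau> y)" by (simp add: algebra_simps)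
    finally show False using z by simp
  qed
qed

text \<open>Two faces on the same side of a shared edge would violate separation, so the side
  determines the face.\<close>

lemma at_most_two_faces:
  assumes "\<tau> \<in> faces_of_dim 1 P"
  shows "card {\<sigma> \<in> Faces. \<tau> edge_of \<sigma>} \<le> 2"
proof -
  let ?S = "{\<sigma> \<in> Faces. \<tau> edge_of \<sigma>}"
  have "inj_on (\<lambda>\<sigma>. \<exists>x\<in>\<sigma>. 0 < val \<tau> x) ?S"
  proof (rule inj_onI, rule ccontr)
    fix \<sigma> \<sigma>' assume s: "\<sigma> \<in> ?S" "\<sigma>' \<in> ?S" "\<sigma> \<noteq> \<sigma>'"
      and eq: "(\<exists>x\<in>\<sigma>. 0 < val \<tau> x) = (\<exists>x\<in>\<sigma>'. 0 < val \<tau> x)"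
    obtain x where x: "x \<in> \<sigma>" "val \<tau> x \<noteq> 0" using not_in_line s(1) assms by blast
    obtain y where y: "y \<in> \<sigma>'" "val \<tau> y \<noteq> 0" using not_in_line s(2) assms by blast
    have sep: "val \<tau> x' * val \<tau> y' \<le> 0" if "x' \<in> \<sigma>" "y' \<in> \<sigma>'" for x' y'
      using faces_separated(2)[of \<sigma> \<sigma>' \<tau>] s that by blast
    show False
    proof (cases "\<exists>x\<in>\<sigma>. 0 < val \<tau> x")
      case True
      then obtain x' y' where "x' \<in> \<sigma>" "y' \<in> \<sigma>'" "0 < val \<tau> x'" "0 < val \<tau> y'" using eq by auto
      then show False using sep[of x' y'] by (auto simp: mult_le_0_iff)
    next
      case False
      then have "val \<tau> x < 0" "val \<tau> y < 0" using eq x y by force+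
      then show False using sep[OF x(1) y(1)] by (auto simp: mult_le_0_iff)
    qed
  qed
  then have "card ?S \<le> card (UNIV :: bool set)" by (rule card_inj_on_le) auto
  then show ?thesis by simp
qed

lemma shared_edge_interior:
  assumes \<sigma>: "\<sigma> \<in> Faces" "\<sigma>' \<in> Faces" "\<sigma> \<noteq> \<sigma>'" and \<tau>: "\<tau> edge_of \<sigma>" "\<tau> edge_of \<sigma>'"
  shows "\<tau> \<in> Edges" "{\<sigma>'' \<in> Faces. \<tau> edge_of \<sigma>''} = {\<sigma>, \<sigma>'}"
proof -
  note e = edge_in_P[OF \<tau>(1) \<sigma>(1)]
  have sub: "{\<sigma>, \<sigma>'} \<subseteq> {\<sigma>'' \<in> Faces. \<tau> edge_of \<sigma>''}" using assms by auto
  have fin: "finite {\<sigma>'' \<in> Faces. \<tau> edge_of \<sigma>''}" using finite_Faces by simp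
  have "card {\<sigma>, \<sigma>'} = 2" using \<sigma>(3) by simp
  then have c: "card {\<sigma>'' \<in> Faces. \<tau> edge_of \<sigma>''} = 2"
    using card_mono[OF fin sub] at_most_two_faces[OF e] by simp
  then show "\<tau> \<in> Edges" using e by (simp add: interior_edges_def)
  show "{\<sigma>'' \<in> Faces. \<tau> edge_of \<sigma>''} = {\<sigma>, \<sigma>'}"
    using card_seteq[OF fin sub] c \<open>card {\<sigma>, \<sigma>'} = 2\<close> by simp
qed

lemma shared_edge_unique:
  assumes \<sigma>: "\<sigma> \<in> Faces" "\<sigma>' \<in> Faces" "\<sigma> \<noteq> \<sigma>'" and \<tau>: "\<tau> edge_of \<sigma>" "\<tau> edge_of \<sigma>'"
    and \<tau>': "\<tau>' edge_of \<sigma>" "\<tau>' edge_of \<sigma>'"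
  shows "\<tau> = \<tau>'"
proof -
  have "\<tau>' \<subseteq> \<sigma> \<inter> \<sigma>'" using \<tau>' edge_of_imp_subset by blast
  then have "\<tau>' \<subseteq> line \<tau>" using faces_separated(1)[OF \<sigma> \<tau>] by blast
  then show ?thesis using edge_subset_line_eq[OF \<tau>'(1) \<tau>(1) \<sigma>(1)] by simp
qed

text \<open>An arbitrary orientation of each interior edge, so that differences across it have a
  definite sign.\<close>

definition "ends \<tau> = (SOME p. fst p \<noteq> snd p \<and> {\<sigma> \<in> Faces. \<tau> edge_of \<sigma>} = {fst p, snd p})"

definition "fa \<tau> = fst (ends \<tau>)"

definition "fb \<tau> = snd (ends \<tau>)"

lemma ends:
  assumes "\<tau> \<in> Edges"
  shows "fa \<tau> \<noteq> fb \<tau>" "{\<sigma> \<in> Faces. \<tau> edge_of \<sigma>} = {fa \<tau>, fb \<tau>}"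
proof -
  have "card {\<sigma> \<in> Faces. \<tau> edge_of \<sigma>} = 2" using assms by (simp add: interior_edges_def)
  then obtain x y where "x \<noteq> y" "{\<sigma> \<in> Faces. \<tau> edge_of \<sigma>} = {x, y}" by (auto simp: card_2_iff)
  then have "\<exists>p. fst p \<noteq> snd p \<and> {\<sigma> \<in> Faces. \<tau> edge_of \<sigma>} = {fst p, snd p}"
    by (intro exI[of _ "(x, y)"]) simp
  from someI_ex[OF this] show "fa \<tau> \<noteq> fb \<tau>" "{\<sigma> \<in> Faces. \<tau> edge_of \<sigma>} = {fa \<tau>, fb \<tau>}"
    by (auto simp: fa_def fb_def ends_def)
qed

lemma ends_edge:
  assumes "\<tau> \<in> Edges"
  shows "fa \<tau> \<in> Faces" "fb \<tau> \<in> Faces" "\<tau> edge_of fa \<tau>" "\<tau> edge_of fb \<tau>"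
  using ends(2)[OF assms] by blast+

lemma edge_of_iff_end:
  assumes "\<tau> \<in> Edges" "\<sigma> \<in> Faces"
  shows "\<tau> edge_of \<sigma> \<longleftrightarrow> \<sigma> = fa \<tau> \<or> \<sigma> = fb \<tau>"
  using ends(2)[OF assms(1)] assms(2) by blast

text \<open>Exchanging the two faces preserves divisibility, and an edge shared by distinct faces is
  interior with just these ends; so one condition per interior edge remains.\<close>

lemma splines_iff:
  "f \<in> splines r P l \<longleftrightarrow> (\<forall>\<sigma>. \<sigma> \<notin> Faces \<longrightarrow> f \<sigma> = 0) \<and> (\<forall>\<tau>\<in>Edges. lin (nv \<tau>) ^ Suc r dvd f (fa \<tau>) - f (fb \<tau>))"
  (is "_ \<longleftrightarrow> ?Z \<and> ?D")
proof
  assume f: "f \<in> splines r P l"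
  have "lin (nv \<tau>) ^ Suc r dvd f (fa \<tau>) - f (fb \<tau>)" if E: "\<tau> \<in> Edges" for \<tau>
  proof -
    have "l \<tau> ^ (r + 1) dvd f (fa \<tau>) - f (fb \<tau>)"
      using f ends_edge[OF E] unfolding splines_def by blast
    then show ?thesis by (simp only: l_eq(1)[OF Edges_dim1[OF E]] Suc_eq_plus1)
  qed
  then show "?Z \<and> ?D" using f unfolding splines_def by blast
next
  assume f: "?Z \<and> ?D"
  have "l \<tau> ^ (r + 1) dvd f \<sigma>1 - f \<sigma>2"
    if "\<sigma>1 \<in> Faces" "\<sigma>2 \<in> Faces" "\<tau> edge_of \<sigma>1" "\<tau> edge_of \<sigma>2" for \<sigma>1 \<sigma>2 \<tau>
  proof (cases "\<sigma>1 = \<sigma>2")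
    case False
    have E: "\<tau> \<in> Edges" and "{\<sigma> \<in> Faces. \<tau> edge_of \<sigma>} = {\<sigma>1, \<sigma>2}"
      using shared_edge_interior[OF that(1,2) False that(3,4)] by auto
    then have "{fa \<tau>, fb \<tau>} = {\<sigma>1, \<sigma>2}" using ends(2) by simp
    then have "f \<sigma>1 - f \<sigma>2 = f (fa \<tau>) - f (fb \<tau>) \<or> f \<sigma>1 - f \<sigma>2 = - (f (fa \<tau>) - f (fb \<tau>))"
      by (auto simp: doubleton_eq_iff)
    moreover have "lin (nv \<tau>) ^ Suc r dvd f (fa \<tau>) - f (fb \<tau>)" using f E by blast
    ultimately show ?thesis
      unfolding l_eq(1)[OF Edges_dim1[OF E]] Suc_eq_plus1[symmetric] by (metis dvd_minus_iff)
  qed simp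
  then show "f \<in> splines r P l" using f unfolding splines_def by blast
qed

end

section \<open>Tuples supported at a single index\<close>

lemma sum_fun_apply: "(sum f I) x = (\<Sum>i\<in>I. f i x)"
  for f :: "'i \<Rightarrow> 'a \<Rightarrow> 'b::comm_monoid_add"
  by (induction I rule: infinite_finite_induct) auto

definition single_at :: "'a \<Rightarrow> poly3 \<Rightarrow> 'a \<Rightarrow> poly3" where
  "single_at i p = (\<lambda>j. if j = i then p else 0)"

lemma single_at_add: "single_at i (p + q) = single_at i p + single_at i q"
  and single_at_diff: "single_at i (p - q) = single_at i p - single_at i q"
  and single_at_0 [simp]: "single_at i 0 = 0"
  by (auto simp: single_at_def fun_eq_iff)

lemma single_at_sum: "single_at i (sum f I) = (\<Sum>k\<in>I. single_at i (f k))"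
  by (induction I rule: infinite_finite_induct) (auto simp: single_at_add)

section \<open>Components of the graphs through a point\<close>

context spline_complex begin

definition "dir \<xi> = (SOME w. w \<noteq> 0 \<and> \<xi> = span {w})"

lemma dir:
  assumes "codim2 \<xi>"
  shows "dir \<xi> \<noteq> 0" "\<xi> = span {dir \<xi>}"
proof -
  have s: "subspace \<xi>" "dim \<xi> = 1" using assms by (auto simp: codim2_def)
  then obtain w where w: "w \<in> \<xi>" "w \<noteq> 0" using dim_eq_0[of \<xi>] by auto
  have "span {w} = \<xi>"
    using s w by (intro subspace_dim_equal span_minimal) auto
  then have "\<exists>w. w \<noteq> 0 \<and> \<xi> = span {w}" using w by blast
  from someI_ex[OF this] show "dir \<xi> \<noteq> 0" "\<xi> = span {dir \<xi>}" by (auto simp: dir_def)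
qed

lemma codim2_span: "w \<noteq> 0 \<Longrightarrow> codim2 (span {w})"
  by (simp add: codim2_def)

definition "through \<xi> \<tau> \<longleftrightarrow> nv \<tau> \<bullet> dir \<xi> = 0"

lemma through_iff:
  assumes "codim2 \<xi>" "\<tau> \<in> faces_of_dim 1 P"
  shows "\<xi> \<subseteq> zero_locus (l \<tau>) \<longleftrightarrow> through \<xi> \<tau>"
proof -
  have "zero_locus (l \<tau>) = {x. nv \<tau> \<bullet> x = 0}"
    by (simp add: zero_locus_def l_eq(1)[OF assms(2)] eval3_lin)
  moreover have "span {dir \<xi>} \<subseteq> {x. nv \<tau> \<bullet> x = 0} \<longleftrightarrow> nv \<tau> \<bullet> dir \<xi> = 0"
    using span_minimal[OF _ subspace_hyperplane, of "{dir \<xi>}" "nv \<tau>"] span_base[of "dir \<xi>" "{dir \<xi>}"] by auto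
  ultimately show ?thesis using dir(2)[OF assms(1)] by (simp add: through_def)
qed

abbreviation "graph_at \<xi> \<equiv> with_proj (xi_graph P l \<xi>)"

lemma parcs_iff:
  assumes "codim2 \<xi>"
  shows "(u, v) \<in> parcs (xi_graph P l \<xi>) \<longleftrightarrow> u \<in> Faces \<and> v \<in> Faces \<and> u \<noteq> v \<and>
    (\<exists>\<tau>. \<tau> edge_of u \<and> \<tau> edge_of v \<and> through \<xi> \<tau>)"
  using through_iff[OF assms] edge_in_P by (auto simp: xi_graph_def)

lemma pverts_iff:
  assumes "codim2 \<xi>"
  shows "u \<in> pverts (xi_graph P l \<xi>) \<longleftrightarrow> u \<in> Faces \<and> (\<exists>\<tau>. \<tau> edge_of u \<and> through \<xi> \<tau>)"
  using through_iff[OF assms] edge_in_P by (auto simp: xi_graph_def)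

lemma parcs_sym: "codim2 \<xi> \<Longrightarrow> (u, v) \<in> parcs (xi_graph P l \<xi>) \<Longrightarrow> (v, u) \<in> parcs (xi_graph P l \<xi>)"
  unfolding parcs_iff by blast

lemma sym_digraph_at:
  assumes "codim2 \<xi>"
  shows "sym_digraph (graph_at \<xi>)"
proof
  show "tail (graph_at \<xi>) a \<in> verts (graph_at \<xi>)" "head (graph_at \<xi>) a \<in> verts (graph_at \<xi>)"
    if "a \<in> arcs (graph_at \<xi>)" for a
  proof -
    obtain u v where a: "a = (u, v)" by (cases a)
    have "u \<in> pverts (xi_graph P l \<xi>)" "v \<in> pverts (xi_graph P l \<xi>)"
      using that unfolding a with_proj_simps parcs_iff[OF assms] pverts_iff[OF assms] by blast+
    then show "tail (graph_at \<xi>) a \<in> verts (graph_at \<xi>)" "head (graph_at \<xi>) a \<in> verts (graph_at \<xi>)"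
      by (simp_all add: a)
  qed
  show "symmetric (graph_at \<xi>)"
    unfolding symmetric_def with_proj_simps by (rule symI) (rule parcs_sym[OF assms])
qed

text \<open>By symmetry of the arcs, strongly connected components are closed under adjacency, so
  they behave as the connected components of an undirected graph.\<close>

lemma scc_facts:
  assumes \<xi>: "codim2 \<xi>" and \<psi>: "\<psi> \<in> pre_digraph.sccs (graph_at \<xi>)"
  shows "verts \<psi> \<subseteq> Faces" "verts \<psi> \<noteq> {}" "tail \<psi> = fst" "head \<psi> = snd"
    "arcs \<psi> = {(u, v) \<in> parcs (xi_graph P l \<xi>). u \<in> verts \<psi> \<and> v \<in> verts \<psi>}"
    "\<And>u v. u \<in> verts \<psi> \<Longrightarrow> v \<in> verts \<psi> \<Longrightarrow> (u, v) \<in> (arcs \<psi>)\<^sup>*"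
    "\<And>u v. u \<in> verts \<psi> \<Longrightarrow> (u, v) \<in> parcs (xi_graph P l \<xi>) \<Longrightarrow> v \<in> verts \<psi>"
proof -
  interpret sym_digraph "graph_at \<xi>" by (rule sym_digraph_at[OF \<xi>])
  have ind: "induced_subgraph \<psi> (graph_at \<xi>)" and sc: "strongly_connected \<psi>" using \<psi> by (auto simp: sccs_def)
  then have sub: "subgraph \<psi> (graph_at \<xi>)" by (simp add: induced_subgraph_def)
  then have "verts \<psi> \<subseteq> pverts (xi_graph P l \<xi>)" unfolding subgraph_def with_proj_simps by blast
  then show "verts \<psi> \<subseteq> Faces" using pverts_iff[OF \<xi>] by blast
  show "verts \<psi> \<noteq> {}" using sc by (simp add: strongly_connected_def)
  show t: "tail \<psi> = fst" "head \<psi> = snd" 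
    using sub unfolding subgraph_def compatible_def with_proj_simps by metis+
  show arcs: "arcs \<psi> = {(u, v) \<in> parcs (xi_graph P l \<xi>). u \<in> verts \<psi> \<and> v \<in> verts \<psi>}"
  proof -
    have "arcs \<psi> = {e \<in> parcs (xi_graph P l \<xi>). fst e \<in> verts \<psi> \<and> snd e \<in> verts \<psi>}"
      by (rule conjunct2[OF ind[unfolded induced_subgraph_def with_proj_simps]])
    then show ?thesis by (simp add: split_def)
  qed
  have "arcs_ends \<psi> = arcs \<psi>" by (simp add: arcs_ends_def arc_to_ends_def t)
  then show "(u, v) \<in> (arcs \<psi>)\<^sup>*" if "u \<in> verts \<psi>" "v \<in> verts \<psi>" for u v
    using sc that reachable_rtranclI[of \<psi> u v] by (auto simp: strongly_connected_def)
  show "v \<in> verts \<psi>" if u: "u \<in> verts \<psi>" and uv: "(u, v) \<in> parcs (xi_graph P l \<xi>)" for u v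
  proof (rule ccontr)
    assume v: "v \<notin> verts \<psi>"
    have "verts \<psi> \<in> sccs_verts" using \<psi> by (simp add: sccs_verts_conv)
    then have "\<not> u \<rightarrow>\<^sup>*\<^bsub>graph_at \<xi>\<^esub> v \<or> \<not> v \<rightarrow>\<^sup>*\<^bsub>graph_at \<xi>\<^esub> u" using u v by (simp add: sccs_verts_def)
    moreover have "u \<rightarrow>\<^sup>*\<^bsub>graph_at \<xi>\<^esub> v" using uv by (intro reachable_adjI) simp
    ultimately show False using symmetric_reachable' by blast
  qed
qed

lemma scc_exists:
  assumes \<xi>: "codim2 \<xi>" and u: "u \<in> pverts (xi_graph P l \<xi>)"
  obtains \<psi> where "\<psi> \<in> pre_digraph.sccs (graph_at \<xi>)" "u \<in> verts \<psi>"
proof -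
  interpret sym_digraph "graph_at \<xi>" by (rule sym_digraph_at[OF \<xi>])
  have "u \<rightarrow>\<^sup>*\<^bsub>graph_at \<xi>\<^esub> u" using u by (simp add: reachable_def)
  then have "u \<in> verts (graph_at \<xi> \<restriction> {v. u \<rightarrow>\<^sup>*\<^bsub>graph_at \<xi>\<^esub> v})" by simp
  then show thesis using induce_reachable_is_in_sccs[of u] u that by auto
qed

lemma scc_disjoint:
  assumes \<xi>: "codim2 \<xi>" and \<psi>: "\<psi> \<in> pre_digraph.sccs (graph_at \<xi>)" "\<psi>' \<in> pre_digraph.sccs (graph_at \<xi>)"
    and u: "u \<in> verts \<psi>" "u \<in> verts \<psi>'"
  shows "\<psi> = \<psi>'"
proof -
  interpret sym_digraph "graph_at \<xi>" by (rule sym_digraph_at[OF \<xi>])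
  have "verts \<psi> \<in> sccs_verts" "verts \<psi>' \<in> sccs_verts" using \<psi> by (auto simp: sccs_verts_conv)
  then have "verts \<psi> = verts \<psi>'" using sccs_verts_disjoint u by blast
  then show ?thesis using inj_on_verts_sccs \<psi> by (auto dest: inj_onD)
qed

lemma finite_sccs:
  assumes \<xi>: "codim2 \<xi>"
  shows "finite (pre_digraph.sccs (graph_at \<xi>))"
proof -
  interpret sym_digraph "graph_at \<xi>" by (rule sym_digraph_at[OF \<xi>])
  have "verts ` sccs \<subseteq> Pow Faces" using scc_facts(1)[OF \<xi>] by auto
  then have "finite (verts ` sccs)" using finite_Faces by (simp add: finite_subset)
  then show ?thesis using inj_on_verts_sccs by (rule finite_imageD)
qed

section \<open>Interior edges as edges of the graph at a point\<close>

definition "shared u v = (THE \<tau>. \<tau> edge_of u \<and> \<tau> edge_of v)"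

lemma shared_eq:
  assumes "u \<in> Faces" "v \<in> Faces" "u \<noteq> v" "\<tau> edge_of u" "\<tau> edge_of v"
  shows "shared u v = \<tau>"
  unfolding shared_def using assms shared_edge_unique[OF assms(1-3)] by (intro the_equality) auto

lemma shared_commute: "shared u v = shared v u"
  by (simp add: shared_def conj_commute)

definition "star_edges \<xi> \<sigma> = {\<tau> \<in> Edges. through \<xi> \<tau> \<and> (fa \<tau> = \<sigma> \<or> fb \<tau> = \<sigma>)}"

text \<open>Testing \<open>fa \<tau>\<close> suffices: an edge through \<xi> makes its two faces
  adjacent, so a component containing one contains the other.\<close>

definition "comp_edges \<xi> \<psi> = {\<tau> \<in> Edges. through \<xi> \<tau> \<and> fa \<tau> \<in> verts \<psi>}"

lemma parcs_shared:
  assumes "codim2 \<xi>" "(u, v) \<in> parcs (xi_graph P l \<xi>)"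
  shows "shared u v \<in> Edges" "through \<xi> (shared u v)" "shared u v edge_of u" "shared u v edge_of v"
    "{fa (shared u v), fb (shared u v)} = {u, v}"
proof -
  obtain \<tau> where \<tau>: "u \<in> Faces" "v \<in> Faces" "u \<noteq> v" "\<tau> edge_of u" "\<tau> edge_of v" "through \<xi> \<tau>"
    using assms(2) by (auto simp: parcs_iff[OF assms(1)])
  have s: "shared u v = \<tau>" using \<tau> by (intro shared_eq)
  show "shared u v \<in> Edges" "through \<xi> (shared u v)" "shared u v edge_of u" "shared u v edge_of v"
    using \<tau> shared_edge_interior(1)[OF \<tau>(1-5)] by (simp_all add: s)
  then show "{fa (shared u v), fb (shared u v)} = {u, v}"
    using ends(2) shared_edge_interior(2)[OF \<tau>(1-5)] by (simp add: s)
qed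

lemma edge_parcs:
  assumes "codim2 \<xi>" "\<tau> \<in> Edges" "through \<xi> \<tau>"
  shows "(fa \<tau>, fb \<tau>) \<in> parcs (xi_graph P l \<xi>)" "(fb \<tau>, fa \<tau>) \<in> parcs (xi_graph P l \<xi>)"
    "shared (fa \<tau>) (fb \<tau>) = \<tau>"
proof -
  note e = ends_edge[OF assms(2)] ends(1)[OF assms(2)]
  show ab: "(fa \<tau>, fb \<tau>) \<in> parcs (xi_graph P l \<xi>)"
    unfolding parcs_iff[OF assms(1)] using e assms(3) by blast
  then show "(fb \<tau>, fa \<tau>) \<in> parcs (xi_graph P l \<xi>)" by (rule parcs_sym[OF assms(1)])
  show "shared (fa \<tau>) (fb \<tau>) = \<tau>" using e by (intro shared_eq)
qed

lemma star_edges_comp: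
  assumes \<xi>: "codim2 \<xi>" and \<psi>: "\<psi> \<in> pre_digraph.sccs (graph_at \<xi>)" and u: "u \<in> verts \<psi>"
  shows "star_edges \<xi> u = {shared u v |v. (u, v) \<in> arcs \<psi>}"
proof
  note sf = scc_facts[OF \<xi> \<psi>]
  show "star_edges \<xi> u \<subseteq> {shared u v |v. (u, v) \<in> arcs \<psi>}"
  proof
    fix \<tau> assume "\<tau> \<in> star_edges \<xi> u"
    then have \<tau>: "\<tau> \<in> Edges" "through \<xi> \<tau>" "fa \<tau> = u \<or> fb \<tau> = u" by (auto simp: star_edges_def)
    note ep = edge_parcs[OF \<xi> \<tau>(1,2)]
    from \<tau>(3) show "\<tau> \<in> {shared u v |v. (u, v) \<in> arcs \<psi>}"
    proof
      assume "fa \<tau> = u"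
      then have "(u, fb \<tau>) \<in> arcs \<psi>" using ep(1) u sf(7)[of u "fb \<tau>"] by (auto simp: sf(5))
      then show ?thesis using ep(3) \<open>fa \<tau> = u\<close> by force
    next
      assume "fb \<tau> = u"
      then have "(u, fa \<tau>) \<in> arcs \<psi>" using ep(2) u sf(7)[of u "fa \<tau>"] by (auto simp: sf(5))
      then show ?thesis using ep(3) \<open>fb \<tau> = u\<close> by (force simp: shared_commute)
    qed
  qed
  show "{shared u v |v. (u, v) \<in> arcs \<psi>} \<subseteq> star_edges \<xi> u"
  proof clarify
    fix v assume "(u, v) \<in> arcs \<psi>"
    then have "(u, v) \<in> parcs (xi_graph P l \<xi>)" by (simp add: sf(5))
    note ps = parcs_shared[OF \<xi> this]
    then show "shared u v \<in> star_edges \<xi> u" by (auto simp: star_edges_def doubleton_eq_iff)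
  qed
qed

lemma comp_edges_eq:
  assumes \<xi>: "codim2 \<xi>" and \<psi>: "\<psi> \<in> pre_digraph.sccs (graph_at \<xi>)"
  shows "comp_edges \<xi> \<psi> = {shared u v |u v. (u, v) \<in> arcs \<psi>}"
proof
  note sf = scc_facts[OF \<xi> \<psi>]
  show "comp_edges \<xi> \<psi> \<subseteq> {shared u v |u v. (u, v) \<in> arcs \<psi>}"
  proof
    fix \<tau> assume "\<tau> \<in> comp_edges \<xi> \<psi>"
    then have "fa \<tau> \<in> verts \<psi>" "\<tau> \<in> star_edges \<xi> (fa \<tau>)" by (auto simp: comp_edges_def star_edges_def)
    then show "\<tau> \<in> {shared u v |u v. (u, v) \<in> arcs \<psi>}" using star_edges_comp[OF \<xi> \<psi>] by blast
  qed
  show "{shared u v |u v. (u, v) \<in> arcs \<psi>} \<subseteq> comp_edges \<xi> \<psi>"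
  proof clarify
    fix u v assume uv: "(u, v) \<in> arcs \<psi>"
    then have "(u, v) \<in> parcs (xi_graph P l \<xi>)" by (simp add: sf(5))
    note ps = parcs_shared[OF \<xi> this]
    then show "shared u v \<in> comp_edges \<xi> \<psi>" using uv by (auto simp: comp_edges_def doubleton_eq_iff sf(5))
  qed
qed

text \<open>Three neighbours of a face in the graph would give it three distinct edges on lines
  through \<xi>, which \<open>at_most_two_edges_through\<close> excludes.\<close>

lemma component_list:
  assumes \<xi>: "codim2 \<xi>" and \<psi>: "\<psi> \<in> pre_digraph.sccs (graph_at \<xi>)"
  obtains vs where "distinct vs" "set vs = verts \<psi>"
    "arcs \<psi> = (\<lambda>(i, j). (vs ! i, vs ! j)) ` path_arcs (length vs) \<or>
     3 \<le> length vs \<and> arcs \<psi> = (\<lambda>(i, j). (vs ! i, vs ! j)) ` cycle_arcs (length vs)"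
proof (rule degree_two_path_or_cycle[of "verts \<psi>" "arcs \<psi>"])
  note sf = scc_facts[OF \<xi> \<psi>]
  show finV: "finite (verts \<psi>)" using sf(1) finite_Faces finite_subset by blast
  show "verts \<psi> \<noteq> {}" by (rule sf(2))
  show sub: "arcs \<psi> \<subseteq> verts \<psi> \<times> verts \<psi>" by (auto simp: sf(5))
  show "sym (arcs \<psi>)" by (rule symI) (use parcs_sym[OF \<xi>] in \<open>auto simp: sf(5)\<close>)
  show "irrefl (arcs \<psi>)" by (auto simp: irrefl_def sf(5) parcs_iff[OF \<xi>])
  show "(u, v) \<in> (arcs \<psi>)\<^sup>*" if "u \<in> verts \<psi>" "v \<in> verts \<psi>" for u v using that by (rule sf(6))
  fix v assume v: "v \<in> verts \<psi>"
  show "card (arcs \<psi> `` {v}) \<le> 2"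
  proof (rule ccontr)
    assume "\<not> ?thesis"
    then have "3 \<le> card (arcs \<psi> `` {v})" by simp
    then obtain S where "S \<subseteq> arcs \<psi> `` {v}" "card S = 3" using obtain_subset_with_card_n by metis
    then obtain x y z where xyz: "(v, x) \<in> arcs \<psi>" "(v, y) \<in> arcs \<psi>" "(v, z) \<in> arcs \<psi>" and ne: "x \<noteq> y" "x \<noteq> z" "y \<noteq> z"
      by (auto simp: card_3_iff)
    have par: "(v, x) \<in> parcs (xi_graph P l \<xi>)" "(v, y) \<in> parcs (xi_graph P l \<xi>)" "(v, z) \<in> parcs (xi_graph P l \<xi>)"
      using xyz by (auto simp: sf(5))
    note p = parcs_shared[OF \<xi> par(1)] parcs_shared[OF \<xi> par(2)] parcs_shared[OF \<xi> par(3)]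
    have "shared v x \<noteq> shared v y" "shared v x \<noteq> shared v z" "shared v y \<noteq> shared v z"
      using p(5,10,15) ne by (metis doubleton_eq_iff)+
    then show False
      using at_most_two_edges_through[OF p(3,8,13) _ dir(1)[OF \<xi>]] p(2,7,12) v sf(1) by (auto simp: through_def)
  qed
qed

end

section \<open>The module of relations between the edges\<close>

locale spline_setting = spline_complex +
  fixes r :: nat
begin

text \<open>The image of the map from pairs of a face tuple f and edge multipliers g to edge tuples.
  An element of its kernel is a spline f together with the quotients g of its differences; its
  cokernel is what the cycles measure.\<close>

definition "relations = {x. \<exists>f g. x = (\<lambda>\<tau>. if \<tau> \<in> Edges then f (fa \<tau>) - f (fb \<tau>) - lin (nv \<tau>) ^ Suc r * g \<tau> else 0)}"

lemma relationsI: "(\<And>\<tau>. x \<tau> = (if \<tau> \<in> Edges then f (fa \<tau>) - f (fb \<tau>) - lin (nv \<tau>) ^ Suc r * g \<tau> else 0)) \<Longrightarrow> x \<in> relations"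
  unfolding relations_def by blast

lemma relationsE:
  assumes "x \<in> relations"
  obtains f g where "\<And>\<tau>. x \<tau> = (if \<tau> \<in> Edges then f (fa \<tau>) - f (fb \<tau>) - lin (nv \<tau>) ^ Suc r * g \<tau> else 0)"
  using assms unfolding relations_def by force

lemma relations_add: "x \<in> relations \<Longrightarrow> y \<in> relations \<Longrightarrow> x + y \<in> relations"
proof -
  assume "x \<in> relations" "y \<in> relations"
  then obtain f g f' g' where "\<And>\<tau>. x \<tau> = (if \<tau> \<in> Edges then f (fa \<tau>) - f (fb \<tau>) - lin (nv \<tau>) ^ Suc r * g \<tau> else 0)"
    "\<And>\<tau>. y \<tau> = (if \<tau> \<in> Edges then f' (fa \<tau>) - f' (fb \<tau>) - lin (nv \<tau>) ^ Suc r * g' \<tau> else 0)"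
    by (elim relationsE) blast
  then show ?thesis
    by (intro relationsI[of _ "\<lambda>\<sigma>. f \<sigma> + f' \<sigma>" "\<lambda>\<tau>. g \<tau> + g' \<tau>"]) (simp add: distrib_left del: power_Suc)
qed

lemma relations_mult: "x \<in> relations \<Longrightarrow> (\<lambda>\<tau>. p * x \<tau>) \<in> relations"
proof -
  assume "x \<in> relations"
  then obtain f g where x: "\<And>\<tau>. x \<tau> = (if \<tau> \<in> Edges then f (fa \<tau>) - f (fb \<tau>) - lin (nv \<tau>) ^ Suc r * g \<tau> else 0)"
    by (elim relationsE) blast
  show ?thesis
    by (rule relationsI[of _ "\<lambda>\<sigma>. p * f \<sigma>" "\<lambda>\<tau>. p * g \<tau>"])
      (simp add: x right_diff_distrib mult.left_commute del: power_Suc)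
qed

lemma relations_0: "0 \<in> relations"
  by (rule relationsI[of _ "\<lambda>_. 0" "\<lambda>_. 0"]) simp

lemma relations_uminus: "x \<in> relations \<Longrightarrow> - x \<in> relations"
  using relations_mult[of x "- 1"] by (simp add: fun_Compl_def)

lemma relations_diff: "x \<in> relations \<Longrightarrow> y \<in> relations \<Longrightarrow> x - y \<in> relations"
  using relations_add[of x "- y"] relations_uminus[of y] by simp

lemma relations_sum: "(\<And>i. i \<in> I \<Longrightarrow> f i \<in> relations) \<Longrightarrow> sum f I \<in> relations"
  by (induction I rule: infinite_finite_induct) (auto intro: relations_0 relations_add)

lemma relations_edge:
  assumes "\<tau> \<in> Edges"
  shows "single_at \<tau> (lin (nv \<tau>) ^ Suc r * p) \<in> relations"
  by (rule relationsI[of _ "\<lambda>_. 0" "single_at \<tau> (- p)"]) (use assms in \<open>auto simp: single_at_def\<close>)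

text \<open>The sign of the component at \<sigma> in the difference across \<tau>; meant for
  \<sigma> being one of the two ends.\<close>

definition "sgn_at \<sigma> \<tau> = (if fa \<tau> = \<sigma> then 1 else - 1 :: poly3)"

lemma sgn_at_square [simp]: "sgn_at \<sigma> \<tau> * sgn_at \<sigma> \<tau> = 1"
  by (simp add: sgn_at_def)

text \<open>These are the differences of the face tuple that is p at \<sigma> and 0
  elsewhere.\<close>

lemma relations_star: "(\<Sum>\<tau>\<in>{\<tau> \<in> Edges. fa \<tau> = \<sigma> \<or> fb \<tau> = \<sigma>}. single_at \<tau> (sgn_at \<sigma> \<tau> * p)) \<in> relations"
proof (rule relationsI[of _ "single_at \<sigma> p" "\<lambda>_. 0"])
  fix \<tau>
  have "(\<Sum>\<tau>\<in>{\<tau> \<in> Edges. fa \<tau> = \<sigma> \<or> fb \<tau> = \<sigma>}. single_at \<tau> (sgn_at \<sigma> \<tau> * p)) \<tau>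
     = (\<Sum>\<tau>'\<in>{\<tau> \<in> Edges. fa \<tau> = \<sigma> \<or> fb \<tau> = \<sigma>}. if \<tau>' = \<tau> then sgn_at \<sigma> \<tau> * p else 0)"
    unfolding sum_fun_apply by (intro sum.cong) (auto simp: single_at_def)
  also have "\<dots> = (if \<tau> \<in> Edges \<and> (fa \<tau> = \<sigma> \<or> fb \<tau> = \<sigma>) then sgn_at \<sigma> \<tau> * p else 0)"
    using finite_Edges by simp
  also have "\<dots> = (if \<tau> \<in> Edges then single_at \<sigma> p (fa \<tau>) - single_at \<sigma> p (fb \<tau>) - lin (nv \<tau>) ^ Suc r * 0 else 0)"
    using ends(1)[of \<tau>] by (auto simp: single_at_def sgn_at_def)
  finally show "(\<Sum>\<tau>\<in>{\<tau> \<in> Edges. fa \<tau> = \<sigma> \<or> fb \<tau> = \<sigma>}. single_at \<tau> (sgn_at \<sigma> \<tau> * p)) \<tau>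
     = (if \<tau> \<in> Edges then single_at \<sigma> p (fa \<tau>) - single_at \<sigma> p (fb \<tau>) - lin (nv \<tau>) ^ Suc r * 0 else 0)" .
qed

section \<open>Relations localized at a point\<close>

definition "away \<xi> = (\<Prod>\<tau>\<in>{\<tau> \<in> Edges. nv \<tau> \<bullet> dir \<xi> \<noteq> 0}. lin (nv \<tau>) ^ Suc r)"

lemma away_dvd:
  assumes "\<tau> \<in> Edges" "\<not> through \<xi> \<tau>"
  shows "lin (nv \<tau>) ^ Suc r dvd away \<xi>"
  unfolding away_def using assms finite_Edges by (intro dvd_prodI) (auto simp: through_def)

text \<open>The power of an edge missing \<xi> is a factor of \<open>away \<xi>\<close>, so after
  this multiplication only the edges through \<xi> carry information.\<close>

lemma away_kills:
  assumes "\<tau> \<in> Edges" "\<not> through \<xi> \<tau>"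
  shows "single_at \<tau> (away \<xi> * p) \<in> relations"
proof -
  obtain q where "away \<xi> = lin (nv \<tau>) ^ Suc r * q" using away_dvd[OF assms] by (auto simp: dvd_def)
  then show ?thesis using relations_edge[OF assms(1), of "q * p"] by (simp add: mult.assoc del: power_Suc)
qed

lemma relations_star_through:
  "(\<Sum>\<tau>\<in>star_edges \<xi> \<sigma>. single_at \<tau> (sgn_at \<sigma> \<tau> * (away \<xi> * p))) \<in> relations"
proof -
  let ?I = "{\<tau> \<in> Edges. fa \<tau> = \<sigma> \<or> fb \<tau> = \<sigma>}"
  let ?f = "\<lambda>\<tau>. single_at \<tau> (sgn_at \<sigma> \<tau> * (away \<xi> * p))"
  have sub: "star_edges \<xi> \<sigma> \<subseteq> ?I" and fin: "finite ?I" using finite_Edges by (auto simp: star_edges_def)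
  have "?f \<tau> \<in> relations" if "\<tau> \<in> ?I - star_edges \<xi> \<sigma>" for \<tau>
    using away_kills[of \<tau> \<xi> "sgn_at \<sigma> \<tau> * p"] that by (auto simp: star_edges_def mult.left_commute)
  then have "sum ?f (?I - star_edges \<xi> \<sigma>) \<in> relations" by (rule relations_sum)
  then have "sum ?f ?I - sum ?f (?I - star_edges \<xi> \<sigma>) \<in> relations"
    by (intro relations_diff relations_star)
  moreover have "sum ?f ?I = sum ?f (?I - star_edges \<xi> \<sigma>) + sum ?f (star_edges \<xi> \<sigma>)"
    by (rule sum.subset_diff[OF sub fin])
  ultimately show ?thesis by simp
qed

text \<open>Solves the star relation for one edge once the others are known; including
  \<open>sgn_at \<sigma> \<tau>\<close> in the multiplier cancels the sign.\<close>

lemma relations_star_solve: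
  assumes "\<tau> \<in> star_edges \<xi> \<sigma>"
    and "\<And>\<tau>' p. \<tau>' \<in> star_edges \<xi> \<sigma> - {\<tau>} \<Longrightarrow> single_at \<tau>' (away \<xi> * p) \<in> relations"
  shows "single_at \<tau> (away \<xi> * p) \<in> relations"
proof -
  let ?f = "\<lambda>\<tau>'. single_at \<tau>' (sgn_at \<sigma> \<tau>' * (away \<xi> * (sgn_at \<sigma> \<tau> * p)))"
  have fin: "finite (star_edges \<xi> \<sigma>)" using finite_Edges by (simp add: star_edges_def)
  have "?f \<tau>' \<in> relations" if "\<tau>' \<in> star_edges \<xi> \<sigma> - {\<tau>}" for \<tau>'
    using assms(2)[OF that, of "sgn_at \<sigma> \<tau>' * (sgn_at \<sigma> \<tau> * p)"] by (simp add: mult.left_commute)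
  then have "sum ?f (star_edges \<xi> \<sigma>) - sum ?f (star_edges \<xi> \<sigma> - {\<tau>}) \<in> relations"
    by (intro relations_diff relations_star_through relations_sum)
  then have "?f \<tau> \<in> relations" using sum.remove[OF fin assms(1), of ?f] by simp
  moreover have "sgn_at \<sigma> \<tau> * (away \<xi> * (sgn_at \<sigma> \<tau> * p)) = (sgn_at \<sigma> \<tau> * sgn_at \<sigma> \<tau>) * (away \<xi> * p)"
    by (simp only: mult_ac)
  ultimately show ?thesis by simp
qed

text \<open>The first vertex of the path has a single edge in its star, which is therefore a
  relation after multiplication by \<open>away \<xi>\<close>. Proceeding along the path, each
  further star has just one undetermined edge.\<close>

lemma path_component_relations:
  assumes \<xi>: "codim2 \<xi>" and \<psi>: "\<psi> \<in> pre_digraph.sccs (graph_at \<xi>)" "\<psi> \<notin> circle_components P l \<xi>"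
    and \<tau>: "\<tau> \<in> comp_edges \<xi> \<psi>"
  shows "single_at \<tau> (away \<xi> * p) \<in> relations"
proof -
  note sf = scc_facts[OF \<xi> \<psi>(1)]
  obtain vs where vs: "distinct vs" "set vs = verts \<psi>" and
    arcs: "arcs \<psi> = (\<lambda>(i, j). (vs ! i, vs ! j)) ` path_arcs (length vs) \<or>
     3 \<le> length vs \<and> arcs \<psi> = (\<lambda>(i, j). (vs ! i, vs ! j)) ` cycle_arcs (length vs)"
    using component_list[OF \<xi> \<psi>(1)] by blast
  have A: "arcs \<psi> = (\<lambda>(i, j). (vs ! i, vs ! j)) ` path_arcs (length vs)"
    using arcs cycle_realization_circle[OF vs(1) vs(2)[symmetric] _ _ sf(3,4)] \<psi> by (auto simp: circle_components_def)
  let ?N = "length vs"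
  have star: "star_edges \<xi> (vs ! i) = {shared (vs ! i) (vs ! j) |j. (i, j) \<in> path_arcs ?N}" if "i < ?N" for i
  proof -
    have "vs ! i \<in> verts \<psi>" using nth_mem[OF that] unfolding vs(2) .
    moreover have "(vs ! i, v) \<in> arcs \<psi> \<longleftrightarrow> (\<exists>j. (i, j) \<in> path_arcs ?N \<and> v = vs ! j)" for v
    proof
      assume "(vs ! i, v) \<in> arcs \<psi>"
      then obtain a b where ab: "(a, b) \<in> path_arcs ?N" "vs ! i = vs ! a" "v = vs ! b" unfolding A by auto
      then have "a < ?N" by (simp add: path_arcs_def)
      then have "i = a" using ab(2) that vs(1) by (simp add: nth_eq_iff_index_eq)
      then show "\<exists>j. (i, j) \<in> path_arcs ?N \<and> v = vs ! j" using ab by blast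
    next
      assume "\<exists>j. (i, j) \<in> path_arcs ?N \<and> v = vs ! j"
      then show "(vs ! i, v) \<in> arcs \<psi>" unfolding A by (auto intro: rev_image_eqI)
    qed
    ultimately show ?thesis using star_edges_comp[OF \<xi> \<psi>(1)] by auto
  qed
  have *: "Suc i < ?N \<Longrightarrow> single_at (shared (vs ! i) (vs ! Suc i)) (away \<xi> * p) \<in> relations" for i p
  proof (induction i arbitrary: p)
    case 0
    then have "star_edges \<xi> (vs ! 0) = {shared (vs ! 0) (vs ! Suc 0)}" by (subst star) (auto simp: path_arcs_def)
    then show ?case by (rule_tac relations_star_solve[of _ _ "vs ! 0"]) auto
  next
    case (Suc i)
    then have "star_edges \<xi> (vs ! Suc i) = {shared (vs ! Suc i) (vs ! i), shared (vs ! Suc i) (vs ! Suc (Suc i))}"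
      by (subst star) (auto simp: path_arcs_def)
    moreover have "single_at (shared (vs ! Suc i) (vs ! i)) (away \<xi> * p) \<in> relations" for p
      using Suc.IH[of p] Suc.prems by (simp add: shared_commute[of "vs ! Suc i"])
    ultimately show ?case by (rule_tac relations_star_solve[of _ _ "vs ! Suc i"]) auto
  qed
  obtain i j where "(i, j) \<in> path_arcs ?N" "\<tau> = shared (vs ! i) (vs ! j)"
    using \<tau> comp_edges_eq[OF \<xi> \<psi>(1)] A by auto
  then show ?thesis using * by (auto simp: path_arcs_def shared_commute)
qed

text \<open>\<epsilon> orients the edges along the cycle. Signed differences then telescope to 0,
  and the star relation at each vertex identifies the two edges meeting there, so all edges share
  one class. Consecutive edges bound a common polygon and hence are not parallel, so I_\<psi>
  involves two independent forms.\<close>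

lemma cycle_component_relations:
  assumes \<xi>: "codim2 \<xi>" and \<psi>: "\<psi> \<in> circle_components P l \<xi>"
  obtains \<epsilon> :: "(real^2) set \<Rightarrow> poly3" where
    "\<And>\<tau>. \<epsilon> \<tau> = 1 \<or> \<epsilon> \<tau> = - 1"
    "\<And>f :: (real^2) set \<Rightarrow> poly3. (\<Sum>\<tau>\<in>comp_edges \<xi> \<psi>. \<epsilon> \<tau> * (f (fa \<tau>) - f (fb \<tau>))) = 0"
    "\<And>\<tau> \<tau>' p. \<tau> \<in> comp_edges \<xi> \<psi> \<Longrightarrow> \<tau>' \<in> comp_edges \<xi> \<psi> \<Longrightarrow>
       single_at \<tau> (\<epsilon> \<tau> * (away \<xi> * p)) - single_at \<tau>' (\<epsilon> \<tau>' * (away \<xi> * p)) \<in> relations"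
    "\<exists>\<tau>\<in>comp_edges \<xi> \<psi>. \<exists>\<tau>'\<in>comp_edges \<xi> \<psi>. cross3 (nv \<tau>) (nv \<tau>') \<noteq> 0"
proof -
  have \<psi>s: "\<psi> \<in> pre_digraph.sccs (graph_at \<xi>)" using \<psi> by (simp add: circle_components_def)
  note sf = scc_facts[OF \<xi> \<psi>s]
  obtain vs where vs: "distinct vs" "set vs = verts \<psi>" and
    arcs: "arcs \<psi> = (\<lambda>(i, j). (vs ! i, vs ! j)) ` path_arcs (length vs) \<or>
     3 \<le> length vs \<and> arcs \<psi> = (\<lambda>(i, j). (vs ! i, vs ! j)) ` cycle_arcs (length vs)"
    using component_list[OF \<xi> \<psi>s] by blast
  have "vs \<noteq> []" using sf(2) vs(2) by auto
  then have A: "arcs \<psi> = (\<lambda>(i, j). (vs ! i, vs ! j)) ` cycle_arcs (length vs)" and N3: "3 \<le> length vs"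
    using arcs path_realization_not_circle[OF vs(1) vs(2)[symmetric] _ _ sf(3,4)] \<psi> by (auto simp: circle_components_def)
  define N where "N = length vs"
  \<comment> \<open>The cyclic successor: edge i of the cycle joins vertex i to vertex
    \<open>nx i\<close>.\<close>
  define nx where "nx i = Suc i mod N" for i
  have N: "3 \<le> N" using N3 by (simp add: N_def)
  have nx: "nx i < N" for i using N by (simp add: nx_def)
  have nx_cases: "nx i = Suc i \<and> Suc i < N \<or> nx i = 0 \<and> Suc i = N" if "i < N" for i
    using that by (auto simp: nx_def mod_Suc)
  \<comment> \<open>The second inequality rests on N \<ge> 3; it keeps the edges of the cycle
    distinct.\<close>
  have nx_ne: "nx i \<noteq> i" "nx (nx i) \<noteq> i" if "i < N" for i
    using nx_cases[OF that] nx_cases[OF nx, of i] N by auto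
  have nx_inj: "i = j" if "i < N" "j < N" "nx i = nx j" for i j
    using nx_cases[OF that(1)] nx_cases[OF that(2)] that(3) by auto
  have cyc: "cycle_arcs N = {(i, nx i) |i. i < N} \<union> {(nx i, i) |i. i < N}"
  proof
    show "cycle_arcs N \<subseteq> {(i, nx i) |i. i < N} \<union> {(nx i, i) |i. i < N}"
    proof
      fix x assume "x \<in> cycle_arcs N"
      then consider i where "x = (i, Suc i)" "Suc i < N" | i where "x = (Suc i, i)" "Suc i < N"
        | "x = (0, N - 1)" | "x = (N - 1, 0)"
        by (auto simp: cycle_arcs_def path_arcs_def)
      then show "x \<in> {(i, nx i) |i. i < N} \<union> {(nx i, i) |i. i < N}"
      proof cases
        case (1 i)
        then have "nx i = Suc i" by (simp add: nx_def)
        with 1 have "x = (i, nx i)" "i < N" by auto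
        then show ?thesis by blast
      next
        case (2 i)
        then have "nx i = Suc i" by (simp add: nx_def)
        with 2 have "x = (nx i, i)" "i < N" by auto
        then show ?thesis by blast
      next
        case 3
        then have "x = (nx (N - 1), N - 1)" "N - 1 < N" using N by (auto simp: nx_def)
        then show ?thesis by blast
      next
        case 4
        then have "x = (N - 1, nx (N - 1))" "N - 1 < N" using N by (auto simp: nx_def)
        then show ?thesis by blast
      qed
    qed
    have "(i, nx i) \<in> cycle_arcs N \<and> (nx i, i) \<in> cycle_arcs N" if "i < N" for i
      using nx_cases[OF that] N by (auto simp: cycle_arcs_def path_arcs_def)
    then show "{(i, nx i) |i. i < N} \<union> {(nx i, i) |i. i < N} \<subseteq> cycle_arcs N" by auto
  qed
  define t where "t i = shared (vs ! i) (vs ! nx i)" for i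
  have arcN: "(vs ! i, vs ! nx i) \<in> parcs (xi_graph P l \<xi>)" if "i < N" for i
  proof -
    have "(i, nx i) \<in> cycle_arcs N" using that cyc by blast
    then have "(vs ! i, vs ! nx i) \<in> arcs \<psi>" unfolding A N_def by force
    then show ?thesis by (simp add: sf(5))
  qed
  note tp = parcs_shared[OF \<xi> arcN, folded t_def]
  have eqv: "vs ! i = vs ! j \<longleftrightarrow> i = j" if "i < N" "j < N" for i j
    using that vs(1) by (simp add: N_def nth_eq_iff_index_eq)
  have t_inj: "i = j" if "i < N" "j < N" "t i = t j" for i j
  proof -
    have "{vs ! i, vs ! nx i} = {vs ! j, vs ! nx j}" using tp(5)[OF that(1)] tp(5)[OF that(2)] that(3) by simp
    then have "i = j \<or> i = nx j \<and> nx i = j" using eqv that nx by (auto simp: doubleton_eq_iff)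
    then show ?thesis using nx_ne that by auto
  qed
  have comp: "comp_edges \<xi> \<psi> = t ` {..<N}"
  proof -
    have "comp_edges \<xi> \<psi> = (\<lambda>(i, j). shared (vs ! i) (vs ! j)) ` cycle_arcs N"
      unfolding comp_edges_eq[OF \<xi> \<psi>s] A N_def by (fastforce simp: image_iff)
    also have "\<dots> = (\<lambda>i. shared (vs ! i) (vs ! nx i)) ` {..<N} \<union> (\<lambda>i. shared (vs ! nx i) (vs ! i)) ` {..<N}"
      unfolding cyc by (fastforce simp: image_iff)
    also have "\<dots> = t ` {..<N}"
      unfolding t_def by (simp only: shared_commute[of "vs ! nx _"] Un_absorb)
    finally show ?thesis .
  qed
  have star: "star_edges \<xi> (vs ! nx i) = {t i, t (nx i)}" if i: "i < N" for i
  proof -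
    have v: "vs ! nx i \<in> verts \<psi>" using nth_mem[OF nx[of i, unfolded N_def]] unfolding vs(2) .
    have "(vs ! nx i, v) \<in> arcs \<psi> \<longleftrightarrow> v = vs ! i \<or> v = vs ! nx (nx i)" for v
    proof
      assume "(vs ! nx i, v) \<in> arcs \<psi>"
      then obtain a b where ab: "(a, b) \<in> cycle_arcs N" "vs ! nx i = vs ! a" "v = vs ! b" unfolding A N_def by auto
      then have "a < N" "b < N" using nx cyc by auto
      then have "a = nx i" using eqv ab(2) nx by metis
      then show "v = vs ! i \<or> v = vs ! nx (nx i)" using ab cyc nx_inj[OF i] by auto
    next
      have "(nx i, i) \<in> cycle_arcs N" "(nx i, nx (nx i)) \<in> cycle_arcs N" using cyc i nx by auto
      then have "(vs ! nx i, vs ! i) \<in> arcs \<psi>" "(vs ! nx i, vs ! nx (nx i)) \<in> arcs \<psi>"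
        unfolding A N_def by force+
      then show "v = vs ! i \<or> v = vs ! nx (nx i) \<Longrightarrow> (vs ! nx i, v) \<in> arcs \<psi>" by auto
    qed
    then have "star_edges \<xi> (vs ! nx i) = {shared (vs ! nx i) (vs ! i), shared (vs ! nx i) (vs ! nx (nx i))}"
      unfolding star_edges_comp[OF \<xi> \<psi>s v] by auto
    then show ?thesis by (simp add: t_def shared_commute)
  qed
  define \<epsilon> where "\<epsilon> \<tau> = (if \<exists>i<N. \<tau> = t i \<and> fa \<tau> = vs ! i then 1 else - 1 :: poly3)" for \<tau>
  have \<epsilon>t: "\<epsilon> (t i) = sgn_at (vs ! i) (t i)" if "i < N" for i
    using that t_inj by (auto simp: \<epsilon>_def sgn_at_def)
  \<comment> \<open>Edge i enters the star of its far end with the opposite sign, which turns the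
    star relation there into a difference of consecutive edges.\<close>
  have \<epsilon>t': "sgn_at (vs ! nx i) (t i) = - \<epsilon> (t i)" if "i < N" for i
  proof -
    have "fa (t i) = vs ! i \<and> fb (t i) = vs ! nx i \<or> fa (t i) = vs ! nx i \<and> fb (t i) = vs ! i"
      using tp(5)[OF that] by (auto simp: doubleton_eq_iff)
    moreover have "vs ! i \<noteq> vs ! nx i" using eqv[OF that nx] nx_ne(1)[OF that] by metis
    ultimately show ?thesis unfolding \<epsilon>t[OF that] by (auto simp: sgn_at_def)
  qed
  show thesis
  proof
    show "\<epsilon> \<tau> = 1 \<or> \<epsilon> \<tau> = - 1" for \<tau> by (simp add: \<epsilon>_def)
    show "(\<Sum>\<tau>\<in>comp_edges \<xi> \<psi>. \<epsilon> \<tau> * (f (fa \<tau>) - f (fb \<tau>))) = 0" for f :: "(real^2) set \<Rightarrow> poly3"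
    proof -
      have "(\<Sum>\<tau>\<in>comp_edges \<xi> \<psi>. \<epsilon> \<tau> * (f (fa \<tau>) - f (fb \<tau>)))
          = (\<Sum>i<N. \<epsilon> (t i) * (f (fa (t i)) - f (fb (t i))))"
        unfolding comp using t_inj by (intro sum.reindex[unfolded o_def] inj_onI) auto
      also have "\<dots> = (\<Sum>i<N. f (vs ! i) - f (vs ! nx i))"
      proof (rule sum.cong[OF refl])
        fix i assume "i \<in> {..<N}"
        then have i: "i < N" by simp
        have "fa (t i) = vs ! i \<and> fb (t i) = vs ! nx i \<or> fa (t i) = vs ! nx i \<and> fb (t i) = vs ! i"
          using tp(5)[OF i] by (auto simp: doubleton_eq_iff)
        moreover have "vs ! i \<noteq> vs ! nx i" using eqv[OF i nx] nx_ne(1)[OF i] by metis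
        ultimately show "\<epsilon> (t i) * (f (fa (t i)) - f (fb (t i))) = f (vs ! i) - f (vs ! nx i)"
          unfolding \<epsilon>t[OF i] by (auto simp: sgn_at_def)
      qed
      also have "\<dots> = (\<Sum>i<N. f (vs ! i)) - (\<Sum>i<N. f (vs ! nx i))" by (rule sum_subtractf)
      also have "(\<Sum>i<N. f (vs ! nx i)) = (\<Sum>i<N. f (vs ! i))"
      proof -
        have "nx ` {..<N} = {..<N}"
          using nx nx_inj by (intro endo_inj_surj inj_onI) auto
        then show ?thesis
          using sum.reindex[of nx "{..<N}" "\<lambda>i. f (vs ! i)"] nx_inj by (simp add: inj_on_def o_def)
      qed
      finally show ?thesis by simp
    qed
    have step: "single_at (t i) (\<epsilon> (t i) * (away \<xi> * p)) - single_at (t (nx i)) (\<epsilon> (t (nx i)) * (away \<xi> * p)) \<in> relations"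
      if i: "i < N" for i p
    proof -
      have ne: "t i \<noteq> t (nx i)" using t_inj[OF i nx] nx_ne(1)[OF i] by metis
      have "single_at (t i) (sgn_at (vs ! nx i) (t i) * (away \<xi> * p))
         + single_at (t (nx i)) (sgn_at (vs ! nx i) (t (nx i)) * (away \<xi> * p)) \<in> relations"
        using relations_star_through[where \<xi>=\<xi> and \<sigma>="vs ! nx i" and p=p] ne unfolding star[OF i] by simp
      then have "single_at (t i) (- (\<epsilon> (t i) * (away \<xi> * p)))
         + single_at (t (nx i)) (\<epsilon> (t (nx i)) * (away \<xi> * p)) \<in> relations"
        unfolding \<epsilon>t'[OF i] \<epsilon>t[OF nx, symmetric] by simp
      moreover have "- (single_at a (- x) + single_at b y) = single_at a x - single_at b y" for a b :: "(real^2) set" and x y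
        by (rule ext) (simp add: single_at_def)
      ultimately show ?thesis by (metis relations_uminus)
    qed
    have from0: "single_at (t 0) (\<epsilon> (t 0) * (away \<xi> * p)) - single_at (t i) (\<epsilon> (t i) * (away \<xi> * p)) \<in> relations"
      if "i < N" for i p
      using that
    proof (induction i)
      case 0
      show ?case using relations_0 by (simp add: zero_fun_def)
    next
      case (Suc i)
      then have "nx i = Suc i" by (simp add: nx_def)
      moreover have "i < N" using Suc.prems by simp
      ultimately have "(single_at (t 0) (\<epsilon> (t 0) * (away \<xi> * p)) - single_at (t i) (\<epsilon> (t i) * (away \<xi> * p)))
         + (single_at (t i) (\<epsilon> (t i) * (away \<xi> * p)) - single_at (t (Suc i)) (\<epsilon> (t (Suc i)) * (away \<xi> * p))) \<in> relations"
        using relations_add[OF Suc.IH step[of i p]] by metis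
      then show ?case by (simp only: diff_add_cancel add_diff_eq)
    qed
    show "single_at \<tau> (\<epsilon> \<tau> * (away \<xi> * p)) - single_at \<tau>' (\<epsilon> \<tau>' * (away \<xi> * p)) \<in> relations"
      if ab: "\<tau> \<in> comp_edges \<xi> \<psi>" "\<tau>' \<in> comp_edges \<xi> \<psi>" for \<tau> \<tau>' p
    proof -
      obtain i j where ij: "i < N" "j < N" "\<tau> = t i" "\<tau>' = t j" using ab unfolding comp by blast
      show ?thesis using relations_diff[OF from0[OF ij(2), of p] from0[OF ij(1), of p]] by (simp add: ij)
    qed
    show "\<exists>\<tau>\<in>comp_edges \<xi> \<psi>. \<exists>\<tau>'\<in>comp_edges \<xi> \<psi>. cross3 (nv \<tau>) (nv \<tau>') \<noteq> 0"
    proof -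
      have 0: "0 < N" using N by simp
      have ne: "t 0 \<noteq> t (nx 0)" using t_inj[OF 0 nx] nx_ne(1)[OF 0] by metis
      have "vs ! nx 0 \<in> Faces" using nth_mem[OF nx[of 0, unfolded N_def]] sf(1) unfolding vs(2) by blast
      then have "cross3 (nv (t 0)) (nv (t (nx 0))) \<noteq> 0"
        using parallel_edges_eq[of "t 0" "vs ! nx 0" "t (nx 0)"] tp(4)[OF 0] tp(3)[OF nx, of 0] ne by blast
      then show ?thesis using comp 0 nx by blast
    qed
  qed
qed

end

section \<open>Graded pieces of free modules\<close>

text \<open>The degree may vary with the index because face components will have degree k and edge
  multipliers degree k - r - 1.\<close>

definition graded :: "'a set \<Rightarrow> ('a \<Rightarrow> nat) \<Rightarrow> ('a \<Rightarrow> poly3) set" where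
  "graded S d = {x. (\<forall>i. i \<notin> S \<longrightarrow> x i = 0) \<and> (\<forall>i\<in>S. homogeneous (d i) (x i))}"

lemma tuple_scale_single_at: "tuple_scale c (single_at i p) = single_at i (const3 c * p)"
  by (auto simp: tuple_scale_def single_at_def fun_eq_iff)

lemma tuple_scale_apply: "tuple_scale c x i = const3 c * x i"
  by (simp add: tuple_scale_def)

lemma subspace_graded: "tuple.subspace (graded S d)"
  by (auto simp: tuple.subspace_def graded_def tuple_scale_apply homogeneous_add homogeneous_const3_mult)

lemma graded_single_at: "i \<in> S \<Longrightarrow> homogeneous (d i) p \<Longrightarrow> single_at i p \<in> graded S d"
  by (auto simp: graded_def single_at_def)

lemma graded_expand:
  assumes "finite S" "x \<in> graded S d"
  shows "x = (\<Sum>i\<in>S. single_at i (x i))"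
proof
  fix j
  have "(\<Sum>i\<in>S. single_at i (x i)) j = (\<Sum>i\<in>S. if i = j then x j else 0)"
    unfolding sum_fun_apply by (intro sum.cong) (auto simp: single_at_def)
  then show "x j = (\<Sum>i\<in>S. single_at i (x i)) j"
    using assms by (auto simp: graded_def)
qed

lemma graded_finite_span:
  assumes "finite S"
  shows "\<exists>T. finite T \<and> graded S d \<subseteq> tuple.span T"
proof -
  obtain T where T: "\<And>k. finite (T k)" "\<And>k. {p. homogeneous k p} \<subseteq> p3.span (T k)"
    using forms_finite_span by metis
  let ?T = "\<Union>i\<in>S. single_at i ` T (d i)"
  have single: "single_at i p \<in> tuple.span ?T" if "i \<in> S" "p \<in> p3.span (T (d i))" for i p
    using that(2)
  proof (induction rule: p3.span_induct_alt)
    case base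
    show ?case using tuple.span_zero[of ?T] by (simp add: zero_fun_def)
  next
    case (step c x y)
    have eq: "single_at i (const3 c * x + y) = tuple_scale c (single_at i x) + single_at i y"
      by (simp add: single_at_add tuple_scale_single_at)
    have "single_at i x \<in> ?T" using step that(1) by blast
    then have "tuple_scale c (single_at i x) \<in> tuple.span ?T" by (intro tuple.span_scale tuple.span_base)
    then show ?case unfolding eq using step(2) by (rule tuple.span_add)
  qed
  have "x \<in> tuple.span ?T" if x: "x \<in> graded S d" for x
  proof -
    have "(\<Sum>i\<in>S. single_at i (x i)) \<in> tuple.span ?T"
      using x T(2) by (intro tuple.span_sum single) (auto simp: graded_def)
    then show ?thesis using graded_expand[OF assms x] by simp
  qed
  then show ?thesis using assms T(1) by (intro exI[of _ ?T]) auto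
qed

text \<open>A basis of the forms at a new index complements the tuples on the previous ones.\<close>

lemma dim_graded:
  assumes "finite S"
  shows "tuple.dim (graded S d) = (\<Sum>i\<in>S. p3.dim {p. homogeneous (d i) p})"
  using assms
proof (induction S)
  case empty
  have "graded {} d = tuple.span ((\<lambda>_. 0) ` ({} :: nat set))" by (auto simp: graded_def)
  then show ?case using tuple.dim_family[of "{} :: nat set" "\<lambda>_. 0"] by simp
next
  case (insert i S)
  obtain T where T: "finite T" "graded (insert i S) d \<subseteq> tuple.span T"
    using graded_finite_span[of "insert i S"] insert.hyps by blast
  obtain T' where T': "finite T'" "{p. homogeneous (d i) p} \<subseteq> p3.span T'" using forms_finite_span by blast
  obtain B where B: "B \<subseteq> {p. homogeneous (d i) p}" "p3.independent B" "{p. homogeneous (d i) p} \<subseteq> p3.span B"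
    "card B = p3.dim {p. homogeneous (d i) p}"
    using p3.basis_exists by blast
  have finB: "finite B" using p3.independent_span_bound[OF T'(1) B(2)] B(1) T'(2) by blast
  have sc: "(\<Sum>b\<in>B. tuple_scale (c b) (single_at i b)) = single_at i (\<Sum>b\<in>B. const3 (c b) * b)" for c
    by (simp add: tuple_scale_single_at single_at_sum)
  have "tuple.dim (graded (insert i S) d) = tuple.dim (graded S d) + card B"
  proof (rule tuple.dim_mod_family[OF subspace_graded subspace_graded T])
    show "graded S d \<subseteq> graded (insert i S) d" by (auto simp: graded_def)
    show "finite B" by (rule finB)
    show "single_at i b \<in> graded (insert i S) d" if "b \<in> B" for b using that B(1) by (intro graded_single_at) auto
    show "\<exists>c. x - (\<Sum>b\<in>B. tuple_scale (c b) (single_at i b)) \<in> graded S d" if x: "x \<in> graded (insert i S) d" for x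
    proof -
      have "x i \<in> p3.span B" using x B(3) by (auto simp: graded_def)
      then obtain c where c: "x i = (\<Sum>b\<in>B. const3 (c b) * b)" by (auto simp: p3.span_finite[OF finB])
      have "x - single_at i (x i) \<in> graded S d"
        using x insert.hyps(2) by (auto simp: graded_def single_at_def)
      then show ?thesis by (intro exI[of _ c]) (simp add: sc c)
    qed
    show "\<forall>b\<in>B. c b = 0" if "(\<Sum>b\<in>B. tuple_scale (c b) (single_at i b)) \<in> graded S d" for c
    proof -
      have "(\<Sum>b\<in>B. const3 (c b) * b) = 0"
        using that insert.hyps(2) unfolding sc by (auto simp: graded_def single_at_def split: if_splits)
      then show ?thesis using p3.independentD[OF B(2) finB order_refl, of c] by blast
    qed
  qed
  then show ?case using insert B(4) by simp
qed

lemma dim_homogeneous: "p3.dim {p. homogeneous k p} = (\<Sum>j\<le>k. Suc j)"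
proof -
  interpret linear_coordinates "axis 1 1" "axis 2 1" "axis 3 1"
    by unfold_locales (simp add: cross3_def inner_vec_def sum_3 axis_def)
  show ?thesis by (rule dim_forms)
qed

interpretation tuple_pair: vector_space_pair "tuple_scale :: real \<Rightarrow> ('a \<Rightarrow> poly3) \<Rightarrow> _" "tuple_scale :: real \<Rightarrow> ('b \<Rightarrow> poly3) \<Rightarrow> _"
  by unfold_locales

section \<open>Splines as the kernel of the relation map\<close>

context spline_setting begin

text \<open>A pair (f, g) is coded as one function on sets: faces and edges differ in dimension, so
  x can be f on the former and g on the latter.\<close>

definition "rel_map x = (\<lambda>\<tau>. if \<tau> \<in> Edges then x (fa \<tau>) - x (fb \<tau>) - lin (nv \<tau>) ^ Suc r * x \<tau> else 0)"

definition "restrict_faces x = (\<lambda>\<sigma>. if \<sigma> \<in> Faces then x \<sigma> else 0 :: poly3)"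

lemma linear_rel_map: "Vector_Spaces.linear tuple_scale tuple_scale rel_map"
  by unfold_locales
    (auto simp: rel_map_def fun_eq_iff tuple_scale_apply distrib_left right_diff_distrib mult.left_commute
      simp del: power_Suc)

lemma linear_restrict_faces: "Vector_Spaces.linear tuple_scale tuple_scale restrict_faces"
  by unfold_locales (auto simp: restrict_faces_def fun_eq_iff tuple_scale_apply)

lemma Faces_Edges_disjoint: "Faces \<inter> Edges = {}"
  by (auto simp: interior_edges_def faces_of_dim_def)

abbreviation "pairs k \<equiv> graded (Faces \<union> Edges) (\<lambda>i. if i \<in> Faces then k else k - Suc r)"

abbreviation "edge_tuples k \<equiv> graded Edges (\<lambda>_. k)"

lemma pairsD:
  assumes "x \<in> pairs k"
  shows "\<sigma> \<in> Faces \<Longrightarrow> homogeneous k (x \<sigma>)" "\<tau> \<in> Edges \<Longrightarrow> homogeneous (k - Suc r) (x \<tau>)"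
    "i \<notin> Faces \<Longrightarrow> i \<notin> Edges \<Longrightarrow> x i = 0"
  using assms Faces_Edges_disjoint by (auto simp: graded_def split: if_splits)

lemma homogeneous_edge_mult:
  "Suc r \<le> k \<Longrightarrow> homogeneous (k - Suc r) p \<Longrightarrow> homogeneous k (lin (nv \<tau>) ^ Suc r * p)"
  using homogeneous_mult[OF homogeneous_lin_power, of "k - Suc r" p "Suc r" "nv \<tau>"] by (simp del: power_Suc)

lemma hpart_edge_mult:
  "Suc r \<le> k \<Longrightarrow> hpart k (lin (nv \<tau>) ^ Suc r * p) = lin (nv \<tau>) ^ Suc r * hpart (k - Suc r) p"
  using hpart_mult[OF homogeneous_lin_power, of "k - Suc r" "Suc r" "nv \<tau>" p] by (simp del: power_Suc)

text \<open>A relation of degree k may arise from inhomogeneous f and g, but their parts of degrees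
  k and k - r - 1 produce it as well. The bound on k keeps the second degree untruncated.\<close>

lemma rel_map_image:
  assumes k: "Suc r \<le> k"
  shows "rel_map ` pairs k = relations \<inter> edge_tuples k"
proof
  show "rel_map ` pairs k \<subseteq> relations \<inter> edge_tuples k"
  proof clarify
    fix x assume x: "x \<in> pairs k"
    have "rel_map x \<in> relations" by (rule relationsI[of _ x x]) (simp add: rel_map_def)
    moreover have "homogeneous k (x (fa \<tau>) - x (fb \<tau>) - lin (nv \<tau>) ^ Suc r * x \<tau>)" if "\<tau> \<in> Edges" for \<tau>
      using that pairsD[OF x] ends_edge[OF that] k by (intro homogeneous_diff homogeneous_edge_mult) auto
    then have "rel_map x \<in> edge_tuples k" by (auto simp: graded_def rel_map_def)
    ultimately show "rel_map x \<in> relations \<inter> edge_tuples k" by blast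
  qed
  show "relations \<inter> edge_tuples k \<subseteq> rel_map ` pairs k"
  proof
    fix x assume "x \<in> relations \<inter> edge_tuples k"
    then have x: "x \<in> relations" "x \<in> edge_tuples k" by auto
    obtain f g where fg: "\<And>\<tau>. x \<tau> = (if \<tau> \<in> Edges then f (fa \<tau>) - f (fb \<tau>) - lin (nv \<tau>) ^ Suc r * g \<tau> else 0)"
      using x(1) by (elim relationsE) blast
    define y where "y i = (if i \<in> Faces then hpart k (f i) else if i \<in> Edges then hpart (k - Suc r) (g i) else 0)" for i
    have "y \<in> pairs k" by (auto simp: graded_def y_def)
    moreover have "rel_map y = x"
    proof
      fix \<tau>
      show "rel_map y \<tau> = x \<tau>"
      proof (cases "\<tau> \<in> Edges")
        case True
        have "x \<tau> = hpart k (x \<tau>)" using x(2) True hpart_homogeneous[of k "x \<tau>" k] by (simp add: graded_def)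
        also have "\<dots> = hpart k (f (fa \<tau>)) - hpart k (f (fb \<tau>)) - lin (nv \<tau>) ^ Suc r * hpart (k - Suc r) (g \<tau>)"
          using True k by (simp add: fg hpart_diff hpart_edge_mult del: power_Suc)
        also have "\<dots> = rel_map y \<tau>"
          using True ends_edge[OF True] Faces_Edges_disjoint by (auto simp: rel_map_def y_def)
        finally show ?thesis ..
      qed (simp add: rel_map_def fg)
    qed
    ultimately show "x \<in> rel_map ` pairs k" by blast
  qed
qed

text \<open>For a spline f, g is the tuple of quotients witnessing the divisibilities, cut down to
  its part of degree k - r - 1.\<close>

lemma restrict_faces_kernel:
  assumes k: "Suc r \<le> k"
  shows "restrict_faces ` {x \<in> pairs k. rel_map x = 0} = splines_deg r P l k"
proof
  show "restrict_faces ` {x \<in> pairs k. rel_map x = 0} \<subseteq> splines_deg r P l k"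
  proof clarify
    fix x assume x: "x \<in> pairs k" "rel_map x = 0"
    have "x (fa \<tau>) - x (fb \<tau>) = lin (nv \<tau>) ^ Suc r * x \<tau>" if "\<tau> \<in> Edges" for \<tau>
      using fun_cong[OF x(2), of \<tau>] that by (simp add: rel_map_def del: power_Suc)
    then have "restrict_faces x \<in> splines r P l"
      unfolding splines_iff using ends_edge by (auto simp: restrict_faces_def simp del: power_Suc)
    then show "restrict_faces x \<in> splines_deg r P l k"
      using pairsD(1)[OF x(1)] by (auto simp: splines_deg_def restrict_faces_def)
  qed
  show "splines_deg r P l k \<subseteq> restrict_faces ` {x \<in> pairs k. rel_map x = 0}"
  proof
    fix f assume "f \<in> splines_deg r P l k"
    then have f: "\<And>\<sigma>. \<sigma> \<notin> Faces \<Longrightarrow> f \<sigma> = 0" "\<And>\<tau>. \<tau> \<in> Edges \<Longrightarrow> lin (nv \<tau>) ^ Suc r dvd f (fa \<tau>) - f (fb \<tau>)"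
      "\<And>\<sigma>. homogeneous k (f \<sigma>)"
      unfolding splines_deg_def splines_iff by auto
    have "\<exists>g. f (fa \<tau>) - f (fb \<tau>) = lin (nv \<tau>) ^ Suc r * g" if "\<tau> \<in> Edges" for \<tau>
      using f(2)[OF that] by (auto simp: dvd_def)
    then obtain g where g: "\<And>\<tau>. \<tau> \<in> Edges \<Longrightarrow> f (fa \<tau>) - f (fb \<tau>) = lin (nv \<tau>) ^ Suc r * g \<tau>" by metis
    define y where "y i = (if i \<in> Faces then f i else if i \<in> Edges then hpart (k - Suc r) (g i) else 0)" for i
    have "y \<in> pairs k" using f(3) by (auto simp: graded_def y_def)
    moreover have "rel_map y = 0"
    proof
      fix \<tau>
      show "rel_map y \<tau> = 0 \<tau>"
      proof (cases "\<tau> \<in> Edges")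
        case True
        have "lin (nv \<tau>) ^ Suc r * hpart (k - Suc r) (g \<tau>) = hpart k (f (fa \<tau>) - f (fb \<tau>))"
          using g[OF True] hpart_edge_mult[OF k] by simp
        also have "\<dots> = f (fa \<tau>) - f (fb \<tau>)" using f(3) by (simp add: hpart_diff hpart_homogeneous[of k])
        finally show ?thesis
          using True ends_edge[OF True] Faces_Edges_disjoint by (auto simp: rel_map_def y_def simp del: power_Suc)
      qed (simp add: rel_map_def)
    qed
    moreover have "restrict_faces y = f" using f(1) by (auto simp: restrict_faces_def y_def)
    ultimately show "f \<in> restrict_faces ` {x \<in> pairs k. rel_map x = 0}" by blast
  qed
qed

text \<open>Rank-nullity twice: for the relation map, and for forgetting g, which is injective on
  the kernel because the edge powers are nonzerodivisors.\<close>

lemma spline_dim_relations: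
  assumes k: "Suc r \<le> k"
  shows "spline_dim r P l k + tuple.dim (relations \<inter> edge_tuples k)
    = card Faces * (\<Sum>j\<le>k. Suc j) + card Edges * (\<Sum>j\<le>k - Suc r. Suc j)"
proof -
  let ?K = "{x \<in> pairs k. rel_map x = 0}"
  have fin: "finite (Faces \<union> Edges)" using finite_Faces finite_Edges by simp
  obtain T where T: "finite T" "pairs k \<subseteq> tuple.span T" using graded_finite_span[OF fin] by blast
  have subK: "tuple.subspace ?K"
  proof -
    interpret rm: Vector_Spaces.linear tuple_scale tuple_scale rel_map by (rule linear_rel_map)
    show ?thesis using subspace_graded[of "Faces \<union> Edges"]
      by (auto simp: tuple.subspace_def rm.add rm.scale rm.zero)
  qed
  have "tuple.dim (pairs k) = tuple.dim ?K + tuple.dim (rel_map ` pairs k)"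
    by (rule tuple_pair.rank_nullity[OF linear_rel_map subspace_graded T])
  moreover have "tuple.dim ?K = tuple.dim {x \<in> ?K. restrict_faces x = 0} + tuple.dim (restrict_faces ` ?K)"
    using T by (intro tuple_pair.rank_nullity[OF linear_restrict_faces subK T(1)]) auto
  moreover have "{x \<in> ?K. restrict_faces x = 0} = graded {} (\<lambda>_. 0)"
  proof
    show "{x \<in> ?K. restrict_faces x = 0} \<subseteq> graded {} (\<lambda>_. 0)"
    proof clarify
      fix x assume x: "x \<in> pairs k" "rel_map x = 0" "restrict_faces x = 0"
      have face0: "x \<sigma> = 0" if "\<sigma> \<in> Faces" for \<sigma>
        using fun_cong[OF x(3), of \<sigma>] that by (simp add: restrict_faces_def)
      have "x \<tau> = 0" if E: "\<tau> \<in> Edges" for \<tau>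
      proof -
        have "lin (nv \<tau>) ^ Suc r * x \<tau> = 0"
          using fun_cong[OF x(2), of \<tau>] E ends_edge[OF E] face0 by (simp add: rel_map_def del: power_Suc)
        then show ?thesis using l_eq(2)[OF Edges_dim1[OF E]] by (simp add: lin_eq_0_iff)
      qed
      then have "x i = 0" for i using face0 pairsD(3)[OF x(1)] by blast
      then show "x \<in> graded {} (\<lambda>_. 0)" by (simp add: graded_def)
    qed
    show "graded {} (\<lambda>_. 0) \<subseteq> {x \<in> ?K. restrict_faces x = 0}"
      by (auto simp: graded_def rel_map_def restrict_faces_def fun_eq_iff)
  qed
  moreover have "tuple.dim (graded ({} :: (real^2) set set) (\<lambda>_. 0)) = 0" by (simp add: dim_graded)
  moreover have "tuple.dim (pairs k) = card Faces * (\<Sum>j\<le>k. Suc j) + card Edges * (\<Sum>j\<le>k - Suc r. Suc j)"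
  proof -
    have "tuple.dim (pairs k) = (\<Sum>i\<in>Faces \<union> Edges. \<Sum>j\<le>(if i \<in> Faces then k else k - Suc r). Suc j)"
      by (simp only: dim_graded[OF fin] dim_homogeneous)
    also have "\<dots> = (\<Sum>i\<in>Faces. \<Sum>j\<le>(if i \<in> Faces then k else k - Suc r). Suc j)
        + (\<Sum>i\<in>Edges. \<Sum>j\<le>(if i \<in> Faces then k else k - Suc r). Suc j)"
      by (rule sum.union_disjoint[OF finite_Faces finite_Edges Faces_Edges_disjoint])
    also have "(\<Sum>i\<in>Faces. \<Sum>j\<le>(if i \<in> Faces then k else k - Suc r). Suc j) = (\<Sum>i\<in>Faces. \<Sum>j\<le>k. Suc j)"
      by (rule sum.cong) auto
    also have "(\<Sum>i\<in>Edges. \<Sum>j\<le>(if i \<in> Faces then k else k - Suc r). Suc j) = (\<Sum>i\<in>Edges. \<Sum>j\<le>k - Suc r. Suc j)"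
      using Faces_Edges_disjoint by (intro sum.cong) auto
    finally show ?thesis by (simp only: sum_constant of_nat_id)
  qed
  ultimately show ?thesis
    unfolding spline_dim_def rel_map_image[OF k] restrict_faces_kernel[OF k] by simp
qed

section \<open>Counting modulo the relations\<close>

lemma through_span:
  assumes "w \<noteq> 0" "nv \<tau> \<bullet> w = 0"
  shows "through (span {w}) \<tau>"
proof -
  have "dir (span {w}) \<in> span {w}"
    using dir(2)[OF codim2_span[OF assms(1)]] span_base[of "dir (span {w})" "{dir (span {w})}"] by auto
  then show ?thesis using assms(2) by (auto simp: through_def span_singleton)
qed

text \<open>The direction of \<xi> is orthogonal to both normals, hence along their cross product:
  two nonparallel edge lines determine the point.\<close>

lemma codim2_eq_span_cross:
  assumes \<xi>: "codim2 \<xi>" and \<tau>: "through \<xi> \<tau>" "through \<xi> \<tau>'" "cross3 (nv \<tau>) (nv \<tau>') \<noteq> 0"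
  shows "\<xi> = span {cross3 (nv \<tau>) (nv \<tau>')}"
proof -
  let ?w = "dir \<xi>" and ?N = "cross3 (nv \<tau>) (nv \<tau>')"
  have par: "(?w \<bullet> ?w) *\<^sub>R ?N = (?w \<bullet> ?N) *\<^sub>R ?w"
    using \<tau> by (intro cross3_orthogonal_parallel) (auto simp: through_def)
  have "?w \<bullet> ?w \<noteq> 0" using dir(1)[OF \<xi>] by simp
  then have "?N = ((?w \<bullet> ?N) / (?w \<bullet> ?w)) *\<^sub>R ?w"
    using arg_cong[OF par, of "\<lambda>x. inverse (?w \<bullet> ?w) *\<^sub>R x"] by (simp add: divide_inverse mult.commute)
  then have "?N \<in> span {?w}" by (metis span_base span_scale singletonI)
  then have "span {?N} \<subseteq> span {?w}" by (intro span_minimal) auto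
  then have "span {?N} = span {?w}"
    using \<tau>(3) dir(1)[OF \<xi>] by (intro subspace_dim_equal) auto
  then show ?thesis using dir(2)[OF \<xi>] by simp
qed

definition "some_normal \<tau> = (SOME w. w \<noteq> 0 \<and> nv \<tau> \<bullet> w = 0)"

lemma some_normal: "some_normal \<tau> \<noteq> 0" "nv \<tau> \<bullet> some_normal \<tau> = 0"
proof -
  have "\<exists>w. w \<noteq> 0 \<and> n \<bullet> w = 0" for n :: "real^3"
  proof (cases "n $ 1 = 0 \<and> n $ 2 = 0")
    case True
    then show ?thesis by (intro exI[of _ "axis 1 1"]) (simp add: inner_axis)
  next
    case False
    then show ?thesis
      by (intro exI[of _ "vector [- n $ 2, n $ 1, 0]"]) (auto simp: inner_vec_def sum_3 vec_eq_iff forall_3)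
  qed
  from someI_ex[OF this[of "nv \<tau>"]] show "some_normal \<tau> \<noteq> 0" "nv \<tau> \<bullet> some_normal \<tau> = 0"
    by (auto simp: some_normal_def)
qed

text \<open>The second family ensures at least one point on every edge line.\<close>

definition "points = (\<lambda>(\<tau>, \<tau>'). span {cross3 (nv \<tau>) (nv \<tau>')}) ` {(\<tau>, \<tau>'). \<tau> \<in> Edges \<and> \<tau>' \<in> Edges \<and> cross3 (nv \<tau>) (nv \<tau>') \<noteq> 0}
   \<union> (\<lambda>\<tau>. span {some_normal \<tau>}) ` Edges"

lemma finite_points: "finite points"
proof -
  have "finite {(\<tau>, \<tau>'). \<tau> \<in> Edges \<and> \<tau>' \<in> Edges \<and> cross3 (nv \<tau>) (nv \<tau>') \<noteq> 0}"
    by (rule finite_subset[of _ "Edges \<times> Edges"]) (use finite_Edges in auto)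
  then show ?thesis using finite_Edges by (simp add: points_def)
qed

lemma points_codim2: "\<xi> \<in> points \<Longrightarrow> codim2 \<xi>"
  using codim2_span some_normal by (auto simp: points_def)

lemma point_on_line: "\<tau> \<in> Edges \<Longrightarrow> \<exists>\<xi>\<in>points. through \<xi> \<tau>"
  using through_span[OF some_normal] by (auto simp: points_def)

lemma point_meet:
  assumes "\<tau> \<in> Edges" "\<tau>' \<in> Edges" "cross3 (nv \<tau>) (nv \<tau>') \<noteq> 0"
  shows "span {cross3 (nv \<tau>) (nv \<tau>')} \<in> points" "through (span {cross3 (nv \<tau>) (nv \<tau>')}) \<tau>"
    "through (span {cross3 (nv \<tau>) (nv \<tau>')}) \<tau>'"
  using assms by (auto simp: points_def dot_cross_self intro!: through_span)

lemma points_distinct: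
  assumes "codim2 \<xi>" "codim2 \<xi>'" "\<xi> \<noteq> \<xi>'"
  shows "cross3 (dir \<xi>) (dir \<xi>') \<noteq> 0"
proof
  assume "cross3 (dir \<xi>) (dir \<xi>') = 0"
  then have "dir \<xi> = ((dir \<xi> \<bullet> dir \<xi>') / (dir \<xi>' \<bullet> dir \<xi>')) *\<^sub>R dir \<xi>'"
    using dir(1)[OF assms(2)] by (rule cross3_eq_0_scale)
  then have "dir \<xi> \<in> span {dir \<xi>'}" by (metis span_base span_scale singletonI)
  then have "span {dir \<xi>} \<subseteq> span {dir \<xi>'}" by (intro span_minimal) auto
  then have "span {dir \<xi>} = span {dir \<xi>'}"
    using dir(1)[OF assms(1)] dir(1)[OF assms(2)] by (intro subspace_dim_equal) auto
  then show False using dir(2)[OF assms(1)] dir(2)[OF assms(2)] assms(3) by simp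
qed

text \<open>Serves as a partition of unity in large degree: modulo the edge power, every form placed
  at \<tau> is a sum of multiples of \<open>away \<xi>\<close> over the points of its line, so the
  count reduces to single points.\<close>

lemma cofinite_edge:
  assumes \<tau>: "\<tau> \<in> Edges"
  shows "cofinite_ideal (insert (lin (nv \<tau>) ^ Suc r) (away ` {\<xi> \<in> points. through \<xi> \<tau>}))"
proof -
  have away: "away = (\<lambda>\<xi>. \<Prod>\<tau>\<in>{\<tau> \<in> Edges. nv \<tau> \<bullet> dir \<xi> \<noteq> 0}. lin (nv \<tau>) ^ Suc r)"
    by (rule ext) (rule away_def)
  show ?thesis
    unfolding away
  proof (rule cofinite_ideal_points[OF finite_Edges])
    show "{\<xi> \<in> points. through \<xi> \<tau>} \<noteq> {}" using point_on_line[OF \<tau>] by blast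
    show "nv \<tau> \<bullet> dir \<xi> = 0" if "\<xi> \<in> {\<xi> \<in> points. through \<xi> \<tau>}" for \<xi> using that by (simp add: through_def)
    show "cross3 (dir \<xi>) (dir \<xi>') \<noteq> 0"
      if "\<xi> \<in> {\<xi> \<in> points. through \<xi> \<tau>}" "\<xi>' \<in> {\<xi> \<in> points. through \<xi> \<tau>}" "\<xi> \<noteq> \<xi>'" for \<xi> \<xi>'
      using that points_codim2 by (intro points_distinct) auto
    show "nv \<tau>' \<bullet> dir \<xi> = 0" if par: "cross3 (nv \<tau>') (nv \<tau>) = 0" "\<xi> \<in> {\<xi> \<in> points. through \<xi> \<tau>}" for \<tau>' \<xi>
    proof -
      obtain c where "nv \<tau>' = c *\<^sub>R nv \<tau>"
        using cross3_eq_0_scale[OF par(1) l_eq(2)[OF Edges_dim1[OF \<tau>]]] by blast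
      then show ?thesis using par(2) by (simp add: through_def)
    qed
    show "\<exists>\<xi>\<in>{\<xi> \<in> points. through \<xi> \<tau>}. nv \<tau>' \<bullet> dir \<xi> = 0" if "\<tau>' \<in> Edges" "cross3 (nv \<tau>') (nv \<tau>) \<noteq> 0" for \<tau>'
      using point_meet[OF that(1) \<tau> that(2)] by (auto simp: through_def)
  qed
qed

section \<open>Cycles and their local ideals\<close>

definition "away_degree \<xi> = (\<Sum>\<tau>\<in>{\<tau> \<in> Edges. nv \<tau> \<bullet> dir \<xi> \<noteq> 0}. Suc r)"

lemma homogeneous_away: "homogeneous (away_degree \<xi>) (away \<xi>)"
  unfolding away_def away_degree_def by (intro homogeneous_prod homogeneous_lin_power)

definition "cycles = {(\<xi>, \<psi>). codim2 \<xi> \<and> \<psi> \<in> circle_components P l \<xi>}"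

definition "local_ideal \<xi> \<psi> = ideal_gen ((\<lambda>n. lin n ^ Suc r) ` nv ` comp_edges \<xi> \<psi>)"

lemma circle_scc: "\<psi> \<in> circle_components P l \<xi> \<Longrightarrow> \<psi> \<in> pre_digraph.sccs (graph_at \<xi>)"
  by (simp add: circle_components_def)

lemma finite_comp_edges: "finite (comp_edges \<xi> \<psi>)"
  using finite_Edges by (simp add: comp_edges_def)

lemma local_ideal_generator: "\<tau> \<in> comp_edges \<xi> \<psi> \<Longrightarrow> lin (nv \<tau>) ^ Suc r \<in> local_ideal \<xi> \<psi>"
  unfolding local_ideal_def by (intro ideal_base imageI)

text \<open>An interior edge lying on both ends of an arc has these two faces as its own ends, so
  arcs and \<open>comp_edges\<close> name the same edges.\<close>

lemma psi_ideal_eq: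
  assumes \<xi>: "codim2 \<xi>" and \<psi>: "\<psi> \<in> circle_components P l \<xi>"
  shows "psi_ideal r P l \<xi> \<psi> = local_ideal \<xi> \<psi>"
proof -
  note sf = scc_facts[OF \<xi> circle_scc[OF \<psi>]]
  have comp: "\<tau> \<in> comp_edges \<xi> \<psi> \<longleftrightarrow> \<tau> \<in> Edges \<and>
      (\<exists>(\<sigma>1, \<sigma>2)\<in>arcs \<psi>. \<tau> edge_of \<sigma>1 \<and> \<tau> edge_of \<sigma>2 \<and> \<xi> \<subseteq> zero_locus (l \<tau>))" for \<tau>
  proof
    assume t: "\<tau> \<in> comp_edges \<xi> \<psi>"
    then have E: "\<tau> \<in> Edges" "through \<xi> \<tau>" "fa \<tau> \<in> verts \<psi>" by (auto simp: comp_edges_def)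
    have "(fa \<tau>, fb \<tau>) \<in> arcs \<psi>"
      using edge_parcs(1)[OF \<xi> E(1,2)] E(3) sf(7)[of "fa \<tau>" "fb \<tau>"] by (simp add: sf(5))
    moreover have "\<xi> \<subseteq> zero_locus (l \<tau>)" using through_iff[OF \<xi> Edges_dim1[OF E(1)]] E(2) by simp
    ultimately show "\<tau> \<in> Edges \<and> (\<exists>(\<sigma>1, \<sigma>2)\<in>arcs \<psi>. \<tau> edge_of \<sigma>1 \<and> \<tau> edge_of \<sigma>2 \<and> \<xi> \<subseteq> zero_locus (l \<tau>))"
      using E(1) ends_edge[OF E(1)] by blast
  next
    assume "\<tau> \<in> Edges \<and> (\<exists>(\<sigma>1, \<sigma>2)\<in>arcs \<psi>. \<tau> edge_of \<sigma>1 \<and> \<tau> edge_of \<sigma>2 \<and> \<xi> \<subseteq> zero_locus (l \<tau>))"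
    then obtain \<sigma>1 \<sigma>2 where E: "\<tau> \<in> Edges" and a: "(\<sigma>1, \<sigma>2) \<in> arcs \<psi>" "\<tau> edge_of \<sigma>1" "\<tau> edge_of \<sigma>2" "\<xi> \<subseteq> zero_locus (l \<tau>)"
      by blast
    have p: "(\<sigma>1, \<sigma>2) \<in> parcs (xi_graph P l \<xi>)" "\<sigma>1 \<in> verts \<psi>" "\<sigma>2 \<in> verts \<psi>" using a(1) by (auto simp: sf(5))
    then have "\<sigma>1 \<in> Faces" "\<sigma>2 \<in> Faces" "\<sigma>1 \<noteq> \<sigma>2" unfolding parcs_iff[OF \<xi>] by blast+
    then have "fa \<tau> = \<sigma>1 \<or> fa \<tau> = \<sigma>2" using edge_of_iff_end[OF E] a(2,3) by metis
    then have "fa \<tau> \<in> verts \<psi>" using p by blast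
    then show "\<tau> \<in> comp_edges \<xi> \<psi>" using E through_iff[OF \<xi> Edges_dim1[OF E]] a(4) by (simp add: comp_edges_def)
  qed
  have "{l \<tau> ^ (r + 1) |\<tau>. \<tau> \<in> Edges \<and>
        (\<exists>(\<sigma>1, \<sigma>2)\<in>arcs \<psi>. \<tau> edge_of \<sigma>1 \<and> \<tau> edge_of \<sigma>2 \<and> \<xi> \<subseteq> zero_locus (l \<tau>))}
     = {l \<tau> ^ (r + 1) |\<tau>. \<tau> \<in> comp_edges \<xi> \<psi>}"
    using comp by blast
  also have "\<dots> = (\<lambda>n. lin n ^ Suc r) ` nv ` comp_edges \<xi> \<psi>"
  proof -
    have "l \<tau> ^ (r + 1) = lin (nv \<tau>) ^ Suc r" if "\<tau> \<in> comp_edges \<xi> \<psi>" for \<tau>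
      using l_eq(1)[OF Edges_dim1, of \<tau>] that by (simp add: comp_edges_def)
    then have "(\<lambda>\<tau>. l \<tau> ^ (r + 1)) ` comp_edges \<xi> \<psi> = (\<lambda>\<tau>. lin (nv \<tau>) ^ Suc r) ` comp_edges \<xi> \<psi>"
      by (intro image_cong refl)
    moreover have "{l \<tau> ^ (r + 1) |\<tau>. \<tau> \<in> comp_edges \<xi> \<psi>} = (\<lambda>\<tau>. l \<tau> ^ (r + 1)) ` comp_edges \<xi> \<psi>"
      by blast
    ultimately show ?thesis by (simp only: image_image)
  qed
  finally show ?thesis unfolding psi_ideal_def local_ideal_def by simp
qed

lemma local_codimension:
  assumes "(\<xi>, \<psi>) \<in> cycles"
  shows "\<exists>K. \<forall>k\<ge>K. real (p3.dim {p. homogeneous k p})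
     = real (p3.dim {p \<in> local_ideal \<xi> \<psi>. homogeneous k p}) + c_const r (min_gens (local_ideal \<xi> \<psi>))"
proof -
  have \<xi>: "codim2 \<xi>" and \<psi>: "\<psi> \<in> circle_components P l \<xi>" using assms by (auto simp: cycles_def)
  obtain \<tau> \<tau>' where t: "\<tau> \<in> comp_edges \<xi> \<psi>" "\<tau>' \<in> comp_edges \<xi> \<psi>" "cross3 (nv \<tau>) (nv \<tau>') \<noteq> 0"
    using cycle_component_relations[OF \<xi> \<psi>] by metis
  show ?thesis
    unfolding local_ideal_def
  proof (rule codim_powers_of_normals[where w="dir \<xi>" and ?n0.0="nv \<tau>" and ?n1.0="nv \<tau>'"])
    show "finite (nv ` comp_edges \<xi> \<psi>)" by (intro finite_imageI finite_comp_edges)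
    show "n \<bullet> dir \<xi> = 0" if "n \<in> nv ` comp_edges \<xi> \<psi>" for n
      using that by (auto simp: comp_edges_def through_def)
    show "0 \<notin> nv ` comp_edges \<xi> \<psi>" using l_eq(2)[OF Edges_dim1] by (auto simp: comp_edges_def)
  qed (use t dir(1)[OF \<xi>] in auto)
qed

text \<open>A cycle contains two nonparallel edges, so \<xi> is one of the finitely many meeting
  points.\<close>

lemma cycles_points:
  assumes "(\<xi>, \<psi>) \<in> cycles"
  shows "\<xi> \<in> points"
proof -
  have \<xi>: "codim2 \<xi>" and \<psi>: "\<psi> \<in> circle_components P l \<xi>" using assms by (auto simp: cycles_def)
  obtain \<tau> \<tau>' where t: "\<tau> \<in> comp_edges \<xi> \<psi>" "\<tau>' \<in> comp_edges \<xi> \<psi>" "cross3 (nv \<tau>) (nv \<tau>') \<noteq> 0"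
    using cycle_component_relations[OF \<xi> \<psi>] by metis
  then have "\<xi> = span {cross3 (nv \<tau>) (nv \<tau>')}"
    by (intro codim2_eq_span_cross[OF \<xi>]) (auto simp: comp_edges_def)
  then show ?thesis using point_meet(1)[of \<tau> \<tau>'] t by (auto simp: comp_edges_def)
qed

lemma finite_cycles: "finite cycles"
proof (rule finite_subset)
  show "cycles \<subseteq> Sigma points (\<lambda>\<xi>. circle_components P l \<xi>)"
    using cycles_points by (auto simp: cycles_def)
  show "finite (Sigma points (\<lambda>\<xi>. circle_components P l \<xi>))"
  proof (intro finite_SigmaI finite_points)
    fix \<xi> assume "\<xi> \<in> points"
    then show "finite (circle_components P l \<xi>)"
      using finite_sccs[OF points_codim2] by (auto simp: circle_components_def)
  qed
qed

text \<open>Of two nonparallel edges of the cycle at least one misses \<eta>, and its power divides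
  \<open>away \<eta>\<close>. Contributions of other points are thus invisible modulo
  I_\<psi>.\<close>

lemma away_in_local_ideal:
  assumes "(\<xi>, \<psi>) \<in> cycles" "codim2 \<eta>" "\<eta> \<noteq> \<xi>"
  shows "away \<eta> \<in> local_ideal \<xi> \<psi>"
proof -
  have \<xi>: "codim2 \<xi>" and \<psi>: "\<psi> \<in> circle_components P l \<xi>" using assms by (auto simp: cycles_def)
  obtain \<tau> \<tau>' where t: "\<tau> \<in> comp_edges \<xi> \<psi>" "\<tau>' \<in> comp_edges \<xi> \<psi>" "cross3 (nv \<tau>) (nv \<tau>') \<noteq> 0"
    using cycle_component_relations[OF \<xi> \<psi>] by metis
  have "\<not> through \<eta> \<tau> \<or> \<not> through \<eta> \<tau>'"
  proof (rule ccontr)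
    assume "\<not> ?thesis"
    then have "\<eta> = span {cross3 (nv \<tau>) (nv \<tau>')}" using t(3) by (intro codim2_eq_span_cross[OF assms(2)]) auto
    moreover have "\<xi> = span {cross3 (nv \<tau>) (nv \<tau>')}"
      using t by (intro codim2_eq_span_cross[OF \<xi>]) (auto simp: comp_edges_def)
    ultimately show False using assms(3) by simp
  qed
  then obtain \<tau>'' where t'': "\<tau>'' \<in> comp_edges \<xi> \<psi>" "\<not> through \<eta> \<tau>''" using t by blast
  then have "lin (nv \<tau>'') ^ Suc r dvd away \<eta>" by (intro away_dvd) (auto simp: comp_edges_def)
  then obtain q where "away \<eta> = lin (nv \<tau>'') ^ Suc r * q" by (auto simp: dvd_def)
  then have "away \<eta> = q * lin (nv \<tau>'') ^ Suc r" by (simp only: mult.commute)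
  then show ?thesis using ideal_mult[OF local_ideal_generator[OF t''(1), unfolded local_ideal_def]]
    unfolding local_ideal_def by (simp del: power_Suc)
qed

lemma away_cancel:
  assumes "codim2 \<xi>" "away \<xi> * f \<in> local_ideal \<xi> \<psi>"
  shows "f \<in> local_ideal \<xi> \<psi>"
  using assms(2) unfolding local_ideal_def away_def
  by (rule ideal_powers_cancel_prod[rotated -1, where w="dir \<xi>"])
    (use finite_comp_edges finite_Edges in \<open>auto simp: comp_edges_def through_def\<close>)

text \<open>The signed sum cancels the differences and leaves multiples of the edge powers. It thus
  induces a map from the cokernel to R / I_\<psi>, which detects independence.\<close>

lemma relations_component_sum:
  assumes "\<And>f :: (real^2) set \<Rightarrow> poly3. (\<Sum>\<tau>\<in>comp_edges \<xi> \<psi>. \<epsilon> \<tau> * (f (fa \<tau>) - f (fb \<tau>))) = 0"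
    and x: "x \<in> relations"
  shows "(\<Sum>\<tau>\<in>comp_edges \<xi> \<psi>. \<epsilon> \<tau> * x \<tau>) \<in> local_ideal \<xi> \<psi>"
proof -
  obtain f g where fg: "\<And>\<tau>. x \<tau> = (if \<tau> \<in> Edges then f (fa \<tau>) - f (fb \<tau>) - lin (nv \<tau>) ^ Suc r * g \<tau> else 0)"
    using x by (elim relationsE) blast
  have "(\<Sum>\<tau>\<in>comp_edges \<xi> \<psi>. \<epsilon> \<tau> * x \<tau>)
      = (\<Sum>\<tau>\<in>comp_edges \<xi> \<psi>. \<epsilon> \<tau> * (f (fa \<tau>) - f (fb \<tau>)) - (\<epsilon> \<tau> * g \<tau>) * lin (nv \<tau>) ^ Suc r)"
    by (intro sum.cong refl) (simp add: fg comp_edges_def right_diff_distrib mult_ac del: power_Suc)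
  also have "\<dots> = - (\<Sum>\<tau>\<in>comp_edges \<xi> \<psi>. (\<epsilon> \<tau> * g \<tau>) * lin (nv \<tau>) ^ Suc r)"
    using assms(1)[of f] by (simp add: sum_subtractf del: power_Suc)
  also have "\<dots> = (\<Sum>\<tau>\<in>comp_edges \<xi> \<psi>. (- (\<epsilon> \<tau> * g \<tau>)) * lin (nv \<tau>) ^ Suc r)"
    by (simp only: mult_minus_left sum_negf)
  also have "\<dots> \<in> local_ideal \<xi> \<psi>"
    unfolding local_ideal_def by (intro ideal_sum ideal_mult ideal_base imageI)
  finally show ?thesis .
qed

text \<open>S represents a basis of R / I_\<psi> in degree k; for large k its size is the
  multiplicity c_\<psi>.\<close>

lemma local_complement:
  assumes "(\<xi>, \<psi>) \<in> cycles"
  shows "\<exists>K. \<forall>k\<ge>K. \<exists>S. finite S \<and> S \<subseteq> {p. homogeneous k p} \<and> real (card S) = c_const r (min_gens (local_ideal \<xi> \<psi>)) \<and>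
    (\<forall>p. homogeneous k p \<longrightarrow> (\<exists>c. p - (\<Sum>s\<in>S. const3 (c s) * s) \<in> local_ideal \<xi> \<psi>)) \<and>
    (\<forall>c. (\<Sum>s\<in>S. const3 (c s) * s) \<in> local_ideal \<xi> \<psi> \<longrightarrow> (\<forall>s\<in>S. c s = 0))"
proof -
  let ?I = "local_ideal \<xi> \<psi>"
  obtain K where K: "\<And>k. K \<le> k \<Longrightarrow> real (p3.dim {p. homogeneous k p})
     = real (p3.dim {p \<in> ?I. homogeneous k p}) + c_const r (min_gens ?I)"
    using local_codimension[OF assms] by blast
  show ?thesis
  proof (intro exI[of _ K] allI impI)
    fix k assume k: "K \<le> k"
    obtain T where T: "finite T" "{p. homogeneous k p} \<subseteq> p3.span T" using forms_finite_span by blast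
    have sub: "p3.subspace {p \<in> ?I. homogeneous k p}" unfolding local_ideal_def by (rule subspace_ideal_part)
    obtain S where S: "finite S" "S \<subseteq> {p. homogeneous k p}"
      "card S + p3.dim {p \<in> ?I. homogeneous k p} = p3.dim {p. homogeneous k p}"
      "\<And>v. v \<in> {p. homogeneous k p} \<Longrightarrow> \<exists>c. v - (\<Sum>s\<in>S. const3 (c s) * s) \<in> {p \<in> ?I. homogeneous k p}"
      "\<And>c. (\<Sum>s\<in>S. const3 (c s) * s) \<in> {p \<in> ?I. homogeneous k p} \<Longrightarrow> \<forall>s\<in>S. c s = 0"
      using p3.complement_family[OF sub subspace_homogeneous T] by blast
    have "homogeneous k (\<Sum>s\<in>S. const3 (c s) * s)" for c
      using S(2) by (intro homogeneous_sum homogeneous_const3_mult) auto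
    then have ind: "\<forall>c. (\<Sum>s\<in>S. const3 (c s) * s) \<in> ?I \<longrightarrow> (\<forall>s\<in>S. c s = 0)" using S(5) by blast
    have span: "\<forall>p. homogeneous k p \<longrightarrow> (\<exists>c. p - (\<Sum>s\<in>S. const3 (c s) * s) \<in> ?I)" using S(4) by blast
    have "real (card S) = c_const r (min_gens ?I)" using K[OF k] S(3) by linarith
    then show "\<exists>S. finite S \<and> S \<subseteq> {p. homogeneous k p} \<and> real (card S) = c_const r (min_gens ?I) \<and>
      (\<forall>p. homogeneous k p \<longrightarrow> (\<exists>c. p - (\<Sum>s\<in>S. const3 (c s) * s) \<in> ?I)) \<and>
      (\<forall>c. (\<Sum>s\<in>S. const3 (c s) * s) \<in> ?I \<longrightarrow> (\<forall>s\<in>S. c s = 0))"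
      using S(1,2) span ind by blast
  qed
qed

text \<open>
  Away from the point \<open>\<xi>\<close> the product \<open>away \<xi>\<close> trivializes the module of relations; near \<open>\<xi>\<close> only the
  circles survive, each contributing the quotient by its local ideal.
\<close>

lemma dim_edge_tuples:
  "\<exists>K. \<forall>k\<ge>K. real (tuple.dim (edge_tuples k))
     = real (tuple.dim (relations \<inter> edge_tuples k)) + (\<Sum>(\<xi>, \<psi>)\<in>cycles. c_const r (min_gens (local_ideal \<xi> \<psi>)))"
proof -
  let ?C = "\<lambda>z. c_const r (min_gens (local_ideal (fst z) (snd z)))"
  have "\<forall>\<tau>\<in>Edges. \<exists>K. \<forall>k\<ge>K. \<forall>p. homogeneous k p \<longrightarrow> p \<in> ideal_gen (insert (lin (nv \<tau>) ^ Suc r) (away ` {\<xi> \<in> points. through \<xi> \<tau>}))"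
    by (intro ballI, rule cofinite_idealD[OF cofinite_edge], assumption) blast
  from bchoice[OF this] obtain K1 where K1: "\<And>\<tau> k p. \<tau> \<in> Edges \<Longrightarrow> K1 \<tau> \<le> k \<Longrightarrow> homogeneous k p \<Longrightarrow>
      p \<in> ideal_gen (insert (lin (nv \<tau>) ^ Suc r) (away ` {\<xi> \<in> points. through \<xi> \<tau>}))"
    by blast
  have "\<forall>z\<in>cycles. \<exists>K. \<forall>k\<ge>K. \<exists>S. finite S \<and> S \<subseteq> {p. homogeneous k p} \<and> real (card S) = ?C z \<and>
    (\<forall>p. homogeneous k p \<longrightarrow> (\<exists>c. p - (\<Sum>s\<in>S. const3 (c s) * s) \<in> local_ideal (fst z) (snd z))) \<and>
    (\<forall>c. (\<Sum>s\<in>S. const3 (c s) * s) \<in> local_ideal (fst z) (snd z) \<longrightarrow> (\<forall>s\<in>S. c s = 0))"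
    by (intro ballI local_complement) simp
  from bchoice[OF this] obtain K2 where K2: "\<And>z k. z \<in> cycles \<Longrightarrow> K2 z \<le> k \<Longrightarrow> \<exists>S. finite S \<and> S \<subseteq> {p. homogeneous k p} \<and> real (card S) = ?C z \<and>
    (\<forall>p. homogeneous k p \<longrightarrow> (\<exists>c. p - (\<Sum>s\<in>S. const3 (c s) * s) \<in> local_ideal (fst z) (snd z))) \<and>
    (\<forall>c. (\<Sum>s\<in>S. const3 (c s) * s) \<in> local_ideal (fst z) (snd z) \<longrightarrow> (\<forall>s\<in>S. c s = 0))"
    by blast
  \<comment> \<open>The representatives live in degree k - \<open>away_degree \<xi>\<close>, so the
    bounds \<open>K2\<close> have to be met after that shift. Sums serve as common upper
    bounds.\<close>
  define M where "M = Suc r + sum K1 Edges + (\<Sum>z\<in>cycles. K2 z + away_degree (fst z)) + sum away_degree points"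
  show ?thesis
  proof (intro exI[of _ M] allI impI)
    fix k assume k: "M \<le> k"
    have kr: "Suc r \<le> k" using k by (simp add: M_def)
    have kK1: "K1 \<tau> \<le> k" if "\<tau> \<in> Edges" for \<tau>
      using member_le_sum[OF that, of K1] finite_Edges k by (simp add: M_def)
    have kK2: "K2 z \<le> k - away_degree (fst z)" if "z \<in> cycles" for z
      using member_le_sum[OF that, of "\<lambda>z. K2 z + away_degree (fst z)"] finite_cycles k by (simp add: M_def)
    have kd: "away_degree \<xi> \<le> k" if "\<xi> \<in> points" for \<xi>
      using member_le_sum[OF that, of away_degree] finite_points k by (simp add: M_def)
    let ?U = "relations \<inter> edge_tuples k" and ?d = "\<lambda>z. k - away_degree (fst z)"
    have "\<forall>z\<in>cycles. \<exists>S. finite S \<and> S \<subseteq> {p. homogeneous (?d z) p} \<and> real (card S) = ?C z \<and>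
      (\<forall>p. homogeneous (?d z) p \<longrightarrow> (\<exists>c. p - (\<Sum>s\<in>S. const3 (c s) * s) \<in> local_ideal (fst z) (snd z))) \<and>
      (\<forall>c. (\<Sum>s\<in>S. const3 (c s) * s) \<in> local_ideal (fst z) (snd z) \<longrightarrow> (\<forall>s\<in>S. c s = 0))"
      using K2[OF _ kK2] by blast
    from bchoice[OF this] obtain S where S_all: "\<forall>z\<in>cycles. finite (S z) \<and> S z \<subseteq> {p. homogeneous (?d z) p} \<and> real (card (S z)) = ?C z \<and>
      (\<forall>p. homogeneous (?d z) p \<longrightarrow> (\<exists>c. p - (\<Sum>s\<in>S z. const3 (c s) * s) \<in> local_ideal (fst z) (snd z))) \<and>
      (\<forall>c. (\<Sum>s\<in>S z. const3 (c s) * s) \<in> local_ideal (fst z) (snd z) \<longrightarrow> (\<forall>s\<in>S z. c s = 0))" ..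
    have S: "finite (S z)" "\<And>s. s \<in> S z \<Longrightarrow> homogeneous (?d z) s" "real (card (S z)) = ?C z"
      "\<And>p. homogeneous (?d z) p \<Longrightarrow> \<exists>c. p - (\<Sum>s\<in>S z. const3 (c s) * s) \<in> local_ideal (fst z) (snd z)"
      "\<And>c. (\<Sum>s\<in>S z. const3 (c s) * s) \<in> local_ideal (fst z) (snd z) \<Longrightarrow> \<forall>s\<in>S z. c s = 0" if "z \<in> cycles" for z
      using bspec[OF S_all that] by simp_all blast+
    have "\<forall>z\<in>cycles. \<exists>\<epsilon>. (\<forall>\<tau>. \<epsilon> \<tau> = 1 \<or> \<epsilon> \<tau> = (- 1 :: poly3)) \<and>
      (\<forall>f :: (real^2) set \<Rightarrow> poly3. (\<Sum>\<tau>\<in>comp_edges (fst z) (snd z). \<epsilon> \<tau> * (f (fa \<tau>) - f (fb \<tau>))) = 0) \<and>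
      (\<forall>\<tau>\<in>comp_edges (fst z) (snd z). \<forall>\<tau>'\<in>comp_edges (fst z) (snd z). \<forall>p.
         single_at \<tau> (\<epsilon> \<tau> * (away (fst z) * p)) - single_at \<tau>' (\<epsilon> \<tau>' * (away (fst z) * p)) \<in> relations) \<and>
      comp_edges (fst z) (snd z) \<noteq> {}"
    proof
      fix z assume "z \<in> cycles"
      then have z: "codim2 (fst z)" "snd z \<in> circle_components P l (fst z)" by (auto simp: cycles_def)
      show "\<exists>\<epsilon>. (\<forall>\<tau>. \<epsilon> \<tau> = 1 \<or> \<epsilon> \<tau> = (- 1 :: poly3)) \<and>
        (\<forall>f :: (real^2) set \<Rightarrow> poly3. (\<Sum>\<tau>\<in>comp_edges (fst z) (snd z). \<epsilon> \<tau> * (f (fa \<tau>) - f (fb \<tau>))) = 0) \<and>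
        (\<forall>\<tau>\<in>comp_edges (fst z) (snd z). \<forall>\<tau>'\<in>comp_edges (fst z) (snd z). \<forall>p.
           single_at \<tau> (\<epsilon> \<tau> * (away (fst z) * p)) - single_at \<tau>' (\<epsilon> \<tau>' * (away (fst z) * p)) \<in> relations) \<and>
        comp_edges (fst z) (snd z) \<noteq> {}"
        by (rule cycle_component_relations[OF z]) blast
    qed
    from bchoice[OF this] obtain \<epsilon> where e1: "\<And>z \<tau>. z \<in> cycles \<Longrightarrow> \<epsilon> z \<tau> = 1 \<or> \<epsilon> z \<tau> = (- 1 :: poly3)" and
      e2: "\<And>z f. z \<in> cycles \<Longrightarrow> (\<Sum>\<tau>\<in>comp_edges (fst z) (snd z). \<epsilon> z \<tau> * ((f :: (real^2) set \<Rightarrow> poly3) (fa \<tau>) - f (fb \<tau>))) = 0" and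
      e3: "\<And>z \<tau> \<tau>' p. z \<in> cycles \<Longrightarrow> \<tau> \<in> comp_edges (fst z) (snd z) \<Longrightarrow> \<tau>' \<in> comp_edges (fst z) (snd z) \<Longrightarrow>
         single_at \<tau> (\<epsilon> z \<tau> * (away (fst z) * p)) - single_at \<tau>' (\<epsilon> z \<tau>' * (away (fst z) * p)) \<in> relations" and
      e4: "\<And>z. z \<in> cycles \<Longrightarrow> comp_edges (fst z) (snd z) \<noteq> {}"
      by blast
    have "\<forall>z\<in>cycles. \<exists>\<tau>. \<tau> \<in> comp_edges (fst z) (snd z)" using e4 by blast
    from bchoice[OF this] obtain \<tau>0 where \<tau>0: "\<And>z. z \<in> cycles \<Longrightarrow> \<tau>0 z \<in> comp_edges (fst z) (snd z)"
      by blast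
    have esq: "\<epsilon> z \<tau> * \<epsilon> z \<tau> = 1" if "z \<in> cycles" for z \<tau> using e1[OF that, of \<tau>] by auto
    \<comment> \<open>The prospective basis modulo the relations: for each cycle,
      \<open>away\<close> of its point times the local representatives, placed at one chosen edge
      \<open>\<tau>0 z\<close>.\<close>
    let ?J = "Sigma cycles S"
    let ?g = "\<lambda>(z, s). single_at (\<tau>0 z) (away (fst z) * s)"
    have finJ: "finite ?J" using finite_cycles S(1) by blast
    have gV: "?g j \<in> edge_tuples k" if "j \<in> ?J" for j
    proof -
      obtain z s where j: "j = (z, s)" "z \<in> cycles" "s \<in> S z" using \<open>j \<in> ?J\<close> by (elim SigmaE)
      have "fst z \<in> points" using cycles_points[of "fst z" "snd z"] j(2) by simp
      then have "away_degree (fst z) + ?d z = k" using kd by simp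
      then have "homogeneous k (away (fst z) * s)"
        using homogeneous_mult[OF homogeneous_away S(2)[OF j(2,3)], of "fst z"] by simp
      moreover have "\<tau>0 z \<in> Edges" using \<tau>0[OF j(2)] by (simp add: comp_edges_def)
      ultimately show ?thesis unfolding j(1) by (simp add: graded_single_at)
    qed
    \<comment> \<open>Congruence modulo all relations to a combination of the prospective basis.
      That the remainder has degree k is restored at the end.\<close>
    define Q where "Q v \<longleftrightarrow> (\<exists>c. v - (\<Sum>j\<in>?J. tuple_scale (c j) (?g j)) \<in> relations)" for v
    have Q_rel: "Q v" if "v \<in> relations" for v
      unfolding Q_def
    proof (rule exI[of _ "\<lambda>_. 0"])
      have "(\<Sum>j\<in>?J. tuple_scale 0 (?g j)) = 0" by (intro sum.neutral ballI tuple.scale_zero_left)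
      then show "v - (\<Sum>j\<in>?J. tuple_scale 0 (?g j)) \<in> relations" using that by (simp only: diff_zero)
    qed
    have Q_add: "Q (v + w)" if v: "Q v" and w: "Q w" for v w
    proof -
      obtain c d where cd: "v - (\<Sum>j\<in>?J. tuple_scale (c j) (?g j)) \<in> relations"
        "w - (\<Sum>j\<in>?J. tuple_scale (d j) (?g j)) \<in> relations"
        using v w unfolding Q_def by blast
      have "(v + w) - (\<Sum>j\<in>?J. tuple_scale (c j + d j) (?g j))
          = (v - (\<Sum>j\<in>?J. tuple_scale (c j) (?g j))) + (w - (\<Sum>j\<in>?J. tuple_scale (d j) (?g j)))"
        by (simp only: tuple.scale_left_distrib sum.distrib add_diff_add)
      also have "\<dots> \<in> relations" using cd by (rule relations_add)
      finally show ?thesis unfolding Q_def by (rule exI[of _ "\<lambda>j. c j + d j"])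
    qed
    have Q_mod: "Q v" if "v - w \<in> relations" "Q w" for v w
      using Q_add[OF Q_rel[OF that(1)] that(2)] by (simp only: diff_add_cancel)
    have Q_sum: "Q (sum f I)" if "\<And>i. i \<in> I \<Longrightarrow> Q (f i)" for f and I :: "'i set"
      using that by (induction I rule: infinite_finite_induct) (auto intro: Q_add Q_rel[OF relations_0])
    have Q_cycle: "Q (single_at (\<tau>0 z) (away (fst z) * q))" if z: "z \<in> cycles" and q: "homogeneous (?d z) q" for z q
    proof -
      obtain c where c: "q - (\<Sum>s\<in>S z. const3 (c s) * s) \<in> local_ideal (fst z) (snd z)"
        using S(4)[OF z q] by blast
      \<comment> \<open>Members of I_\<psi> contribute nothing: the term belonging to the power of
        an edge \<tau> is moved along the cycle from \<open>\<tau>0 z\<close> to \<tau>, where it is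
        a multiple of that power. Inserting \<open>?e\<close> twice cancels its sign.\<close>
      have ideal: "single_at (\<tau>0 z) (away (fst z) * i) \<in> relations" if i: "i \<in> local_ideal (fst z) (snd z)" for i
      proof -
        obtain a where a: "i = (\<Sum>\<tau>\<in>comp_edges (fst z) (snd z). a \<tau> * lin (nv \<tau>) ^ Suc r)"
          using i unfolding local_ideal_def image_image ideal_image[OF finite_comp_edges] by blast
        have "single_at (\<tau>0 z) (away (fst z) * (a \<tau> * lin (nv \<tau>) ^ Suc r)) \<in> relations"
          if \<tau>: "\<tau> \<in> comp_edges (fst z) (snd z)" for \<tau>
        proof -
          let ?p = "a \<tau> * lin (nv \<tau>) ^ Suc r" and ?e = "\<epsilon> z (\<tau>0 z)" and ?e' = "\<epsilon> z \<tau>"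
          have E: "\<tau> \<in> Edges" using \<tau> by (simp add: comp_edges_def)
          have "single_at (\<tau>0 z) (?e * (away (fst z) * (?e * ?p))) - single_at \<tau> (?e' * (away (fst z) * (?e * ?p))) \<in> relations"
            by (rule e3[OF z \<tau>0[OF z] \<tau>])
          moreover have "single_at \<tau> (?e' * (away (fst z) * (?e * ?p))) \<in> relations"
            using relations_edge[OF E, of "?e' * (away (fst z) * (?e * a \<tau>))"] by (simp only: mult_ac)
          ultimately have "single_at (\<tau>0 z) (?e * (away (fst z) * (?e * ?p))) \<in> relations"
            using relations_add by (metis diff_add_cancel)
          moreover have "?e * (away (fst z) * (?e * ?p)) = (?e * ?e) * (away (fst z) * ?p)" by (simp only: mult_ac)
          ultimately show ?thesis using esq[OF z, of "\<tau>0 z"] by (simp only: mult_1_left)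
        qed
        then have "(\<Sum>\<tau>\<in>comp_edges (fst z) (snd z). single_at (\<tau>0 z) (away (fst z) * (a \<tau> * lin (nv \<tau>) ^ Suc r))) \<in> relations"
          by (rule relations_sum)
        then show ?thesis by (simp only: a sum_distrib_left single_at_sum)
      qed
      \<comment> \<open>The coefficients of one cycle, extended by 0 to the other cycles.\<close>
      define c' where "c' j = (if fst j = z then c (snd j) else 0)" for j :: "((real^3) set \<times> ((real^2) set, (real^2) set \<times> (real^2) set) pre_digraph) \<times> poly3"
      have "(\<Sum>j\<in>?J. tuple_scale (c' j) (?g j)) = (\<Sum>j\<in>Pair z ` S z. tuple_scale (c' j) (?g j))"
      proof (rule sum.mono_neutral_right[OF finJ])
        show "Pair z ` S z \<subseteq> ?J" using z by auto
        show "\<forall>j\<in>?J - Pair z ` S z. tuple_scale (c' j) (?g j) = 0"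
        proof
          fix j assume "j \<in> ?J - Pair z ` S z"
          then have "c' j = 0" by (auto simp: c'_def)
          then show "tuple_scale (c' j) (?g j) = 0" by (simp only: tuple.scale_zero_left)
        qed
      qed
      also have "\<dots> = (\<Sum>s\<in>S z. tuple_scale (c s) (single_at (\<tau>0 z) (away (fst z) * s)))"
        by (subst sum.reindex) (auto simp: inj_on_def c'_def)
      also have "\<dots> = single_at (\<tau>0 z) (away (fst z) * (\<Sum>s\<in>S z. const3 (c s) * s))"
        by (simp only: tuple_scale_single_at sum_distrib_left single_at_sum mult.left_commute)
      finally have "single_at (\<tau>0 z) (away (fst z) * q) - (\<Sum>j\<in>?J. tuple_scale (c' j) (?g j))
          = single_at (\<tau>0 z) (away (fst z) * (q - (\<Sum>s\<in>S z. const3 (c s) * s)))"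
        by (simp only: right_diff_distrib single_at_diff)
      also have "\<dots> \<in> relations" by (rule ideal[OF c])
      finally show ?thesis unfolding Q_def by (rule exI[of _ c'])
    qed
    \<comment> \<open>In a path component the tuple is a relation; in a cycle it can be moved to the
      chosen edge.\<close>
    have Q_away: "Q (single_at \<tau> (away \<xi> * q))"
      if \<tau>: "\<tau> \<in> Edges" "through \<xi> \<tau>" and \<xi>p: "\<xi> \<in> points" and q: "homogeneous (k - away_degree \<xi>) q" for \<tau> \<xi> q
    proof -
      have \<xi>: "codim2 \<xi>" by (rule points_codim2[OF \<xi>p])
      have "fa \<tau> \<in> pverts (xi_graph P l \<xi>)"
        unfolding pverts_iff[OF \<xi>] using ends_edge[OF \<tau>(1)] \<tau>(2) by blast
      then obtain \<psi> where \<psi>: "\<psi> \<in> pre_digraph.sccs (graph_at \<xi>)" "fa \<tau> \<in> verts \<psi>" by (rule scc_exists[OF \<xi>])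
      have \<tau>c: "\<tau> \<in> comp_edges \<xi> \<psi>" using \<tau> \<psi>(2) by (simp add: comp_edges_def)
      show ?thesis
      proof (cases "\<psi> \<in> circle_components P l \<xi>")
        case False
        show ?thesis by (rule Q_rel[OF path_component_relations[OF \<xi> \<psi>(1) False \<tau>c]])
      next
        case True
        define z where "z = (\<xi>, \<psi>)"
        have z: "z \<in> cycles" using True \<xi> by (simp add: z_def cycles_def)
        let ?e = "\<epsilon> z \<tau>" and ?e' = "\<epsilon> z (\<tau>0 z)"
        have "single_at \<tau> (?e * (away \<xi> * (?e * q))) - single_at (\<tau>0 z) (?e' * (away \<xi> * (?e * q))) \<in> relations"
          using e3[OF z, of \<tau> "\<tau>0 z" "?e * q"] \<tau>0[OF z] \<tau>c by (simp add: z_def)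
        moreover have "?e * (away \<xi> * (?e * q)) = (?e * ?e) * (away \<xi> * q)" by (simp only: mult_ac)
        then have "?e * (away \<xi> * (?e * q)) = away \<xi> * q" using esq[OF z, of \<tau>] by (simp only: mult_1_left)
        moreover have "?e' * (away \<xi> * (?e * q)) = away (fst z) * (?e' * (?e * q))" by (simp only: z_def fst_conv mult_ac)
        moreover have "homogeneous (?d z) (?e' * (?e * q))"
          using e1[OF z, of \<tau>] e1[OF z, of "\<tau>0 z"] q homogeneous_uminus[OF q] by (auto simp: z_def)
        then have "Q (single_at (\<tau>0 z) (away (fst z) * (?e' * (?e * q))))" by (rule Q_cycle[OF z])
        ultimately show ?thesis using Q_mod by metis
      qed
    qed
    \<comment> \<open>For k beyond \<open>K1 \<tau>\<close> the form splits over the points of the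
      line of \<tau>; passing to parts of degree k makes the coefficients homogeneous.\<close>
    have Q_edge: "Q (single_at \<tau> p)" if \<tau>: "\<tau> \<in> Edges" and p: "homogeneous k p" for \<tau> p
    proof -
      let ?X = "{\<xi> \<in> points. through \<xi> \<tau>}" and ?l = "lin (nv \<tau>) ^ Suc r"
      have fX: "finite ?X" using finite_points by simp
      obtain c0 where c0: "p - c0 * ?l \<in> ideal_gen (away ` ?X)"
        using K1[OF \<tau> kK1[OF \<tau>] p] unfolding ideal_insert by blast
      then obtain q where q: "p - c0 * ?l = (\<Sum>\<xi>\<in>?X. q \<xi> * away \<xi>)" using ideal_image[OF fX] by blast
      have "p = hpart k p" using p by (simp add: hpart_homogeneous[of k])
      also have "\<dots> = hpart k (?l * c0 + (\<Sum>\<xi>\<in>?X. away \<xi> * q \<xi>))"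
        using q by (simp add: algebra_simps del: power_Suc)
      also have "\<dots> = ?l * hpart (k - Suc r) c0 + (\<Sum>\<xi>\<in>?X. away \<xi> * hpart (k - away_degree \<xi>) (q \<xi>))"
      proof -
        have "hpart k (away \<xi> * q \<xi>) = away \<xi> * hpart (k - away_degree \<xi>) (q \<xi>)" if "\<xi> \<in> ?X" for \<xi>
          using hpart_mult[OF homogeneous_away, of "k - away_degree \<xi>" \<xi> "q \<xi>"] kd[of \<xi>] that by simp
        then show ?thesis by (simp add: hpart_add hpart_sum hpart_edge_mult[OF kr] del: power_Suc)
      qed
      finally have eq: "single_at \<tau> p = single_at \<tau> (?l * hpart (k - Suc r) c0)
          + (\<Sum>\<xi>\<in>?X. single_at \<tau> (away \<xi> * hpart (k - away_degree \<xi>) (q \<xi>)))"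
        by (metis single_at_add single_at_sum)
      show ?thesis unfolding eq
      proof (intro Q_add Q_sum)
        show "Q (single_at \<tau> (?l * hpart (k - Suc r) c0))" by (rule Q_rel[OF relations_edge[OF \<tau>]])
        show "Q (single_at \<tau> (away \<xi> * hpart (k - away_degree \<xi>) (q \<xi>)))" if "\<xi> \<in> ?X" for \<xi>
          using that by (intro Q_away \<tau>) auto
      qed
    qed
    have subU: "tuple.subspace ?U"
    proof -
      have "tuple_scale c x \<in> relations" if "x \<in> relations" for c x
        using relations_mult[OF that, of "const3 c"] by (simp add: tuple_scale_def)
      then have "tuple.subspace relations"
        unfolding tuple.subspace_def using relations_0 relations_add by blast
      then show ?thesis by (rule tuple.subspace_inter[OF _ subspace_graded])
    qed
    obtain T where T: "finite T" "edge_tuples k \<subseteq> tuple.span T" using graded_finite_span[OF finite_Edges] by blast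
    have "tuple.dim (edge_tuples k) = tuple.dim ?U + card ?J"
    proof (rule tuple.dim_mod_family[OF subU subspace_graded T])
      show "?U \<subseteq> edge_tuples k" by blast
      show "finite ?J" by (rule finJ)
      show "?g j \<in> edge_tuples k" if "j \<in> ?J" for j by (rule gV[OF that])
      show "\<exists>c. v - (\<Sum>j\<in>?J. tuple_scale (c j) (?g j)) \<in> ?U" if v: "v \<in> edge_tuples k" for v
      proof -
        have "Q (\<Sum>\<tau>\<in>Edges. single_at \<tau> (v \<tau>))"
          using v by (intro Q_sum Q_edge) (auto simp: graded_def)
        then have "Q v" using graded_expand[OF finite_Edges v] by simp
        then obtain c where "v - (\<Sum>j\<in>?J. tuple_scale (c j) (?g j)) \<in> relations" unfolding Q_def by blast
        moreover have "v - (\<Sum>j\<in>?J. tuple_scale (c j) (?g j)) \<in> edge_tuples k"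
          using gV by (intro tuple.subspace_diff[OF subspace_graded] v tuple.subspace_sum[OF subspace_graded]
              tuple.subspace_scale[OF subspace_graded])
        ultimately show ?thesis by blast
      qed
      show "\<forall>j\<in>?J. c j = 0" if rel: "(\<Sum>j\<in>?J. tuple_scale (c j) (?g j)) \<in> ?U" for c
      proof clarify
        fix \<xi> \<psi> s0 assume zc: "(\<xi>, \<psi>) \<in> cycles" and s0: "s0 \<in> S (\<xi>, \<psi>)"
        define z where "z = (\<xi>, \<psi>)"
        have z: "z \<in> cycles" using zc by (simp add: z_def)
        have \<xi>: "codim2 \<xi>" and \<psi>: "\<psi> \<in> circle_components P l \<xi>" using zc by (auto simp: cycles_def)
        let ?I = "local_ideal \<xi> \<psi>"
        have IS: "\<And>p q. p \<in> ?I \<Longrightarrow> q \<in> ?I \<Longrightarrow> p + q \<in> ?I" "\<And>a p. p \<in> ?I \<Longrightarrow> a * p \<in> ?I"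
          "\<And>p q. p \<in> ?I \<Longrightarrow> q \<in> ?I \<Longrightarrow> p - q \<in> ?I"
          unfolding local_ideal_def by (fact ideal_add ideal_mult ideal_diff)+
        \<comment> \<open>The signed sum along the fixed cycle. It sends the given combination,
          which is a relation, into I_\<psi> and isolates the coefficients belonging to this
          cycle.\<close>
        define \<Phi> where "\<Phi> x = (\<Sum>\<tau>\<in>comp_edges \<xi> \<psi>. \<epsilon> z \<tau> * x \<tau>)" for x :: "(real^2) set \<Rightarrow> poly3"
        have \<Phi>_sum: "\<Phi> (sum f I) = (\<Sum>i\<in>I. \<Phi> (f i))" for f and I :: "(((real^3) set \<times> ((real^2) set, (real^2) set \<times> (real^2) set) pre_digraph) \<times> poly3) set"
          unfolding \<Phi>_def by (simp only: sum_fun_apply sum_distrib_left) (rule sum.swap)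
        have \<Phi>_scale: "\<Phi> (tuple_scale a x) = const3 a * \<Phi> x" for a x
          unfolding \<Phi>_def tuple_scale_apply sum_distrib_left by (simp only: mult.left_commute)
        have \<Phi>_single: "\<Phi> (single_at \<tau> p) = (if \<tau> \<in> comp_edges \<xi> \<psi> then \<epsilon> z \<tau> * p else 0)" for \<tau> p
        proof -
          have "\<Phi> (single_at \<tau> p) = (\<Sum>\<tau>'\<in>comp_edges \<xi> \<psi>. if \<tau>' = \<tau> then \<epsilon> z \<tau> * p else 0)"
            unfolding \<Phi>_def by (intro sum.cong) (auto simp: single_at_def)
          then show ?thesis using finite_comp_edges[of \<xi> \<psi>] by simp
        qed
        have mem: "\<Phi> (\<Sum>j\<in>?J. tuple_scale (c j) (?g j)) \<in> ?I"
          unfolding \<Phi>_def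
          by (rule relations_component_sum) (use e2[OF z] rel in \<open>auto simp: z_def\<close>)
        have "\<Phi> (\<Sum>j\<in>?J. tuple_scale (c j) (?g j)) = (\<Sum>j\<in>?J. const3 (c j) * \<Phi> (?g j))"
          by (simp only: \<Phi>_sum \<Phi>_scale)
        also have "\<dots>
            = (\<Sum>j\<in>?J - Pair z ` S z. const3 (c j) * \<Phi> (?g j)) + (\<Sum>j\<in>Pair z ` S z. const3 (c j) * \<Phi> (?g j))"
          by (rule sum.subset_diff[OF _ finJ]) (use z in auto)
        finally have split: "(\<Sum>j\<in>Pair z ` S z. const3 (c j) * \<Phi> (?g j))
            = \<Phi> (\<Sum>j\<in>?J. tuple_scale (c j) (?g j)) - (\<Sum>j\<in>?J - Pair z ` S z. const3 (c j) * \<Phi> (?g j))"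
          by (simp only: add_diff_cancel_left')
        \<comment> \<open>Other cycles at the same point use disjoint edges and give 0; those at
          another point carry its \<open>away\<close> as a factor, which lies in I_\<psi>.\<close>
        have others: "(\<Sum>j\<in>?J - Pair z ` S z. const3 (c j) * \<Phi> (?g j)) \<in> ?I"
        proof -
          have "const3 (c j) * \<Phi> (?g j) \<in> ?I" if "j \<in> ?J - Pair z ` S z" for j
          proof -
            obtain \<xi>' \<psi>' s where j: "j = ((\<xi>', \<psi>'), s)" "(\<xi>', \<psi>') \<in> cycles" "s \<in> S (\<xi>', \<psi>')" "(\<xi>', \<psi>') \<noteq> z"
              using \<open>j \<in> ?J - Pair z ` S z\<close> by auto
            have \<xi>': "codim2 \<xi>'" and \<psi>': "\<psi>' \<in> circle_components P l \<xi>'" using j(2) by (auto simp: cycles_def)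
            have "\<Phi> (?g j) \<in> ?I"
            proof (cases "\<xi>' = \<xi>")
              case True
              have "\<tau>0 (\<xi>', \<psi>') \<notin> comp_edges \<xi> \<psi>"
              proof
                assume "\<tau>0 (\<xi>', \<psi>') \<in> comp_edges \<xi> \<psi>"
                then have "fa (\<tau>0 (\<xi>', \<psi>')) \<in> verts \<psi>" "fa (\<tau>0 (\<xi>', \<psi>')) \<in> verts \<psi>'"
                  using \<tau>0[OF j(2)] by (auto simp: comp_edges_def)
                then have "\<psi> = \<psi>'" using scc_disjoint[OF \<xi> circle_scc[OF \<psi>]] circle_scc[OF \<psi>'] True by blast
                then show False using j(4) True by (simp add: z_def)
              qed
              then have "\<Phi> (?g j) = 0" by (simp add: j(1) \<Phi>_single)
              then show ?thesis by (simp add: local_ideal_def ideal_0)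
            next
              case False
              have "away \<xi>' \<in> ?I" by (rule away_in_local_ideal[OF zc \<xi>' False])
              then have "(\<epsilon> z (\<tau>0 (\<xi>', \<psi>')) * s) * away \<xi>' \<in> ?I" by (rule IS(2))
              moreover have "(\<epsilon> z (\<tau>0 (\<xi>', \<psi>')) * s) * away \<xi>' = \<epsilon> z (\<tau>0 (\<xi>', \<psi>')) * (away \<xi>' * s)"
                by (simp only: mult_ac)
              ultimately show ?thesis by (simp add: j(1) \<Phi>_single local_ideal_def ideal_0)
            qed
            then show ?thesis by (rule IS(2))
          qed
          then show ?thesis unfolding local_ideal_def by (rule ideal_sum)
        qed
        have "(\<Sum>j\<in>Pair z ` S z. const3 (c j) * \<Phi> (?g j)) \<in> ?I"
          unfolding split by (rule IS(3)[OF mem others])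
        also have "(\<Sum>j\<in>Pair z ` S z. const3 (c j) * \<Phi> (?g j)) = \<epsilon> z (\<tau>0 z) * (away \<xi> * (\<Sum>s\<in>S z. const3 (c (z, s)) * s))"
        proof -
          have "(\<Sum>j\<in>Pair z ` S z. const3 (c j) * \<Phi> (?g j)) = (\<Sum>s\<in>S z. const3 (c (z, s)) * \<Phi> (single_at (\<tau>0 z) (away \<xi> * s)))"
            by (subst sum.reindex) (auto simp: inj_on_def z_def)
          also have "\<dots> = (\<Sum>s\<in>S z. \<epsilon> z (\<tau>0 z) * (away \<xi> * (const3 (c (z, s)) * s)))"
            using \<tau>0[OF z] by (intro sum.cong refl) (simp add: \<Phi>_single z_def mult_ac)
          finally show ?thesis by (simp only: sum_distrib_left)
        qed
        \<comment> \<open>Multiplying by the sign again removes it, and \<open>away \<xi>\<close>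
          cancels modulo I_\<psi>; what remains is a relation among the representatives S in R /
          I_\<psi>.\<close>
        finally have "\<epsilon> z (\<tau>0 z) * (\<epsilon> z (\<tau>0 z) * (away \<xi> * (\<Sum>s\<in>S z. const3 (c (z, s)) * s))) \<in> ?I"
          by (rule IS(2))
        then have "away \<xi> * (\<Sum>s\<in>S z. const3 (c (z, s)) * s) \<in> ?I"
          using esq[OF z, of "\<tau>0 z"] by (simp add: mult.assoc[symmetric])
        then have "(\<Sum>s\<in>S z. const3 (c (z, s)) * s) \<in> ?I" by (rule away_cancel[OF \<xi>])
        then have "\<forall>s\<in>S z. c (z, s) = 0"
          using S(5)[OF z, of "\<lambda>s. c (z, s)"] by (simp add: z_def)
        then show "c ((\<xi>, \<psi>), s0) = 0" using s0 by (simp add: z_def)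
      qed
    qed
    moreover have "real (card ?J) = (\<Sum>(\<xi>, \<psi>)\<in>cycles. c_const r (min_gens (local_ideal \<xi> \<psi>)))"
    proof -
      have "real (card ?J) = (\<Sum>z\<in>cycles. real (card (S z)))"
        using finite_cycles S(1) by (simp add: card_SigmaI)
      also have "\<dots> = (\<Sum>z\<in>cycles. ?C z)" using S(3) by (intro sum.cong refl)
      finally show ?thesis by (simp add: split_def)
    qed
    ultimately show "real (tuple.dim (edge_tuples k))
       = real (tuple.dim ?U) + (\<Sum>(\<xi>, \<psi>)\<in>cycles. c_const r (min_gens (local_ideal \<xi> \<psi>)))"
      by simp
  qed
qed

section \<open>The Hilbert polynomial\<close>

lemma sum_Suc: "real (\<Sum>j\<le>k. Suc j) = (real k + 1) * (real k + 2) / 2"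
  by (induction k) (auto simp: field_simps)

text \<open>The rank is the dimension of all edge tuples minus the sum of the c_\<psi>. The two edge
  terms agree in their quadratic parts, so their difference contributes only -(r + 1) k + binom(r,
  2) - 1 per interior edge.\<close>

lemma spline_dim_eventually:
  "\<exists>K. \<forall>k\<ge>K. real (spline_dim r P l k) = real (card Faces) / 2 * (real k)\<^sup>2
     + (3 * real (card Faces) - 2 * (real r + 1) * real (card Edges)) / 2 * real k
     + real (card Faces) + ((real r gchoose 2) - 1) * real (card Edges)
     + (\<Sum>(\<xi>, \<psi>)\<in>cycles. c_const r (min_gens (local_ideal \<xi> \<psi>)))"
proof -
  obtain K where K: "\<And>k. K \<le> k \<Longrightarrow> real (tuple.dim (edge_tuples k))
     = real (tuple.dim (relations \<inter> edge_tuples k)) + (\<Sum>(\<xi>, \<psi>)\<in>cycles. c_const r (min_gens (local_ideal \<xi> \<psi>)))"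
    using dim_edge_tuples by blast
  show ?thesis
  proof (intro exI[of _ "K + Suc r"] allI impI)
    fix k assume k: "K + Suc r \<le> k"
    then have kr: "Suc r \<le> k" and kK: "K \<le> k" by auto
    define F E C where "F = real (card Faces)" and "E = real (card Edges)"
      and "C = (\<Sum>(\<xi>, \<psi>)\<in>cycles. c_const r (min_gens (local_ideal \<xi> \<psi>)))"
    have "real (tuple.dim (edge_tuples k)) = E * real (\<Sum>j\<le>k. Suc j)"
      by (simp add: dim_graded[OF finite_Edges] dim_homogeneous E_def)
    then have 1: "real (tuple.dim (relations \<inter> edge_tuples k)) = E * ((real k + 1) * (real k + 2) / 2) - C"
      using K[OF kK] unfolding sum_Suc C_def by simp
    have "real (spline_dim r P l k) + real (tuple.dim (relations \<inter> edge_tuples k))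
        = F * real (\<Sum>j\<le>k. Suc j) + E * real (\<Sum>j\<le>k - Suc r. Suc j)"
      using arg_cong[OF spline_dim_relations[OF kr], of real] by (simp only: F_def E_def of_nat_add of_nat_mult)
    \<comment> \<open>An edge multiplier has degree k - r - 1 and so contributes (k - r) (k - r + 1)
      / 2 dimensions.\<close>
    also have "\<dots> = F * ((real k + 1) * (real k + 2) / 2) + E * ((real k - real r) * (real k - real r + 1) / 2)"
      unfolding sum_Suc using kr by (simp add: of_nat_diff)
    finally have "real (spline_dim r P l k) = F * ((real k + 1) * (real k + 2) / 2)
        + E * ((real k - real r) * (real k - real r + 1) / 2) - E * ((real k + 1) * (real k + 2) / 2) + C"
      using 1 by simp
    then show "real (spline_dim r P l k) = real (card Faces) / 2 * (real k)\<^sup>2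
     + (3 * real (card Faces) - 2 * (real r + 1) * real (card Edges)) / 2 * real k
     + real (card Faces) + ((real r gchoose 2) - 1) * real (card Edges)
     + (\<Sum>(\<xi>, \<psi>)\<in>cycles. c_const r (min_gens (local_ideal \<xi> \<psi>)))"
      unfolding F_def[symmetric] E_def[symmetric] C_def[symmetric]
      by (simp add: gbinomial_2 field_simps power2_eq_square)
  qed
qed

end

text \<open>Two candidates agree at all large integers, so their difference has infinitely many
  roots. This justifies the definite description.\<close>

lemma hilbert_polynomial_unique:
  assumes "is_hilbert_polynomial H p"
  shows "hilbert_polynomial H = p"
  unfolding hilbert_polynomial_def
proof (rule the_equality, rule assms)
  fix q assume "is_hilbert_polynomial H q"
  then have "\<forall>\<^sub>F k in sequentially. poly (q - p) (real k) = 0"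
    using assms unfolding is_hilbert_polynomial_def by eventually_elim simp
  then obtain K where K: "\<And>k. K \<le> k \<Longrightarrow> poly (q - p) (real k) = 0" by (auto simp: eventually_sequentially)
  have "infinite {x. poly (q - p) x = 0}"
  proof
    assume "finite {x. poly (q - p) x = 0}"
    then have "finite (real ` {K..})" using K by (elim finite_subset[rotated]) auto
    then show False using finite_imageD[of real "{K..}"] infinite_Ici by (auto simp: inj_on_def)
  qed
  then have "q - p = 0" using poly_roots_finite by blast
  then show "q = p" by simp
qed

theorem corollary3p13:
  fixes P :: "(real^2) set set"
    and r :: nat
    and l :: "(real^2) set \<Rightarrow> poly3"
  assumes "planar_polyhedral_complex P"
    and "hereditary P"
    and "edge_forms P l"
  defines "f2 \<equiv> real (card (faces_of_dim 2 P))"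
    and "f10 \<equiv> real (card (interior_edges P))"
    and "HP \<equiv> hilbert_polynomial (spline_dim r P l)"
    and "n \<equiv> (\<lambda>\<xi> \<psi>. min_gens (psi_ideal r P l \<xi> \<psi>))"
    and "\<Xi> \<equiv> {\<xi>. codim2 \<xi> \<and> circle_components P l \<xi> \<noteq> {}}"
  shows "is_hilbert_polynomial (spline_dim r P l) HP \<and>
    finite \<Xi> \<and>
    (\<forall>k::real. poly HP k =
       f2 / 2 * k^2 + (3 * f2 - 2 * (real r + 1) * f10) / 2 * k
       + f2 + ((real r gchoose 2) - 1) * f10
       + (\<Sum>\<xi>\<in>\<Xi>. \<Sum>\<psi>\<in>circle_components P l \<xi>. c_const r (n \<xi> \<psi>))) \<and>
    (\<forall>\<xi> \<psi>. codim2 \<xi> \<and> \<psi> \<in> circle_components P l \<xi> \<longrightarrow>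
       c_const r (n \<xi> \<psi>) =
         (real (r + 2) gchoose 2)
         + alpha r (n \<xi> \<psi>) / 2 *
             (2 * real r + 3 + alpha r (n \<xi> \<psi>)
              - real (n \<xi> \<psi>) * (1 + alpha r (n \<xi> \<psi>))))"
proof -
  interpret spline_setting P l r by unfold_locales (rule assms)+
  have fin\<Xi>: "finite \<Xi>"
  proof (rule finite_subset[OF _ finite_points])
    show "\<Xi> \<subseteq> points" using cycles_points by (auto simp: \<Xi>_def cycles_def)
  qed
  \<comment> \<open>Subspaces without circle components contribute no pairs, so the sum over pairs
    becomes the iterated sum over \<Xi>.\<close>
  have cyc: "cycles = Sigma \<Xi> (\<lambda>\<xi>. circle_components P l \<xi>)" by (auto simp: cycles_def \<Xi>_def)
  have fincc: "finite (circle_components P l \<xi>)" if "\<xi> \<in> \<Xi>" for \<xi>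
    using finite_sccs that by (auto simp: \<Xi>_def circle_components_def)
  have C: "(\<Sum>(\<xi>, \<psi>)\<in>cycles. c_const r (min_gens (local_ideal \<xi> \<psi>)))
      = (\<Sum>\<xi>\<in>\<Xi>. \<Sum>\<psi>\<in>circle_components P l \<xi>. c_const r (n \<xi> \<psi>))"
  proof -
    have "(\<Sum>\<xi>\<in>\<Xi>. \<Sum>\<psi>\<in>circle_components P l \<xi>. c_const r (n \<xi> \<psi>))
        = (\<Sum>\<xi>\<in>\<Xi>. \<Sum>\<psi>\<in>circle_components P l \<xi>. c_const r (min_gens (local_ideal \<xi> \<psi>)))"
      by (intro sum.cong refl) (auto simp: n_def \<Xi>_def psi_ideal_eq)
    also have "\<dots> = (\<Sum>(\<xi>, \<psi>)\<in>cycles. c_const r (min_gens (local_ideal \<xi> \<psi>)))"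
      unfolding cyc using fin\<Xi> fincc by (intro sum.Sigma) auto
    finally show ?thesis ..
  qed
  define p where "p = [: f2 + ((real r gchoose 2) - 1) * f10
       + (\<Sum>\<xi>\<in>\<Xi>. \<Sum>\<psi>\<in>circle_components P l \<xi>. c_const r (n \<xi> \<psi>)),
     (3 * f2 - 2 * (real r + 1) * f10) / 2, f2 / 2 :]"
  have p: "poly p k = f2 / 2 * k^2 + (3 * f2 - 2 * (real r + 1) * f10) / 2 * k
       + f2 + ((real r gchoose 2) - 1) * f10
       + (\<Sum>\<xi>\<in>\<Xi>. \<Sum>\<psi>\<in>circle_components P l \<xi>. c_const r (n \<xi> \<psi>))" for k
    by (simp add: p_def algebra_simps power2_eq_square)
  have hp: "is_hilbert_polynomial (spline_dim r P l) p"
  proof -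
    obtain K where "\<And>k. K \<le> k \<Longrightarrow> real (spline_dim r P l k) = poly p (real k)"
      using spline_dim_eventually unfolding C p f2_def f10_def by blast
    then show ?thesis
      unfolding is_hilbert_polynomial_def eventually_sequentially by (intro exI[of _ K]) simp
  qed
  then have "HP = p" unfolding HP_def by (rule hilbert_polynomial_unique)
  then show ?thesis using hp fin\<Xi> p c_const_closed_form by simp
qed

end
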